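(* Let $\Gamma=\mathrm{Sp}(2n,\mathbb{Z})$ with $n\ge 1$, or $\Gamma=\mathrm{SL}(n,\mathbb{Z})$ with $n\ge 2$. Let $G$ be a finite undirected multigraph with vertices $v_1,\dots,v_m$, each vertex $v_i$ being decorated with an element $t_i\in\Gamma$, such that $\{t_1,\dots,t_m\}$ generates $\Gamma$. Assume that: (1) the adjacency matrix $A(G)$ is a Perron–Frobenius matrix, i.e. it has a unique eigenvalue of maximal modulus and some power $A(G)^k$ has all entries positive; (2) for every nontrivial one-dimensional unitary representation $\rho$ of $\Gamma$ there exist $1\le i,j\le m$ such that $\rho(t_i)\ne\rho(t_j)$. Then, for a walk $w$ chosen uniformly at random among all walks of length $N$ on $G$, the probability that the matrix $\gamma_w\in\Gamma$ has characteristic polynomial reducible over $\mathbb{Z}$ tends to $0$ as $N\to\infty$.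
   Context: A walk $w=(v_{i_1},v_{i_2},\dots,v_{i_N})$ of length $N$ on $G$ is a sequence of vertices with consecutive vertices joined by an edge (loops are allowed, and walks are counted with edge multiplicity). To $w$ one associates the product $\gamma_w=t_{i_N}\cdots t_{i_2}t_{i_1}\in\Gamma$. $\mathrm{Sp}(2n,\mathbb{Z})$ is the group of $2n\times 2n$ integer matrices $M$ with $M^tJM=J$, $J=\begin{pmatrix}0&I_n\\-I_n&0\end{pmatrix}$. *)

theory Defs
  imports
    "HOL-Library.Uprod"
    "HOL-Algebra.Generated_Groups"
    "HOL-Probability.Probability_Mass_Function"
    "Jordan_Normal_Form.Char_Poly"
begin

definition SL :: "nat \<Rightarrow> int mat monoid" where
  "SL n = \<lparr>carrier = {M \<in> carrier_mat n n. Determinant.det M = 1}, monoid.mult = (*), one = 1\<^sub>m n\<rparr>"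

definition J_mat :: "nat \<Rightarrow> int mat" where
  "J_mat n = four_block_mat (0\<^sub>m n n) (1\<^sub>m n) (- 1\<^sub>m n) (0\<^sub>m n n)"

(* Sp n consists of (2n) x (2n) matrices. *)
definition Sp :: "nat \<Rightarrow> int mat monoid" where
  "Sp n = \<lparr>carrier = {M \<in> carrier_mat (2 * n) (2 * n). M\<^sup>T * J_mat n * M = J_mat n},
           monoid.mult = (*), one = 1\<^sub>m (2 * n)\<rparr>"

definition U1 :: "complex monoid" where
  "U1 = \<lparr>carrier = {z. cmod z = 1}, monoid.mult = (*), one = 1\<rparr>"

(* Homomorphisms are total functions on the type, so triviality is tested on the carrier only. *)
definition nontrivial_unitary_character :: "('a, 'b) monoid_scheme \<Rightarrow> ('a \<Rightarrow> complex) \<Rightarrow> bool" where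
  "nontrivial_unitary_character \<Gamma> \<rho> \<longleftrightarrow> \<rho> \<in> hom \<Gamma> U1 \<and> (\<exists>g\<in>carrier \<Gamma>. \<rho> g \<noteq> 1)"

(* Vertices are 0, ..., nverts - 1, so that they index the rows of the adjacency matrix;
   index i stands for v_(i+1).  Parallel edges are distinct elements of edges with the
   same end points; e is a loop at i if ends e = Upair i i. *)
record 'e multigraph =
  nverts :: nat
  edges :: "'e set"
  ends :: "'e \<Rightarrow> nat uprod"

definition finite_multigraph :: "'e multigraph \<Rightarrow> bool" where
  "finite_multigraph G \<longleftrightarrow> finite (edges G) \<and> (\<forall>e\<in>edges G. set_uprod (ends G e) \<subseteq> {..<nverts G})"

(* A loop contributes 1 to its diagonal entry, so every symmetric matrix over nat arises
   as an adjacency matrix, including those in which loops are counted twice. *)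
definition adj_matrix :: "'e multigraph \<Rightarrow> nat mat" where
  "adj_matrix G = mat (nverts G) (nverts G) (\<lambda>(i, j). card {e \<in> edges G. ends G e = Upair i j})"

definition perron_frobenius_matrix :: "nat mat \<Rightarrow> bool" where
  "perron_frobenius_matrix A \<longleftrightarrow>
     (let A\<^sub>C = map_mat of_nat A :: complex mat in
        \<exists>!l. eigenvalue A\<^sub>C l \<and> (\<forall>\<mu>. eigenvalue A\<^sub>C \<mu> \<longrightarrow> cmod \<mu> \<le> cmod l)) \<and>
     (\<exists>k>0. \<forall>i<dim_row A. \<forall>j<dim_col A. (A ^\<^sub>m k) $$ (i, j) > 0)"

(* A walk of length N has N vertices vs and N - 1 steps.  Recording the edges es used in
   the steps makes walks counted with edge multiplicity. *)
definition walks :: "'e multigraph \<Rightarrow> nat \<Rightarrow> (nat list \<times> 'e list) set" where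
  "walks G N = {(vs, es). length vs = N \<and> set vs \<subseteq> {..<nverts G} \<and> length es = N - 1 \<and>
     (\<forall>k<N - 1. es ! k \<in> edges G \<and> ends G (es ! k) = Upair (vs ! k) (vs ! Suc k))}"

(* fold multiplies each new factor on the left: the first vertex is the rightmost factor. *)
definition walk_prod :: "('a, 'b) monoid_scheme \<Rightarrow> (nat \<Rightarrow> 'a) \<Rightarrow> nat list \<times> 'e list \<Rightarrow> 'a" where
  "walk_prod \<Gamma> t w = fold (\<lambda>i g. t i \<otimes>\<^bsub>\<Gamma>\<^esub> g) (fst w) \<one>\<^bsub>\<Gamma>\<^esub>"

end

theory Submission
  imports Defs "Berlekamp_Zassenhaus.Distinct_Degree_Factorization"
begin

text \<open>
  Let $f$ be the characteristic polynomial of an element $\gamma$ of $\Gamma$, so that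
  $f$ is monic and $f(0) = \pm 1$. Suppose that modulo some prime $p$ it becomes $q r$ with
  $q$ and $r$ irreducible, $q$ monic and $q(0) \neq \pm 1$. Then $f$ is irreducible over the
  integers. In a factorisation $f = u v$ both constant terms are $\pm 1$. If neither factor
  were constant, one of them would reduce to $\pm q$, whose constant term is not $\pm 1$
  modulo $p$. This is the lemma \<open>irreducible_if_certified\<close>.

  Elements certified in this way are not rare, uniformly in $p$. They include the conjugates
  of $\mathrm{diag}(C, \theta(C))$, where $C$ is a $d \times d$ matrix with irreducible
  characteristic polynomial and determinant other than $\pm 1$. For $\mathrm{SL}(n)$ one
  takes $d = n - 1$ and $\theta(C) = 1 / \det C$; for $\mathrm{Sp}(2n)$ one takes $d = n$ and
  $\theta(C)$ the inverse transpose of $C$. The centraliser of such an element is determined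
  by the matrices that commute with $C$, of which there are at most $p^d$, and about $p^d / d$
  irreducible polynomials are available for $C$. So the certified elements form at least the
  fraction $1 / (4 d)$ of the finite group as soon as $p \geq 8 d$ (\<open>card_certified\<close>).

  Different primes are independent. Modulo $p$ the group is generated by elementary matrices
  (\<open>sl_elementary_induct\<close>) or by transvections (\<open>sp_transvection_induct\<close>). These come in
  one-parameter families that are defined over the integers, so the integer parameter can be
  prescribed modulo $p$ and taken to be $0$ modulo the other primes. Hence $\Gamma$ maps onto
  the product of its reductions modulo any finite set of primes (\<open>simultaneous_reduction\<close>).

  The walk becomes equidistributed in every finite set on which $\Gamma$ acts transitively
  (\<open>walk_equidistribution\<close>), in particular in that product. For $k$ primes the limiting
  proportion of walks that no prime certifies is therefore at most $(1 - 1 / (4 d))^k$, and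
  $k$ is arbitrary.

  For the equidistribution, the points that can be reached from a given start in $k$ steps
  ending at $v$ form a set whose size stabilises as $k$ grows. Since the graph is undirected
  and its adjacency matrix has a positive power, that set then no longer depends on $v$, and
  every generator $t_v$ moves the $k$-th set to the next one. The sequence of sets is periodic;
  if the period were $r > 1$, mapping all $t_v$ to $e^{2 \pi i / r}$ would define a character
  forbidden by the second hypothesis. So the sets are invariant under the group, everything is
  reachable, and the weights of the walks contract towards uniform ones
  (\<open>nearly_uniform_contraction\<close>).

  The argument modulo $p$ lives in a type with $p$ elements. It yields a statement about
  integers for each prime that is the size of a type. To reach all primes, a type is introduced
  whose size is a prime violating that statement, should there be one.
\<close>

unbundle no inner_syntax
unbundle no vec_syntax
hide_const (open) Divisibility.irreducible Determinants.det

section \<open>Equidistribution of walks on a group action\<close>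

lemma relpow_double: "R ^^ (k + k) = (R O R) ^^ k"
  by (induction k) (simp_all add: O_assoc)

text \<open>
  A walk on the vertices below \<open>m\<close>, with \<open>A u v\<close> edges between \<open>u\<close> and \<open>v\<close>, carries along a
  point of \<open>X\<close>, which is moved by \<open>\<sigma> v\<close> at each arrival at \<open>v\<close>. The last assumption is the
  form in which the absence of characters enters: sets on which all generators act as one and
  the same shift do not move at all.
\<close>

locale permutation_walk =
  fixes m :: nat and A :: "nat \<Rightarrow> nat \<Rightarrow> nat" and X :: "'x set" and \<sigma> :: "nat \<Rightarrow> 'x \<Rightarrow> 'x"
  assumes fin: "finite X"
    and perm: "v < m \<Longrightarrow> bij_betw (\<sigma> v) X X"
    and sym: "A u v = A v u"
    and prim: "\<exists>k>0. \<forall>u<m. \<forall>v<m. (u, v) \<in> {(u, v). u < m \<and> v < m \<and> A u v > 0} ^^ k"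
    and trans: "\<lbrakk>S \<subseteq> X; S \<noteq> {}; \<And>v. v < m \<Longrightarrow> \<sigma> v ` S = S\<rbrakk> \<Longrightarrow> S = X"
    and shift_fixed: "\<lbrakk>\<And>k. T k \<subseteq> X; \<And>k v. v < m \<Longrightarrow> \<sigma> v ` T k = T (Suc k)\<rbrakk> \<Longrightarrow> T 1 = T 0"
begin

definition adj :: "(nat \<times> nat) set" where
  "adj = {(u, v). u < m \<and> v < m \<and> A u v > 0}"

text \<open>
  The transfer operator: if \<open>F v x\<close> is the number of walks that end at \<open>v\<close> with the point at \<open>x\<close>,
  then \<open>step F\<close> counts in the same way the walks with one more vertex.
\<close>

definition step :: "(nat \<Rightarrow> 'x \<Rightarrow> real) \<Rightarrow> nat \<Rightarrow> 'x \<Rightarrow> real" where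
  "step F v x = (\<Sum>u<m. real (A u v) * F u (inv_into X (\<sigma> v) x))"

text \<open>
  The start vertex \<open>u\<close> does not move the point, so that \<open>reach u x k\<close> is the support of
  \<open>step ^^ k\<close> applied to a unit weight at \<open>(u, x)\<close>.
\<close>

fun reach :: "nat \<Rightarrow> 'x \<Rightarrow> nat \<Rightarrow> nat \<Rightarrow> 'x set" where
  "reach u x 0 v = (if v = u then {x} else {})"
| "reach u x (Suc k) v = \<sigma> v ` (\<Union>w\<in>{w. (w, v) \<in> adj}. reach u x k w)"

lemma adj_sym: "(u, v) \<in> adj \<longleftrightarrow> (v, u) \<in> adj"
  using sym by (auto simp: adj_def)

lemma reach_subset:
  assumes "x \<in> X" "v < m"
  shows "reach u x k v \<subseteq> X"
  using assms(2)
proof (induction k arbitrary: v)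
  case (Suc k)
  have "(\<Union>w\<in>{w. (w, v) \<in> adj}. reach u x k w) \<subseteq> X"
    using Suc.IH by (auto simp: adj_def)
  then show ?case using perm[OF Suc.prems] by (auto simp: bij_betw_def)
qed (use assms in auto)

lemma card_reach_step:
  assumes "x \<in> X" "(w, v) \<in> adj"
  shows "\<sigma> v ` reach u x k w \<subseteq> reach u x (Suc k) v"
    and "card (\<sigma> v ` reach u x k w) = card (reach u x k w)"
proof -
  have w: "w < m" "v < m" using assms by (auto simp: adj_def)
  show "\<sigma> v ` reach u x k w \<subseteq> reach u x (Suc k) v" using assms by auto
  show "card (\<sigma> v ` reach u x k w) = card (reach u x k w)"
    using perm[OF w(2)] reach_subset[OF assms(1) w(1), of u k]
    by (intro card_image) (auto simp: bij_betw_def inj_on_def)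
qed

lemma card_reach_mono:
  assumes "x \<in> X" "(w, v) \<in> adj ^^ k" "v < m"
  shows "card (reach u x j w) \<le> card (reach u x (j + k) v)"
  using assms(2,3)
proof (induction k arbitrary: v)
  case (Suc k)
  then obtain v' where v': "(w, v') \<in> adj ^^ k" "(v', v) \<in> adj" by auto
  then have "v' < m" by (auto simp: adj_def)
  from Suc.IH[OF v'(1) this] card_reach_step[OF assms(1) v'(2), of u "j + k"]
  show ?case
    by (metis add_Suc_right card_mono fin finite_subset le_trans reach_subset[OF assms(1) Suc.prems(2)])
qed auto

text \<open>
  Each step maps \<open>reach u x k w\<close> injectively into \<open>reach u x (Suc k) v\<close> for every neighbour \<open>v\<close>
  of \<open>w\<close>. So the sizes can only grow, and once the maximal size is attained somewhere, it is
  attained at all vertices after \<open>k0\<close> more steps. From then on these maps are onto, and two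
  neighbours of one vertex have the same reachable set. Any two vertices are joined by a walk
  of even length, so the sets do not depend on the vertex at all.
\<close>

lemma reach_eventually_everything:
  assumes x: "x \<in> X" and u: "u < m"
  shows "\<exists>K. \<forall>k\<ge>K. \<forall>v<m. reach u x k v = X"
proof -
  obtain k0 where k0: "k0 > 0" "\<And>u v. u < m \<Longrightarrow> v < m \<Longrightarrow> (u, v) \<in> adj ^^ k0"
    using prim unfolding adj_def by blast
  have nbr: "\<exists>w. (w, v) \<in> adj" if v: "v < m" for v
    using k0(1) k0(2)[OF v v] by (cases k0) auto
  \<comment> \<open>the maximal size \<open>M\<close> of a reachable set, attained at \<open>(k1, w1)\<close>\<close>
  define C where "C = {card (reach u x k v) | k v. v < m}"
  have "C \<subseteq> {..card X}"
    using reach_subset[OF x] by (auto simp: C_def card_mono fin)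
  then have finC: "finite C" by (rule finite_subset) auto
  have inC: "card (reach u x k v) \<in> C" if "v < m" for k v using that by (auto simp: C_def)
  define M where "M = Max C"
  have M: "card (reach u x k v) \<le> M" if "v < m" for k v
    unfolding M_def by (rule Max_ge[OF finC inC[OF that]])
  have "M \<in> C" unfolding M_def using inC[OF u] finC by (intro Max_in) auto
  then obtain k1 w1 where k1: "w1 < m" "card (reach u x k1 w1) = M" by (auto simp: C_def)
  have "card (reach u x 0 u) \<le> M" by (rule M[OF u])
  then have "M > 0" by simp
  have cardM: "card (reach u x k v) = M" if "k \<ge> k1 + k0" "v < m" for k v
    using that
  proof (induction k arbitrary: v rule: dec_induct)
    case base
    show ?case using card_reach_mono[OF x k0(2)[OF k1(1) base] base, of u k1] M[OF base, of "k1 + k0"] k1(2) by simp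
  next
    case (step k)
    obtain w where w: "(w, v) \<in> adj" using nbr step.prems by auto
    then have "w < m" by (auto simp: adj_def)
    have "(w, v) \<in> adj ^^ 1" using w by simp
    from card_reach_mono[OF x this step.prems, of u k] step.IH[OF \<open>w < m\<close>] M[OF step.prems, of "Suc k"]
    show ?case by (simp add: le_antisym)
  qed
  have step_eq: "\<sigma> v ` reach u x k w = reach u x (Suc k) v" if "k \<ge> k1 + k0" "(w, v) \<in> adj" for k v w
  proof -
    have wv: "w < m" "v < m" using that by (auto simp: adj_def)
    have "card (reach u x (Suc k) v) = card (reach u x k w)"
      using cardM[OF that(1) wv(1)] cardM[of "Suc k", OF _ wv(2)] that(1) by linarith
    then show ?thesis
      using card_reach_step[OF x that(2), of u k] finite_subset[OF reach_subset[OF x wv(2), of u "Suc k"] fin]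
      by (intro card_subset_eq) linarith+
  qed
  \<comment> \<open>vertices that are joined by two edges are neighbours of a common vertex\<close>
  have two: "reach u x k w = reach u x k w'" if "k \<ge> k1 + k0" "(w, w') \<in> (adj O adj) ^^ j" for k j w w'
    using that(2)
  proof (induction j arbitrary: w')
    case (Suc j)
    then obtain a b where ab: "(w, a) \<in> (adj O adj) ^^ j" "(a, b) \<in> adj" "(b, w') \<in> adj" by auto
    have l: "a < m" "w' < m" "b < m" using ab by (auto simp: adj_def)
    have "\<sigma> b ` reach u x k a = \<sigma> b ` reach u x k w'"
      using step_eq[OF that(1)] ab adj_sym by metis
    then have "reach u x k a = reach u x k w'"
      using perm[OF l(3)] reach_subset[OF x l(1)] reach_subset[OF x l(2)]
      by (metis bij_betw_def inj_on_image_eq_iff)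
    then show ?case using Suc.IH[OF ab(1)] by simp
  qed auto
  have const: "reach u x k w = reach u x k w'" if "k \<ge> k1 + k0" "w < m" "w' < m" for k w w'
  proof -
    \<comment> \<open>all pairs are joined by walks of the even length \<open>2 * k0\<close>\<close>
    have "(w, w') \<in> adj ^^ k0 O adj ^^ k0" using k0(2) that by blast
    also have "adj ^^ k0 O adj ^^ k0 = adj ^^ (k0 + k0)" by (rule relpow_add[symmetric])
    also have "adj ^^ (k0 + k0) = (adj O adj) ^^ k0" by (rule relpow_double)
    finally show ?thesis by (rule two[OF that(1)])
  qed
  have all: "reach u x k v = X" if k: "k \<ge> k1 + k0" and v: "v < m" for k v
  proof -
    \<comment> \<open>the common sets are shifted by all generators alike, hence invariant\<close>
    define T where "T i = reach u x (k + i) u" for i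
    have T: "\<sigma> v ` T i = T (Suc i)" if v: "v < m" for i v
    proof -
      obtain w where w: "(w, v) \<in> adj" using nbr v by auto
      then have "w < m" by (auto simp: adj_def)
      have "T i = reach u x (k + i) w" unfolding T_def by (rule const) (use \<open>w < m\<close> u k in auto)
      moreover have "T (Suc i) = reach u x (Suc (k + i)) v"
        unfolding T_def add_Suc_right by (rule const) (use v u k in auto)
      ultimately show ?thesis using step_eq[OF _ w] k by simp
    qed
    have sub: "T i \<subseteq> X" for i unfolding T_def by (rule reach_subset[OF x u])
    have ne: "T i \<noteq> {}" for i unfolding T_def using cardM[of "k + i" u] u k \<open>M > 0\<close> by auto
    have "T 1 = T 0" by (rule shift_fixed[of T]) (use sub T in auto)
    then have "\<sigma> v ` T 0 = T 0" if "v < m" for v using T[OF that, of 0] by simp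
    then have "T 0 = X" using trans[of "T 0"] sub ne by blast
    then show ?thesis unfolding T_def using const[OF k u v] by simp
  qed
  then show ?thesis by blast
qed


definition mass :: "(nat \<Rightarrow> 'x \<Rightarrow> real) \<Rightarrow> nat \<Rightarrow> real" where
  "mass F u = (\<Sum>x\<in>X. F u x)"

text \<open>
  Summing over the points of \<open>X\<close> forgets the permutations, and \<open>step\<close> turns into the
  adjacency operator of the graph.
\<close>

definition mass_step :: "(nat \<Rightarrow> real) \<Rightarrow> nat \<Rightarrow> real" where
  "mass_step f v = (\<Sum>u<m. real (A u v) * f u)"

definition nonneg :: "(nat \<Rightarrow> 'x \<Rightarrow> real) \<Rightarrow> bool" where
  "nonneg F \<longleftrightarrow> (\<forall>u<m. \<forall>x\<in>X. F u x \<ge> 0)"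

text \<open>
  Each point of \<open>X\<close> carries at least the share \<open>1 - \<epsilon>\<close> of what it would carry in the uniform
  distribution of the weight at the vertex. A lower bound suffices: applied to all the points outside
  a set, it bounds the weight of the set from above. Every nonnegative weight satisfies it for \<open>\<epsilon> = 1\<close>.
\<close>

definition nearly_uniform :: "real \<Rightarrow> (nat \<Rightarrow> 'x \<Rightarrow> real) \<Rightarrow> bool" where
  "nearly_uniform \<epsilon> F \<longleftrightarrow> (\<forall>v<m. \<forall>x\<in>X. F v x \<ge> (1 - \<epsilon>) / card X * mass F v)"

lemma inv_perm:
  assumes "v < m"
  shows "bij_betw (inv_into X (\<sigma> v)) X X"
    and "x \<in> X \<Longrightarrow> inv_into X (\<sigma> v) x \<in> X"
    and "x \<in> X \<Longrightarrow> \<sigma> v (inv_into X (\<sigma> v) x) = x"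
    and "x \<in> X \<Longrightarrow> inv_into X (\<sigma> v) (\<sigma> v x) = x"
  using perm[OF assms] bij_betw_inv_into[OF perm[OF assms]]
  by (auto simp: bij_betw_def f_inv_into_f)

lemma nonneg_step: "nonneg F \<Longrightarrow> nonneg (step F)"
  unfolding nonneg_def step_def by (auto intro!: sum_nonneg mult_nonneg_nonneg simp: inv_perm)

lemma nonneg_steps: "nonneg F \<Longrightarrow> nonneg ((step ^^ k) F)"
  by (induction k) (auto simp: nonneg_step)

lemma mass_nonneg: "nonneg F \<Longrightarrow> u < m \<Longrightarrow> mass F u \<ge> 0"
  by (auto simp: nonneg_def mass_def intro!: sum_nonneg)

lemma mass_of_step:
  assumes "v < m"
  shows "mass (step F) v = mass_step (mass F) v"
proof -
  have "mass (step F) v = (\<Sum>u<m. \<Sum>x\<in>X. real (A u v) * F u (inv_into X (\<sigma> v) x))"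
    unfolding mass_def step_def by (rule sum.swap)
  also have "\<dots> = (\<Sum>u<m. \<Sum>x\<in>X. real (A u v) * F u x)"
    by (intro sum.cong refl sum.reindex_bij_betw[OF inv_perm(1)[OF assms]])
  finally show ?thesis by (simp add: mass_step_def mass_def sum_distrib_left)
qed

lemma mass_step_cong: "(\<And>u. u < m \<Longrightarrow> f u = g u) \<Longrightarrow> mass_step f v = mass_step g v"
  by (simp add: mass_step_def)

lemma mass_of_steps: "v < m \<Longrightarrow> mass ((step ^^ k) F) v = (mass_step ^^ k) (mass F) v"
proof (induction k arbitrary: v)
  case (Suc k)
  have "mass ((step ^^ Suc k) F) v = mass_step (mass ((step ^^ k) F)) v"
    using mass_of_step[OF Suc.prems] by simp
  also have "\<dots> = mass_step ((mass_step ^^ k) (mass F)) v"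
    by (rule mass_step_cong[OF Suc.IH])
  finally show ?case by simp
qed simp

text \<open>
  A weight that does not depend on the point is not seen by the permutations, so it can be
  split off and propagated by the graph alone.
\<close>

lemma steps_subtract_constant:
  "v < m \<Longrightarrow> (step ^^ k) F v y = (step ^^ k) (\<lambda>u x. F u x - g u) v y + (mass_step ^^ k) g v"
proof (induction k arbitrary: v y)
  case (Suc k)
  have "(step ^^ Suc k) F v y = step ((step ^^ k) F) v y" by simp
  also have "\<dots> = (\<Sum>u<m. real (A u v) * (step ^^ k) F u (inv_into X (\<sigma> v) y))"
    by (rule step_def)
  also have "\<dots> = (\<Sum>u<m. real (A u v) * (step ^^ k) (\<lambda>u x. F u x - g u) u (inv_into X (\<sigma> v) y)
                     + real (A u v) * (mass_step ^^ k) g u)"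
    using Suc.IH by (intro sum.cong refl) (simp flip: distrib_left)
  also have "\<dots> = step ((step ^^ k) (\<lambda>u x. F u x - g u)) v y + mass_step ((mass_step ^^ k) g) v"
    by (simp only: step_def[of _ v] mass_step_def[of _ v] sum.distrib)
  finally show ?case by simp
qed simp

lemma mass_steps_scale: "(mass_step ^^ k) (\<lambda>u. c * f u) v = c * (mass_step ^^ k) f v"
proof (induction k arbitrary: v)
  case (Suc k)
  have "(mass_step ^^ Suc k) (\<lambda>u. c * f u) v = mass_step ((mass_step ^^ k) (\<lambda>u. c * f u)) v" by simp
  also have "\<dots> = mass_step (\<lambda>u. c * (mass_step ^^ k) f u) v" by (rule mass_step_cong) (rule Suc)
  also have "\<dots> = c * mass_step ((mass_step ^^ k) f) v"
    by (simp only: mass_step_def[of _ v] sum_distrib_left mult_ac)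
  finally show ?case by simp
qed simp

lemma mass_steps_bound:
  assumes "\<And>u. u < m \<Longrightarrow> 0 \<le> f u \<and> f u \<le> a"
  shows "v < m \<Longrightarrow> 0 \<le> (mass_step ^^ k) f v \<and> (mass_step ^^ k) f v \<le> (\<Sum>u<m. \<Sum>v<m. real (A u v)) ^ k * a"
proof (induction k arbitrary: v)
  case (Suc k)
  define D where "D = (\<Sum>u<m. \<Sum>v<m. real (A u v))"
  have "0 \<le> a" using assms[OF Suc.prems] by linarith
  have "D \<ge> 0" unfolding D_def by (intro sum_nonneg) auto
  have eq: "(mass_step ^^ Suc k) f v = (\<Sum>u<m. real (A u v) * (mass_step ^^ k) f u)"
    by (subst mass_step_def[symmetric]) simp
  also have "\<dots> \<le> (\<Sum>u<m. (\<Sum>v<m. real (A u v)) * (D ^ k * a))"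
    using Suc.IH Suc.prems by (intro sum_mono mult_mono member_le_sum) (auto simp: D_def intro: sum_nonneg)
  also have "\<dots> = D ^ Suc k * a" by (simp add: D_def flip: sum_distrib_right)
  finally have "(mass_step ^^ Suc k) f v \<le> D ^ Suc k * a" .
  moreover have "0 \<le> (mass_step ^^ Suc k) f v"
    unfolding eq using Suc.IH by (auto intro!: sum_nonneg mult_nonneg_nonneg)
  ultimately show ?case by (simp add: D_def)
qed (use assms in auto)

lemma steps_ge_start:
  assumes "nonneg F" "x \<in> X"
  shows "v < m \<Longrightarrow> y \<in> reach u x k v \<Longrightarrow> (step ^^ k) F v y \<ge> F u x"
proof (induction k arbitrary: v y)
  case (Suc k)
  then obtain w y' where w: "(w, v) \<in> adj" "y' \<in> reach u x k w" "y = \<sigma> v y'" by auto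
  then have wm: "w < m" "A w v \<ge> 1" by (auto simp: adj_def)
  have y': "y' \<in> X" using reach_subset[OF assms(2) wm(1)] w by auto
  then have "y \<in> X" using perm[OF Suc.prems(1)] w by (auto simp: bij_betw_def)
  have inv: "inv_into X (\<sigma> v) y = y'" using w y' inv_perm(4)[OF Suc.prems(1)] by simp
  note nn = nonneg_steps[OF assms(1), of k, unfolded nonneg_def, rule_format]
  have "F u x \<le> 1 * (step ^^ k) F w y'" using Suc.IH[OF wm(1) w(2)] by simp
  also have "\<dots> \<le> real (A w v) * (step ^^ k) F w y'"
    using wm nn[OF wm(1) y'] by (intro mult_right_mono) auto
  also have "\<dots> \<le> (\<Sum>w<m. real (A w v) * (step ^^ k) F w y')"
    using wm nn y' by (intro member_le_sum[where f = "\<lambda>w. real (A w v) * (step ^^ k) F w y'"]) auto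
  also have "\<dots> = step ((step ^^ k) F) v y" by (simp only: step_def[of _ v] inv)
  finally show ?case by simp
qed (auto split: if_splits)

lemma nearly_uniform_step:
  assumes "nearly_uniform \<epsilon> F"
  shows "nearly_uniform \<epsilon> (step F)"
  unfolding nearly_uniform_def
proof (intro allI ballI impI)
  fix v x assume v: "v < m" and x: "x \<in> X"
  have "(1 - \<epsilon>) / card X * mass (step F) v = (\<Sum>u<m. real (A u v) * ((1 - \<epsilon>) / card X * mass F u))"
    by (simp add: mass_of_step[OF v] mass_step_def sum_distrib_left mult_ac)
  also have "\<dots> \<le> step F v x"
    unfolding step_def using assms inv_perm(2)[OF v x]
    by (intro sum_mono mult_left_mono) (auto simp: nearly_uniform_def)
  finally show "(1 - \<epsilon>) / card X * mass (step F) v \<le> step F v x" .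
qed

text \<open>
  Subtract from \<open>F\<close> its guaranteed uniform part. The remainder \<open>F'\<close> has the share \<open>\<epsilon>\<close> of the
  mass, and after \<open>k\<close> steps each of its entries contributes to every state. So every state
  receives a fixed fraction of the mass of \<open>F'\<close>, and a fixed fraction of \<open>\<epsilon>\<close> has become uniform. The
  fraction \<open>1 / C\<close> compares the mass before and after \<open>k\<close> steps.
\<close>

lemma nearly_uniform_contraction:
  assumes "X \<noteq> {}"
  obtains k \<delta> where "0 < \<delta>" "\<delta> \<le> (1::real)"
    "\<And>F \<epsilon>. nonneg F \<Longrightarrow> 0 \<le> \<epsilon> \<Longrightarrow> nearly_uniform \<epsilon> F \<Longrightarrow> nearly_uniform ((1 - \<delta>) * \<epsilon>) ((step ^^ k) F)"
proof -
  have "\<forall>p\<in>{..<m} \<times> X. \<exists>K. \<forall>k\<ge>K. \<forall>v<m. reach (fst p) (snd p) k v = X"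
    using reach_eventually_everything by auto
  then obtain K where K: "\<And>u x k v. u < m \<Longrightarrow> x \<in> X \<Longrightarrow> k \<ge> K (u, x) \<Longrightarrow> v < m \<Longrightarrow> reach u x k v = X"
    by (metis (no_types, lifting) SigmaI bchoice fst_conv lessThan_iff snd_conv)
  define k where "k = Max (K ` ({..<m} \<times> X))"
  have k: "reach u x k v = X" if "u < m" "x \<in> X" "v < m" for u x v
    by (rule K) (use that fin in \<open>auto simp: k_def\<close>)
  define C where "C = (\<Sum>u<m. \<Sum>v<m. real (A u v)) ^ k + 1"
  have D0: "0 \<le> (\<Sum>u<m. \<Sum>v<m. real (A u v)) ^ k" by (intro zero_le_power sum_nonneg) auto
  then have C: "C \<ge> 1" by (simp add: C_def)
  have N: "real (card X) > 0" using assms fin by (simp add: card_gt_0_iff)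
  have split_share: "(1 - (1 - 1 / C) * e) / n * z = e * z / (C * n) + (1 - e) / n * z" for e n z :: real
  proof -
    have "1 - (1 - 1 / C) * e = e / C + (1 - e)" by (simp add: left_diff_distrib)
    then have "(1 - (1 - 1 / C) * e) / n * z = (e / C + (1 - e)) / n * z" by (simp only:)
    also have "\<dots> = e * z / (C * n) + (1 - e) / n * z" by (simp add: add_divide_distrib distrib_right)
    finally show ?thesis .
  qed
  show ?thesis
  proof (rule that[of "1 / C" k])
    show "0 < 1 / C" "1 / C \<le> 1" using C by auto
    fix F \<epsilon> assume F: "nonneg F" and \<epsilon>: "0 \<le> (\<epsilon>::real)" and L: "nearly_uniform \<epsilon> F"
    define F' where "F' u x = F u x - (1 - \<epsilon>) / card X * mass F u" for u x
    have F': "nonneg F'" using L by (auto simp: nonneg_def F'_def nearly_uniform_def)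
    have mF': "mass F' u = \<epsilon> * mass F u" for u
    proof -
      have "mass F' u = mass F u - card X * ((1 - \<epsilon>) / card X * mass F u)"
        unfolding mass_def[of F'] F'_def sum_subtractf by (simp add: mass_def)
      moreover have "card X * ((1 - \<epsilon>) / card X * mass F u) = (1 - \<epsilon>) * mass F u" using N by simp
      ultimately show ?thesis by (simp add: algebra_simps)
    qed
    show "nearly_uniform ((1 - 1 / C) * \<epsilon>) ((step ^^ k) F)"
      unfolding nearly_uniform_def
    proof (intro allI ballI impI)
      fix v y assume v: "v < m" and y: "y \<in> X"
      let ?r = "(step ^^ k) F' v y" and ?Z = "mass ((step ^^ k) F) v"
      have "?r \<ge> F' u x" if "u < m" "x \<in> X" for u x
        using steps_ge_start[OF F' that(2) v] k[OF that v] y by auto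
      then have "mass F' u \<le> (\<Sum>x\<in>X. ?r)" if "u < m" for u
        unfolding mass_def using that by (intro sum_mono)
      then have "0 \<le> \<epsilon> * mass F u \<and> \<epsilon> * mass F u \<le> card X * ?r" if "u < m" for u
        using that mF' mass_nonneg[OF F] \<epsilon> by simp
      then have "\<epsilon> * ?Z \<le> (\<Sum>u<m. \<Sum>v<m. real (A u v)) ^ k * (card X * ?r)"
        using mass_steps_bound[of "\<lambda>u. \<epsilon> * mass F u" "card X * ?r" v k, OF _ v]
        by (simp add: mass_steps_scale mass_of_steps[OF v])
      also have "\<dots> \<le> C * (card X * ?r)"
        using nonneg_steps[OF F', of k] v y N D0 unfolding C_def nonneg_def by (intro mult_right_mono) auto
      finally have "\<epsilon> * ?Z / (C * card X) \<le> ?r" using C N by (simp add: field_simps)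
      moreover have "(step ^^ k) F v y = ?r + (1 - \<epsilon>) / card X * ?Z"
        unfolding F'_def[abs_def] mass_of_steps[OF v] mass_steps_scale[symmetric]
        by (rule steps_subtract_constant[OF v])
      moreover have "(1 - (1 - 1 / C) * \<epsilon>) / card X * ?Z = \<epsilon> * ?Z / (C * card X) + (1 - \<epsilon>) / card X * ?Z"
        by (rule split_share)
      ultimately show "(1 - (1 - 1 / C) * \<epsilon>) / card X * ?Z \<le> (step ^^ k) F v y" by linarith
    qed
  qed
qed

lemma eventually_nearly_uniform:
  assumes F: "nonneg F" and X: "X \<noteq> {}" and \<epsilon>: "\<epsilon> > 0"
  shows "\<forall>\<^sub>F N in sequentially. nearly_uniform \<epsilon> ((step ^^ N) F)"
proof -
  obtain k \<delta> where k: "0 < \<delta>" "\<delta> \<le> (1::real)"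
    "\<And>F \<epsilon>. nonneg F \<Longrightarrow> 0 \<le> \<epsilon> \<Longrightarrow> nearly_uniform \<epsilon> F \<Longrightarrow> nearly_uniform ((1 - \<delta>) * \<epsilon>) ((step ^^ k) F)"
    using nearly_uniform_contraction[OF X] by metis
  have "\<exists>j. (1 - \<delta>) ^ j < \<epsilon>" using k \<epsilon> by (intro real_arch_pow_inv) auto
  then obtain j where j: "(1 - \<delta>) ^ j < \<epsilon>" ..
  have pw: "nearly_uniform ((1 - \<delta>) ^ i) ((step ^^ (k * i)) F)" for i
  proof (induction i)
    case 0
    show ?case using F by (auto simp: nearly_uniform_def nonneg_def)
  next
    case (Suc i)
    have "nearly_uniform ((1 - \<delta>) * (1 - \<delta>) ^ i) ((step ^^ k) ((step ^^ (k * i)) F))"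
      using k(3)[OF nonneg_steps[OF F] _ Suc] k by simp
    then show ?case by (simp add: funpow_add)
  qed
  have later: "nearly_uniform ((1 - \<delta>) ^ j) ((step ^^ N) F)" if "N \<ge> k * j" for N
    using that
  proof (induction N rule: dec_induct)
    case (step N)
    then show ?case using nearly_uniform_step by simp
  qed (rule pw)
  have "nearly_uniform \<epsilon> ((step ^^ N) F)" if N: "N \<ge> k * j" for N
    unfolding nearly_uniform_def
  proof (intro allI ballI impI)
    fix v x assume v: "v < m" and x: "x \<in> X"
    have "(1 - \<epsilon>) / card X * mass ((step ^^ N) F) v \<le> (1 - (1 - \<delta>) ^ j) / card X * mass ((step ^^ N) F) v"
      using j mass_nonneg[OF nonneg_steps[OF F] v] by (intro mult_right_mono divide_right_mono) auto
    also have "\<dots> \<le> (step ^^ N) F v x" using later[OF N] v x by (auto simp: nearly_uniform_def)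
    finally show "(1 - \<epsilon>) / card X * mass ((step ^^ N) F) v \<le> (step ^^ N) F v x" .
  qed
  then show ?thesis unfolding eventually_sequentially by blast
qed

lemma eventually_proportion_le:
  assumes F: "nonneg F" and X: "X \<noteq> {}" and \<epsilon>: "\<epsilon> > 0" and Y: "Y \<subseteq> X"
  shows "\<forall>\<^sub>F N in sequentially. (\<Sum>v<m. \<Sum>x\<in>Y. (step ^^ N) F v x)
            \<le> (card Y / card X + \<epsilon>) * (\<Sum>v<m. \<Sum>x\<in>X. (step ^^ N) F v x)"
  using eventually_nearly_uniform[OF F X \<epsilon>]
proof eventually_elim
  case (elim N)
  have N: "real (card X) > 0" using X fin by (simp add: card_gt_0_iff)
  have "(\<Sum>x\<in>Y. (step ^^ N) F v x) \<le> (card Y / card X + \<epsilon>) * (\<Sum>x\<in>X. (step ^^ N) F v x)" if v: "v < m" for v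
  proof -
    let ?Z = "mass ((step ^^ N) F) v"
    have Z: "?Z \<ge> 0" by (rule mass_nonneg[OF nonneg_steps[OF F] v])
    have "card (X - Y) * ((1 - \<epsilon>) / card X * ?Z) = (\<Sum>x\<in>X - Y. (1 - \<epsilon>) / card X * ?Z)" by simp
    also have "\<dots> \<le> (\<Sum>x\<in>X - Y. (step ^^ N) F v x)"
      using elim v unfolding nearly_uniform_def by (intro sum_mono) auto
    also have "\<dots> = ?Z - (\<Sum>x\<in>Y. (step ^^ N) F v x)"
      unfolding mass_def by (rule sum_diff[OF fin Y])
    finally have "(\<Sum>x\<in>Y. (step ^^ N) F v x) \<le> ?Z - card (X - Y) * ((1 - \<epsilon>) / card X * ?Z)" by linarith
    also have "\<dots> = ?Z - (1 - card Y / card X) * (1 - \<epsilon>) * ?Z"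
      using N card_mono[OF fin Y] finite_subset[OF Y fin] Y
      by (simp add: card_Diff_subset of_nat_diff field_simps)
    also have "\<dots> = (card Y / card X + \<epsilon>) * ?Z - \<epsilon> * (card Y / card X) * ?Z"
    proof -
      have "z - (1 - D) * (1 - \<epsilon>) * z = (D + \<epsilon>) * z - \<epsilon> * D * z" for z D :: real
        by (simp add: algebra_simps)
      then show ?thesis .
    qed
    also have "\<dots> \<le> (card Y / card X + \<epsilon>) * ?Z" using \<epsilon> Z by simp
    finally show ?thesis by (simp add: mass_def)
  qed
  then show ?case unfolding sum_distrib_left by (intro sum_mono) auto
qed

end

lemma finite_walks:
  assumes "finite_multigraph G"
  shows "finite (walks G N)"
proof (rule finite_subset)
  show "walks G N \<subseteq> {vs. set vs \<subseteq> {..<nverts G} \<and> length vs = N} \<times>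
                    {es. set es \<subseteq> edges G \<and> length es = N - 1}"
    by (auto simp: walks_def in_set_conv_nth)
  show "finite \<dots>"
    using assms by (intro finite_cartesian_product finite_lists_length_eq) (auto simp: finite_multigraph_def)
qed

text \<open>
  A walk ending at \<open>v\<close> is a shorter walk followed by an edge from its last vertex to \<open>v\<close>. The
  predicate \<open>P\<close> carries the condition on the product of the shorter walk.
\<close>

lemma walks_Suc_last:
  "{w \<in> walks G (Suc (Suc N)). last (fst w) = v \<and> P (butlast (fst w))} =
   (\<lambda>((vs, es), e). (vs @ [v], es @ [e])) ` 
     (\<Union>u<nverts G. {w \<in> walks G (Suc N). last (fst w) = u \<and> P (fst w)} \<times> {e \<in> edges G. ends G e = Upair u v})"
  if v: "v < nverts G"
proof (intro equalityI subsetI)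
  fix w assume w: "w \<in> {w \<in> walks G (Suc (Suc N)). last (fst w) = v \<and> P (butlast (fst w))}"
  obtain vs es where ve: "w = (vs, es)" by force
  have l: "length vs = Suc (Suc N)" "length es = Suc N" "set vs \<subseteq> {..<nverts G}"
    "\<And>k. k < Suc N \<Longrightarrow> es ! k \<in> edges G \<and> ends G (es ! k) = Upair (vs ! k) (vs ! Suc k)"
    "last vs = v" "P (butlast vs)"
    using w by (auto simp: ve walks_def)
  obtain vs' where vs': "vs = vs' @ [v]" using l by (metis append_butlast_last_id length_greater_0_conv zero_less_Suc)
  obtain es' e where es': "es = es' @ [e]" using l by (metis append_butlast_last_id length_greater_0_conv zero_less_Suc)
  have l': "length vs' = Suc N" "length es' = N" using l vs' es' by auto
  then have ne: "vs' \<noteq> []" by auto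
  have "(vs', es') \<in> walks G (Suc N)"
    unfolding walks_def using l(3) l' l(4) by (auto simp: vs' es' nth_append) (metis less_Suc_eq)+
  moreover have "e \<in> edges G \<and> ends G e = Upair (last vs') v"
    using l(4)[of N] l' ne by (auto simp: vs' es' nth_append last_conv_nth)
  moreover have "last vs' < nverts G" using ne l(3) by (auto simp: vs' dest: last_in_set)
  ultimately show "w \<in> (\<lambda>((vs, es), e). (vs @ [v], es @ [e])) ` 
     (\<Union>u<nverts G. {w \<in> walks G (Suc N). last (fst w) = u \<and> P (fst w)} \<times> {e \<in> edges G. ends G e = Upair u v})"
    using l(6) by (force simp: ve vs' es')
next
  fix w assume "w \<in> (\<lambda>((vs, es), e). (vs @ [v], es @ [e])) ` 
     (\<Union>u<nverts G. {w \<in> walks G (Suc N). last (fst w) = u \<and> P (fst w)} \<times> {e \<in> edges G. ends G e = Upair u v})"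
  then obtain vs es e where w: "w = (vs @ [v], es @ [e])" "(vs, es) \<in> walks G (Suc N)" "P vs" "e \<in> edges G"
    "ends G e = Upair (last vs) v" by auto
  then have "vs \<noteq> []" by (auto simp: walks_def)
  then show "w \<in> {w \<in> walks G (Suc (Suc N)). last (fst w) = v \<and> P (butlast (fst w))}"
    using w v by (auto simp: walks_def nth_append last_conv_nth less_Suc_eq)
qed

lemma (in permutation_walk) card_walks_eq_steps:
  assumes G: "finite_multigraph G" and m: "m = nverts G"
    and A: "\<And>u v. A u v = card {e \<in> edges G. ends G e = Upair u v}"
    and x0: "x0 \<in> X"
  shows "v < m \<Longrightarrow> y \<in> X \<Longrightarrow> real (card {w \<in> walks G (Suc N). last (fst w) = v \<and> fold \<sigma> (fst w) x0 = y}) =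
           (step ^^ N) (\<lambda>v y. of_bool (\<sigma> v x0 = y)) v y"
proof (induction N arbitrary: v y)
  case 0
  have "{w \<in> walks G (Suc 0). last (fst w) = v \<and> fold \<sigma> (fst w) x0 = y} =
        (if \<sigma> v x0 = y then {([v], [])} else {})"
    using 0 m by (auto simp: walks_def length_Suc_conv)
  then show ?case by simp
next
  case (Suc N)
  let ?B = "\<lambda>u. {w \<in> walks G (Suc N). last (fst w) = u \<and> fold \<sigma> (fst w) x0 = inv_into X (\<sigma> v) y}"
  let ?E = "\<lambda>u. {e \<in> edges G. ends G e = Upair u v}"
  have inX: "fold \<sigma> vs x0 \<in> X" if "set vs \<subseteq> {..<m}" for vs
    using that x0
  proof (induction vs arbitrary: x0)
    case (Cons a vs)
    then have "\<sigma> a x0 \<in> X" using perm[of a] by (auto simp: bij_betw_def)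
    then show ?case using Cons by simp
  qed simp
  have eqv: "\<sigma> v (fold \<sigma> vs x0) = y \<longleftrightarrow> fold \<sigma> vs x0 = inv_into X (\<sigma> v) y" if "set vs \<subseteq> {..<m}" for vs
    using inX[OF that] inv_perm(3,4)[OF Suc.prems(1)] Suc.prems(2) by metis
  have "{w \<in> walks G (Suc (Suc N)). last (fst w) = v \<and> fold \<sigma> (fst w) x0 = y} =
        {w \<in> walks G (Suc (Suc N)). last (fst w) = v \<and> fold \<sigma> (butlast (fst w)) x0 = inv_into X (\<sigma> v) y}"
  proof (intro Collect_cong conj_cong refl)
    fix w assume w: "w \<in> walks G (Suc (Suc N))" "last (fst w) = v"
    then have "fst w \<noteq> []" "set (fst w) \<subseteq> {..<m}" by (auto simp: walks_def m)
    then have "fst w = butlast (fst w) @ [v]" "set (butlast (fst w)) \<subseteq> {..<m}"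
      using w append_butlast_last_id[of "fst w"] by (auto dest: in_set_butlastD)
    note b = this
    have "fold \<sigma> (fst w) x0 = fold \<sigma> (butlast (fst w) @ [v]) x0" by (subst b(1)) (rule refl)
    also have "\<dots> = \<sigma> v (fold \<sigma> (butlast (fst w)) x0)" by simp
    finally show "(fold \<sigma> (fst w) x0 = y) = (fold \<sigma> (butlast (fst w)) x0 = inv_into X (\<sigma> v) y)"
      using eqv[OF b(2)] by simp
  qed
  also have "\<dots> = (\<lambda>((vs, es), e). (vs @ [v], es @ [e])) ` (\<Union>u<m. ?B u \<times> ?E u)"
    using walks_Suc_last[where P = "\<lambda>vs. fold \<sigma> vs x0 = inv_into X (\<sigma> v) y"] Suc.prems(1) unfolding m by simp
  also have "card \<dots> = card (\<Union>u<m. ?B u \<times> ?E u)"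
    by (intro card_image) (auto simp: inj_on_def)
  also have "\<dots> = (\<Sum>u<m. card (?B u \<times> ?E u))"
    using finite_walks[OF G] G
    by (intro card_UN_disjoint) (auto simp: finite_multigraph_def)
  also have "real \<dots> = (\<Sum>u<m. real (A u v) * real (card (?B u)))"
    by (simp add: card_cartesian_product A mult.commute)
  also have "\<dots> = (\<Sum>u<m. real (A u v) * (step ^^ N) (\<lambda>v y. of_bool (\<sigma> v x0 = y)) u (inv_into X (\<sigma> v) y))"
    using Suc.IH inv_perm(2)[OF Suc.prems] by simp
  also have "\<dots> = step ((step ^^ N) (\<lambda>v y. of_bool (\<sigma> v x0 = y))) v y" by (rule step_def[symmetric])
  finally show ?case by simp
qed


text \<open>
  The sets \<open>T k\<close> are moved cyclically with some period \<open>r\<close>. Every group element \<open>g\<close> then shifts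
  the sequence by some \<open>d\<close>, which is unique modulo \<open>r\<close>, and \<open>g \<mapsto> exp (2 \<pi> \<i> d / r)\<close> is a unitary
  character. It takes the same value on all generators, so it is trivial, and \<open>r = 1\<close>.
\<close>

lemma shift_invariant_if_no_character:
  fixes \<Gamma> :: "('a, 'b) monoid_scheme" and act :: "'a \<Rightarrow> 'x \<Rightarrow> 'x" and T :: "nat \<Rightarrow> 'x set"
  assumes t: "\<And>v. v < m \<Longrightarrow> t v \<in> carrier \<Gamma>" and m: "m > 0"
    and gen: "generate \<Gamma> (t ` {..<m}) = carrier \<Gamma>"
    and char: "\<forall>\<rho>. nontrivial_unitary_character \<Gamma> \<rho> \<longrightarrow> (\<exists>i<m. \<exists>j<m. \<rho> (t i) \<noteq> \<rho> (t j))"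
    and group: "group \<Gamma>" and fin: "finite X"
    and act_closed: "\<And>g x. g \<in> carrier \<Gamma> \<Longrightarrow> x \<in> X \<Longrightarrow> act g x \<in> X"
    and act_mult: "\<And>g h x. g \<in> carrier \<Gamma> \<Longrightarrow> h \<in> carrier \<Gamma> \<Longrightarrow> x \<in> X \<Longrightarrow> act (g \<otimes>\<^bsub>\<Gamma>\<^esub> h) x = act g (act h x)"
    and act_one: "\<And>x. x \<in> X \<Longrightarrow> act \<one>\<^bsub>\<Gamma>\<^esub> x = x"
    and sub: "\<And>k. T k \<subseteq> X" and T: "\<And>k v. v < m \<Longrightarrow> act (t v) ` T k = T (Suc k)"
  shows "T 1 = T 0"
proof -
  interpret group \<Gamma> by fact
  have img_mult: "act (g \<otimes>\<^bsub>\<Gamma>\<^esub> h) ` S = act g ` act h ` S" if "g \<in> carrier \<Gamma>" "h \<in> carrier \<Gamma>" "S \<subseteq> X" for g h S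
    unfolding image_image using that act_mult by (intro image_cong) auto
  have img_one: "act \<one>\<^bsub>\<Gamma>\<^esub> ` S = S" if "S \<subseteq> X" for S
  proof -
    have "act \<one>\<^bsub>\<Gamma>\<^esub> ` S = id ` S" by (rule image_cong) (use that act_one in auto)
    then show ?thesis by simp
  qed
  have img_inv: "act (inv\<^bsub>\<Gamma>\<^esub> g) ` act g ` S = S" if "g \<in> carrier \<Gamma>" "S \<subseteq> X" for g S
    using img_mult[of "inv\<^bsub>\<Gamma>\<^esub> g" g S] that img_one by simp
  have step_inj: "T i = T j" if "T (i + k) = T (j + k)" for i j k
    using that
  proof (induction k)
    case (Suc k)
    have "act (t 0) ` T (i + k) = act (t 0) ` T (j + k)" using Suc.prems T[OF m] by simp
    then have "T (i + k) = T (j + k)" using img_inv[OF t[OF m] sub] by metis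
    then show ?case by (rule Suc.IH)
  qed simp
  define r where "r = (LEAST r. r > 0 \<and> T r = T 0)"
  have ex: "\<exists>r>0. T r = T 0"
  proof -
    have "\<not> inj T"
    proof
      assume "inj T"
      moreover have "finite (range T)" using fin sub by (intro finite_subset[of "range T" "Pow X"]) auto
      ultimately show False using finite_imageD by fastforce
    qed
    then obtain i j where ij: "i < j" "T i = T j" unfolding inj_def by (metis linorder_neqE_nat)
    then have "T (0 + i) = T (j - i + i)" by simp
    then show ?thesis using step_inj[of 0 i "j - i"] ij by (intro exI[of _ "j - i"]) auto
  qed
  then have r: "r > 0" "T r = T 0" unfolding r_def by (metis (mono_tags, lifting) LeastI)+
  have r_least: "r \<le> s" if "s > 0" "T s = T 0" for s unfolding r_def by (rule Least_le) (use that in auto)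
  have Tr: "T (k + r) = T k" for k
    by (induction k) (use r T[OF m] in \<open>metis add_0 add_Suc\<close>)+
  have shift: "\<exists>d. \<forall>k. act g ` T k = T (k + d)" if "g \<in> carrier \<Gamma>" for g
  proof -
    from that show ?thesis
      unfolding gen[symmetric]
    proof (induction g rule: generate.induct)
      case one
      then show ?case using img_one[OF sub] by (intro exI[of _ 0]) auto
    next
      case (incl h)
      then show ?case using T by (intro exI[of _ 1]) auto
    next
      case (inv h)
      then obtain v where v: "v < m" "h = t v" by auto
      \<comment> \<open>going back one place in a cycle of length \<open>r\<close> is going forward \<open>r - 1\<close> places\<close>
      have "act (inv\<^bsub>\<Gamma>\<^esub> h) ` T k = T (k + (r - 1))" for k
      proof -
        have "T k = T (Suc (k + (r - 1)))" using Tr[of k] r by simp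
        also have "\<dots> = act h ` T (k + (r - 1))" using T v by simp
        finally show ?thesis using img_inv[OF t[OF v(1)] sub] v by simp
      qed
      then show ?case by blast
    next
      case (eng h1 h2)
      then obtain d1 d2 where d: "\<forall>k. act h1 ` T k = T (k + d1)" "\<forall>k. act h2 ` T k = T (k + d2)" by blast
      have "h1 \<in> carrier \<Gamma>" "h2 \<in> carrier \<Gamma>" using eng gen by auto
      then have "\<forall>k. act (h1 \<otimes>\<^bsub>\<Gamma>\<^esub> h2) ` T k = T (k + (d2 + d1))"
        using img_mult[OF _ _ sub] d by (simp add: add.assoc)
      then show ?case by blast
    qed
  qed
  have Trc: "T (k + r * c) = T k" for k c
    by (induction c) (use Tr in \<open>simp_all add: add.assoc[symmetric] add.commute[of r]\<close>)
  have dvd: "r dvd s" if "T s = T 0" for s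
  proof -
    have "T (s mod r) = T 0" using Trc[of "s mod r" "s div r"] that by simp
    then have "s mod r = 0" using r_least[of "s mod r"] r(1) mod_less_divisor[OF r(1), of s] by linarith
    then show ?thesis by auto
  qed
  define \<omega> where "\<omega> = cis (2 * pi / r)"
  have \<omega>r: "\<omega> ^ r = 1" using r(1) Complex.DeMoivre[of "2 * pi / r" r] by (simp add: \<omega>_def)
  have \<omega>_le: "\<omega> ^ d = \<omega> ^ d'" if "T d = T d'" "d \<le> d'" for d d'
  proof -
    have "r dvd d' - d" using step_inj[of "d' - d" d 0] that by (intro dvd) simp
    then obtain c where "d' - d = r * c" by (rule dvdE)
    then have "d' = d + r * c" using that(2) by linarith
    then show ?thesis by (simp add: power_add power_mult \<omega>r)
  qed
  then have \<omega>_eq: "\<omega> ^ d = \<omega> ^ d'" if "T d = T d'" for d d'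
  proof (cases "d \<le> d'")
    case True then show ?thesis using \<omega>_le that by blast
  next
    case False then show ?thesis using \<omega>_le[of d' d] that by simp
  qed
  define \<rho> where "\<rho> g = \<omega> ^ (SOME d. \<forall>k. act g ` T k = T (k + d))" for g
  have \<rho>: "\<rho> g = \<omega> ^ d" if "\<forall>k. act g ` T k = T (k + d)" for g d
  proof -
    have "\<forall>k. act g ` T k = T (k + (SOME d. \<forall>k. act g ` T k = T (k + d)))" using that by (rule someI)
    then have "T (SOME d. \<forall>k. act g ` T k = T (k + d)) = T d"
      using spec[OF that, of 0] by (drule_tac spec[of _ 0]) simp
    then show ?thesis unfolding \<rho>_def by (rule \<omega>_eq)
  qed
  have hom: "\<rho> \<in> hom \<Gamma> U1"
  proof (rule homI)
    fix g assume "g \<in> carrier \<Gamma>"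
    show "\<rho> g \<in> carrier U1" by (simp add: \<rho>_def U1_def norm_power \<omega>_def)
  next
    fix g h assume gh: "g \<in> carrier \<Gamma>" "h \<in> carrier \<Gamma>"
    obtain d1 where d1: "\<forall>k. act g ` T k = T (k + d1)" using shift[OF gh(1)] by (rule exE)
    obtain d2 where d2: "\<forall>k. act h ` T k = T (k + d2)" using shift[OF gh(2)] by (rule exE)
    note d = d1 d2
    then have "\<forall>k. act (g \<otimes>\<^bsub>\<Gamma>\<^esub> h) ` T k = T (k + (d2 + d1))"
      using img_mult[OF gh sub] by (simp add: add.assoc)
    from \<rho>[OF this] show "\<rho> (g \<otimes>\<^bsub>\<Gamma>\<^esub> h) = \<rho> g \<otimes>\<^bsub>U1\<^esub> \<rho> h"
      using \<rho>[OF d1] \<rho>[OF d2] by (simp add: U1_def power_add mult.commute)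
  qed
  have \<rho>t: "\<rho> (t v) = \<omega>" if "v < m" for v using \<rho>[of "t v" 1] T[OF that] by simp
  have "\<rho> (t 0) = 1"
  proof -
    have "\<not> nontrivial_unitary_character \<Gamma> \<rho>" using char \<rho>t by auto
    then show ?thesis using hom t[OF m] by (auto simp: nontrivial_unitary_character_def)
  qed
  then have "\<omega> = 1" using \<rho>t[OF m] by simp
  then have cos: "cos (2 * pi / r) = 1" unfolding \<omega>_def by (auto dest: arg_cong[of _ _ Re])
  have "r = 1"
  proof (rule ccontr)
    assume "r \<noteq> 1"
    then have "real r \<ge> 2" using r(1) by linarith
    then have "0 < 2 * pi / r" "2 * pi / r \<le> pi" using pi_gt_zero by (auto simp: field_simps)
    then have "cos (2 * pi / r) < cos 0" by (intro cos_monotone_0_pi) auto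
    then show False using cos by simp
  qed
  then show ?thesis using r(2) by simp
qed

lemma adjacency_pow_pos_imp_relpow:
  fixes A :: "nat mat"
  assumes A: "A \<in> carrier_mat m m"
  shows "i < m \<Longrightarrow> j < m \<Longrightarrow> (A ^\<^sub>m k) $$ (i, j) > 0 \<Longrightarrow>
           (i, j) \<in> {(u, v). u < m \<and> v < m \<and> A $$ (u, v) > 0} ^^ k"
proof (induction k arbitrary: j)
  case 0
  then show ?case using A by (auto split: if_splits)
next
  case (Suc k)
  have Ak: "A ^\<^sub>m k \<in> carrier_mat m m" using A by simp
  have "(A ^\<^sub>m Suc k) $$ (i, j) = (\<Sum>l<m. (A ^\<^sub>m k) $$ (i, l) * A $$ (l, j))"
    using Ak A Suc.prems by (simp add: scalar_prod_def atLeast0LessThan)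
  then obtain l where "l < m" "(A ^\<^sub>m k) $$ (i, l) * A $$ (l, j) > 0"
    using Suc.prems(3) by (metis (no_types, lifting) gr0I lessThan_iff less_irrefl sum.neutral)
  then show ?case using Suc.IH[of l] Suc.prems by auto
qed

text \<open>
  The number of walks with prescribed last vertex and prescribed image of \<open>x0\<close> is given by the
  iterated transfer operator, whose values become uniform in the point of \<open>X\<close>. Only the upper
  bound for the probability of a set is kept, which is all that the sieve uses.
\<close>

theorem walk_equidistribution:
  fixes \<Gamma> :: "('a, 'b) monoid_scheme" and act :: "'a \<Rightarrow> 'x \<Rightarrow> 'x"
  assumes group: "group \<Gamma>" and G: "finite_multigraph G"
    and t: "\<forall>i<nverts G. t i \<in> carrier \<Gamma>"
    and gen: "generate \<Gamma> (t ` {..<nverts G}) = carrier \<Gamma>"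
    and PF: "perron_frobenius_matrix (adj_matrix G)"
    and char: "\<forall>\<rho>. nontrivial_unitary_character \<Gamma> \<rho> \<longrightarrow> (\<exists>i<nverts G. \<exists>j<nverts G. \<rho> (t i) \<noteq> \<rho> (t j))"
    and fin: "finite X"
    and act_closed: "\<And>g x. g \<in> carrier \<Gamma> \<Longrightarrow> x \<in> X \<Longrightarrow> act g x \<in> X"
    and act_mult: "\<And>g h x. g \<in> carrier \<Gamma> \<Longrightarrow> h \<in> carrier \<Gamma> \<Longrightarrow> x \<in> X \<Longrightarrow> act (g \<otimes>\<^bsub>\<Gamma>\<^esub> h) x = act g (act h x)"
    and act_one: "\<And>x. x \<in> X \<Longrightarrow> act \<one>\<^bsub>\<Gamma>\<^esub> x = x"
    and x0: "x0 \<in> X" and act_trans: "\<And>x. x \<in> X \<Longrightarrow> \<exists>g\<in>carrier \<Gamma>. act g x0 = x"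
    and Y: "Y \<subseteq> X" and \<epsilon>: "\<epsilon> > 0"
  shows "\<forall>\<^sub>F N in sequentially. walks G N \<noteq> {} \<and> measure_pmf.prob (pmf_of_set (walks G N))
            {w. act (walk_prod \<Gamma> t w) x0 \<in> Y} \<le> card Y / card X + \<epsilon>"
proof -
  interpret \<Gamma>: group \<Gamma> by fact
  define m where "m = nverts G"
  define A where "A u v = card {e \<in> edges G. ends G e = Upair u v}" for u v
  have adj: "adj_matrix G \<in> carrier_mat m m" "\<And>u v. u < m \<Longrightarrow> v < m \<Longrightarrow> adj_matrix G $$ (u, v) = A u v"
    by (auto simp: adj_matrix_def m_def A_def)
  have m: "m > 0"
  proof (rule ccontr)
    assume "\<not> m > 0"
    then have "dim_row (adj_matrix G) = 0" by (simp add: adj_matrix_def m_def)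
    then have "\<not> eigenvalue (map_mat of_nat (adj_matrix G) :: complex mat) l" for l
      by (auto simp: eigenvalue_def eigenvector_def)
    then show False using PF by (auto simp: perron_frobenius_matrix_def Let_def)
  qed
  have bij: "bij_betw (act g) X X" if g: "g \<in> carrier \<Gamma>" for g
    by (rule bij_betwI[of _ _ _ "act (inv\<^bsub>\<Gamma>\<^esub> g)"])
       (use g act_closed act_one act_mult[symmetric] in \<open>auto simp: Pi_def\<close>)
  interpret permutation_walk m A X "\<lambda>v. act (t v)"
  proof
    show "finite X" by fact
    show "bij_betw (act (t v)) X X" if "v < m" for v using bij t that by (auto simp: m_def)
    show "A u v = A v u" for u v
    proof -
      have "Upair u v = Upair v u" by simp
      then show ?thesis by (simp only: A_def)
    qed
    show "\<exists>k>0. \<forall>u<m. \<forall>v<m. (u, v) \<in> {(u, v). u < m \<and> v < m \<and> 0 < A u v} ^^ k"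
    proof -
      obtain k where k: "k > 0" "\<forall>i<m. \<forall>j<m. (adj_matrix G ^\<^sub>m k) $$ (i, j) > 0"
        using PF adj(1) by (auto simp: perron_frobenius_matrix_def Let_def)
      have "{(u, v). u < m \<and> v < m \<and> 0 < A u v} = {(u, v). u < m \<and> v < m \<and> 0 < adj_matrix G $$ (u, v)}"
        using adj(2) by auto
      then show ?thesis using k adjacency_pow_pos_imp_relpow[OF adj(1), of _ _ k] by auto
    qed
  next
    fix S assume S: "S \<subseteq> X" "S \<noteq> {}" "\<And>v. v < m \<Longrightarrow> act (t v) ` S = S"
    have inv: "act g ` S = S" if "g \<in> carrier \<Gamma>" for g
      using that unfolding gen[symmetric]
    proof (induction g rule: generate.induct)
      case one
      have "act \<one>\<^bsub>\<Gamma>\<^esub> ` S = id ` S" by (rule image_cong) (use S act_one in auto)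
      then show ?case by simp
    next
      case (incl h) then show ?case using S(3) by (auto simp: m_def)
    next
      case (inv h)
      then have h: "h \<in> carrier \<Gamma>" "act h ` S = S" using t S(3) by (auto simp: m_def)
      then have "act (inv\<^bsub>\<Gamma>\<^esub> h) ` S = act (inv\<^bsub>\<Gamma>\<^esub> h) ` act h ` S" by simp
      also have "\<dots> = (\<lambda>x. x) ` S"
        unfolding image_image by (rule image_cong) (use S(1) h act_one act_mult[symmetric] in auto)
      finally show ?case by simp
    next
      case (eng h1 h2)
      have h: "h1 \<in> carrier \<Gamma>" "h2 \<in> carrier \<Gamma>" using eng gen by auto
      have "act (h1 \<otimes>\<^bsub>\<Gamma>\<^esub> h2) ` S = act h1 ` act h2 ` S"
        unfolding image_image by (rule image_cong) (use S(1) h act_mult in auto)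
      then show ?case using eng by simp
    qed
    obtain s where s: "s \<in> S" using S by auto
    show "S = X"
    proof
      show "X \<subseteq> S"
      proof
        fix x assume "x \<in> X"
        then obtain g where g: "g \<in> carrier \<Gamma>" "act g x0 = x" using act_trans by auto
        obtain h where h: "h \<in> carrier \<Gamma>" "act h x0 = s" using act_trans s S by auto
        have "act (inv\<^bsub>\<Gamma>\<^esub> h) s = x0" using h x0 act_mult[of "inv\<^bsub>\<Gamma>\<^esub> h" h x0] act_one by simp
        then have "x0 \<in> S" using inv[of "inv\<^bsub>\<Gamma>\<^esub> h"] h s by force
        then show "x \<in> S" using inv[OF g(1)] g(2) by force
      qed
    qed fact
  next
    fix T :: "nat \<Rightarrow> 'x set"
    assume "\<And>k. T k \<subseteq> X" "\<And>k v. v < m \<Longrightarrow> act (t v) ` T k = T (Suc k)"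
    then show "T 1 = T 0"
      using t m gen char
      by (intro shift_invariant_if_no_character[where \<Gamma> = \<Gamma> and act = act and t = t and m = m and X = X])
         (use group fin act_closed act_mult act_one in \<open>auto simp: m_def\<close>)
  qed
  define F :: "nat \<Rightarrow> 'x \<Rightarrow> real" where "F = (\<lambda>v y. of_bool (act (t v) x0 = y))"
  have nn: "nonneg F" by (simp add: nonneg_def F_def)
  have fold_act: "act (fold (\<lambda>i g. t i \<otimes>\<^bsub>\<Gamma>\<^esub> g) vs g) x0 = fold (\<lambda>v. act (t v)) vs (act g x0)"
    if "set vs \<subseteq> {..<m}" "g \<in> carrier \<Gamma>" for vs g
    using that
  proof (induction vs arbitrary: g)
    case (Cons a vs)
    then have "t a \<in> carrier \<Gamma>" using t by (auto simp: m_def)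
    then show ?case using Cons act_mult x0 by simp
  qed simp
  have fold_in: "fold (\<lambda>v. act (t v)) vs x \<in> X" if "set vs \<subseteq> {..<m}" "x \<in> X" for vs x
    using that by (induction vs arbitrary: x) (use t act_closed in \<open>auto simp: m_def\<close>)
  \<comment> \<open>a walk with \<open>Suc N\<close> vertices has \<open>N\<close> edges, one for each iteration of \<open>step\<close>\<close>
  have count: "real (card {w \<in> walks G (Suc N). act (walk_prod \<Gamma> t w) x0 \<in> Z}) = (\<Sum>v<m. \<Sum>x\<in>Z. (step ^^ N) F v x)"
    if Z: "Z \<subseteq> X" for Z N
  proof -
    let ?W = "\<lambda>v y. {w \<in> walks G (Suc N). last (fst w) = v \<and> fold (\<lambda>v. act (t v)) (fst w) x0 = y}"
    have finZ: "finite Z" using Z fin finite_subset by blast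
    have fw: "act (walk_prod \<Gamma> t w) x0 = fold (\<lambda>v. act (t v)) (fst w) x0" "last (fst w) < m"
      if "w \<in> walks G (Suc N)" for w
    proof -
      have w: "set (fst w) \<subseteq> {..<m}" "fst w \<noteq> []" using that by (auto simp: walks_def m_def)
      show "act (walk_prod \<Gamma> t w) x0 = fold (\<lambda>v. act (t v)) (fst w) x0"
        unfolding walk_prod_def using fold_act[OF w(1) \<Gamma>.one_closed] act_one[OF x0] by simp
      show "last (fst w) < m" using w last_in_set by blast
    qed
    have "{w \<in> walks G (Suc N). act (walk_prod \<Gamma> t w) x0 \<in> Z} = (\<Union>(v, y)\<in>{..<m} \<times> Z. ?W v y)"
      using fw by auto
    also have "card \<dots> = (\<Sum>(v, y)\<in>{..<m} \<times> Z. card (?W v y))"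
      using finite_walks[OF G] finZ by (subst card_UN_disjoint) (auto simp: case_prod_beta)
    also have "real \<dots> = (\<Sum>(v, y)\<in>{..<m} \<times> Z. (step ^^ N) F v y)"
      unfolding F_def of_nat_sum using Z x0
      by (intro sum.cong refl) (auto intro!: card_walks_eq_steps[OF G m_def A_def])
    finally show ?thesis by (simp add: sum.cartesian_product)
  qed
  have tot: "real (card (walks G (Suc N))) = (\<Sum>v<m. \<Sum>x\<in>X. (step ^^ N) F v x)" for N
  proof -
    have "{w \<in> walks G (Suc N). act (walk_prod \<Gamma> t w) x0 \<in> X} = walks G (Suc N)"
    proof -
      have "act (walk_prod \<Gamma> t w) x0 \<in> X" if "w \<in> walks G (Suc N)" for w
      proof -
        have w: "set (fst w) \<subseteq> {..<m}" using that by (auto simp: walks_def m_def)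
        show ?thesis
          unfolding walk_prod_def using fold_act[OF w \<Gamma>.one_closed] fold_in[OF w x0] act_one[OF x0] by simp
      qed
      then show ?thesis by auto
    qed
    then show ?thesis using count[of X N] by simp
  qed
  have inX: "act (t 0) x0 \<in> X" using t m act_closed x0 by (auto simp: m_def)
  obtain K where K: "\<And>k v. k \<ge> K \<Longrightarrow> v < m \<Longrightarrow> reach 0 (act (t 0) x0) k v = X"
    using reach_eventually_everything[OF inX m] by blast
  have ne: "walks G (Suc N) \<noteq> {}" if "N \<ge> K" for N
  proof -
    have "1 \<le> (step ^^ N) F 0 x0"
      using steps_ge_start[OF nn inX m, of x0 0 N] K[OF that m] x0 by (simp add: F_def)
    also have "\<dots> \<le> (\<Sum>x\<in>X. (step ^^ N) F 0 x)"
      using nonneg_steps[OF nn, of N] m x0 fin by (intro member_le_sum) (auto simp: nonneg_def)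
    also have "\<dots> \<le> (\<Sum>v<m. \<Sum>x\<in>X. (step ^^ N) F v x)"
      using nonneg_steps[OF nn, of N] m
      by (intro member_le_sum[where f = "\<lambda>v. \<Sum>x\<in>X. (step ^^ N) F v x"]) (auto simp: nonneg_def intro!: sum_nonneg)
    finally show ?thesis using tot[of N] by auto
  qed
  have "X \<noteq> {}" using x0 by auto
  have ev: "\<forall>\<^sub>F N in sequentially. N \<ge> K \<and> (\<Sum>v<m. \<Sum>x\<in>Y. (step ^^ N) F v x)
            \<le> (card Y / card X + \<epsilon>) * (\<Sum>v<m. \<Sum>x\<in>X. (step ^^ N) F v x)"
    by (intro eventually_conj eventually_ge_at_top eventually_proportion_le[OF nn \<open>X \<noteq> {}\<close> \<epsilon> Y])
  have "\<forall>\<^sub>F N in sequentially. walks G (Suc N) \<noteq> {} \<and> measure_pmf.prob (pmf_of_set (walks G (Suc N)))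
            {w. act (walk_prod \<Gamma> t w) x0 \<in> Y} \<le> card Y / card X + \<epsilon>"
    using ev
  proof eventually_elim
    case (elim N)
    have W: "walks G (Suc N) \<noteq> {}" "finite (walks G (Suc N))" using ne elim finite_walks[OF G] by auto
    have "walks G (Suc N) \<inter> {w. act (walk_prod \<Gamma> t w) x0 \<in> Y} = {w \<in> walks G (Suc N). act (walk_prod \<Gamma> t w) x0 \<in> Y}"
      by auto
    then have "measure_pmf.prob (pmf_of_set (walks G (Suc N))) {w. act (walk_prod \<Gamma> t w) x0 \<in> Y}
         = card {w \<in> walks G (Suc N). act (walk_prod \<Gamma> t w) x0 \<in> Y} / card (walks G (Suc N))"
      using W by (simp add: measure_pmf_of_set)
    also have "\<dots> \<le> card Y / card X + \<epsilon>"
      using elim W by (simp add: count[OF Y] tot[symmetric] divide_le_eq card_gt_0_iff)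
    finally show ?case using W(1) by blast
  qed
  then show ?thesis by (subst (asm) eventually_sequentially_Suc)
qed

section \<open>The special linear and the symplectic groups\<close>

text \<open>
  The groups in question occur both over the integers and over finite fields.
\<close>

definition matrix_group :: "nat \<Rightarrow> 'a::comm_ring_1 mat set \<Rightarrow> 'a mat monoid" where
  "matrix_group n H = \<lparr>carrier = H, monoid.mult = (*), one = 1\<^sub>m n\<rparr>"

definition sl_mats :: "nat \<Rightarrow> 'a::comm_ring_1 mat set" where
  "sl_mats n = {M \<in> carrier_mat n n. det M = 1}"

definition symp_form :: "nat \<Rightarrow> 'a::comm_ring_1 mat" where
  "symp_form n = four_block_mat (0\<^sub>m n n) (1\<^sub>m n) (- 1\<^sub>m n) (0\<^sub>m n n)"

definition sp_mats :: "nat \<Rightarrow> 'a::comm_ring_1 mat set" where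
  "sp_mats n = {M \<in> carrier_mat (2 * n) (2 * n). M\<^sup>T * symp_form n * M = symp_form n}"

lemma SL_eq: "SL n = matrix_group n (sl_mats n)"
  by (simp add: SL_def matrix_group_def sl_mats_def)

lemma Sp_eq: "Sp n = matrix_group (2 * n) (sp_mats n)"
  by (simp add: Sp_def matrix_group_def sp_mats_def symp_form_def J_mat_def)

text \<open>
  Over a commutative ring the adjugate provides a two-sided inverse of \<open>A\<close>, and \<open>B\<close> must agree
  with it.
\<close>

lemma left_inverse_imp_right_inverse:
  fixes A B :: "'a::comm_ring_1 mat"
  assumes A: "A \<in> carrier_mat n n" and B: "B \<in> carrier_mat n n" and BA: "B * A = 1\<^sub>m n"
  shows "A * B = 1\<^sub>m n"
proof -
  define C where "C = det B \<cdot>\<^sub>m adj_mat A"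
  have C: "C \<in> carrier_mat n n" using adj_mat(1)[OF A] by (simp add: C_def)
  have "det B * det A = 1" using det_mult[OF B A] BA by simp
  then have AC: "A * C = 1\<^sub>m n"
    using adj_mat(1,2)[OF A] A
    by (intro eq_matI) (auto simp: C_def mult_smult_distrib[OF A adj_mat(1)[OF A]] simp flip: mult.assoc)
  have "B = B * (A * C)" using AC B by simp
  also have "\<dots> = C" using assoc_mult_mat[OF B A C] BA C by simp
  finally show ?thesis using AC by simp
qed

lemma group_matrix_group:
  assumes sub: "H \<subseteq> carrier_mat n n" and one: "1\<^sub>m n \<in> H" and mult: "\<And>A B. A \<in> H \<Longrightarrow> B \<in> H \<Longrightarrow> A * B \<in> H"
    and inv: "\<And>A. A \<in> H \<Longrightarrow> \<exists>B\<in>H. B * A = 1\<^sub>m n"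
  shows "group (matrix_group n H)"
proof (rule groupI)
  fix x y z assume "x \<in> carrier (matrix_group n H)" "y \<in> carrier (matrix_group n H)" "z \<in> carrier (matrix_group n H)"
  then show "x \<otimes>\<^bsub>matrix_group n H\<^esub> y \<otimes>\<^bsub>matrix_group n H\<^esub> z = x \<otimes>\<^bsub>matrix_group n H\<^esub> (y \<otimes>\<^bsub>matrix_group n H\<^esub> z)"
    using sub by (auto simp: matrix_group_def intro!: assoc_mult_mat)
qed (use assms in \<open>auto simp: matrix_group_def\<close>)

lemma group_sl: "group (matrix_group n (sl_mats n))"
proof (rule group_matrix_group)
  fix A :: "'a mat" assume "A \<in> sl_mats n"
  then have A: "A \<in> carrier_mat n n" "det A = 1" by (auto simp: sl_mats_def)
  have "adj_mat A * A = 1\<^sub>m n" using adj_mat(3)[OF A(1)] A(2) by (auto intro: eq_matI)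
  moreover from this have "det (adj_mat A) = 1"
    using det_mult[OF adj_mat(1)[OF A(1)] A(1)] A(2) by simp
  ultimately show "\<exists>B\<in>sl_mats n. B * A = 1\<^sub>m n"
    using adj_mat(1)[OF A(1)] by (auto simp: sl_mats_def)
qed (auto simp: sl_mats_def det_mult)

definition \<omega> :: "nat \<Rightarrow> 'a::comm_ring_1 vec \<Rightarrow> 'a vec \<Rightarrow> 'a" where
  "\<omega> n u v = u \<bullet> (symp_form n *\<^sub>v v)"

lemma symp_form_carrier [simp]: "symp_form n \<in> carrier_mat (2 * n) (2 * n)"
  by (simp add: symp_form_def mult_2)

lemma symp_form_dim [simp]: "dim_row (symp_form n) = 2 * n" "dim_col (symp_form n) = 2 * n"
  using symp_form_carrier[of n] by (auto simp del: symp_form_carrier)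

lemma symp_form_mult_vec:
  fixes v :: "'a::comm_ring_1 vec"
  assumes v: "v \<in> carrier_vec (2 * n)" and i: "i < n"
  shows "(symp_form n *\<^sub>v v) $ i = v $ (n + i)" and "(symp_form n *\<^sub>v v) $ (n + i) = - v $ i"
proof -
  have "row (symp_form n) i = (unit_vec (2 * n) (n + i) :: 'a vec)"
    using i by (intro eq_vecI) (auto simp: symp_form_def unit_vec_def)
  then show "(symp_form n *\<^sub>v v) $ i = v $ (n + i)" using v i by simp
  have "row (symp_form n) (n + i) = (- unit_vec (2 * n) i :: 'a vec)"
    using i by (intro eq_vecI) (auto simp: symp_form_def unit_vec_def)
  then show "(symp_form n *\<^sub>v v) $ (n + i) = - v $ i" using v i by simp
qed

lemma sum_double: "(\<Sum>i = 0..<2 * n. f i) = (\<Sum>i = 0..<n. f i + f (n + i))" for f :: "nat \<Rightarrow> 'a::comm_monoid_add"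
proof -
  have "(\<Sum>i = 0..<2 * n. f i) = (\<Sum>i = 0..<n. f i) + (\<Sum>i = n..<n + n. f i)"
    by (subst sum.atLeastLessThan_concat) (auto simp: mult_2)
  also have "(\<Sum>i = n..<n + n. f i) = (\<Sum>i = 0..<n. f (n + i))"
    using sum.shift_bounds_nat_ivl[of f 0 n n] by (simp add: add.commute)
  finally show ?thesis by (simp add: sum.distrib)
qed

lemma \<omega>_sum:
  assumes "u \<in> carrier_vec (2 * n)" "v \<in> carrier_vec (2 * n)"
  shows "\<omega> n u v = (\<Sum>i = 0..<n. u $ i * v $ (n + i) - u $ (n + i) * v $ i)"
proof -
  have "dim_vec (symp_form n *\<^sub>v v) = 2 * n" by simp
  then show ?thesis
    using assms by (simp add: \<omega>_def scalar_prod_def sum_double symp_form_mult_vec del: index_mult_mat_vec)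
qed

lemma \<omega>_alternating: "u \<in> carrier_vec (2 * n) \<Longrightarrow> \<omega> n u u = 0"
  by (simp add: \<omega>_sum mult.commute)

lemma \<omega>_skew: "u \<in> carrier_vec (2 * n) \<Longrightarrow> v \<in> carrier_vec (2 * n) \<Longrightarrow> \<omega> n u v = - \<omega> n v u"
  by (simp add: \<omega>_sum mult.commute flip: sum_negf)

lemma \<omega>_linear:
  assumes "u \<in> carrier_vec (2 * n)" "v \<in> carrier_vec (2 * n)" "w \<in> carrier_vec (2 * n)"
  shows "\<omega> n (u + v) w = \<omega> n u w + \<omega> n v w" "\<omega> n w (u + v) = \<omega> n w u + \<omega> n w v"
    "\<omega> n (u - v) w = \<omega> n u w - \<omega> n v w" "\<omega> n w (u - v) = \<omega> n w u - \<omega> n w v"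
    "\<omega> n (a \<cdot>\<^sub>v u) w = a * \<omega> n u w" "\<omega> n w (a \<cdot>\<^sub>v u) = a * \<omega> n w u"
  using assms
  by (auto simp: \<omega>_sum sum_distrib_left algebra_simps simp flip: sum.distrib sum_subtractf)

lemma \<omega>_unit:
  assumes "u \<in> carrier_vec (2 * n)" "i < n"
  shows "\<omega> n u (unit_vec (2 * n) (n + i)) = u $ i" "\<omega> n u (unit_vec (2 * n) i) = - u $ (n + i)"
  using \<omega>_skew[OF assms(1), of "unit_vec (2 * n) (n + i)"] \<omega>_skew[OF assms(1), of "unit_vec (2 * n) i"]
    symp_form_mult_vec[OF assms] symp_form_carrier[of n] assms mult_mat_vec_carrier[OF symp_form_carrier assms(1)]
  by (auto simp: \<omega>_def simp del: symp_form_carrier)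

lemma \<omega>_nondegenerate:
  assumes u: "u \<in> carrier_vec (2 * n)" "\<And>v. v \<in> carrier_vec (2 * n) \<Longrightarrow> \<omega> n u v = 0"
  shows "u = 0\<^sub>v (2 * n)"
proof (rule eq_vecI)
  fix i assume i: "i < dim_vec (0\<^sub>v (2 * n) :: 'a vec)"
  show "u $ i = 0\<^sub>v (2 * n) $ i"
  proof (cases "i < n")
    case True
    then show ?thesis using \<omega>_unit(1)[OF u(1), of i] u(2) by simp
  next
    case False
    then show ?thesis using \<omega>_unit(2)[OF u(1), of "i - n"] u(2)[of "unit_vec (2 * n) (i - n)"] i by simp
  qed
qed (use u in auto)

text \<open>
  The entries of a matrix are its values as a bilinear form at pairs of unit vectors.
\<close>

lemma mat_eq_if_bilinear_eq:
  fixes A B :: "'a::comm_ring_1 mat"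
  assumes A: "A \<in> carrier_mat n n" and B: "B \<in> carrier_mat n n"
    and eq: "\<And>u v. u \<in> carrier_vec n \<Longrightarrow> v \<in> carrier_vec n \<Longrightarrow> u \<bullet> (A *\<^sub>v v) = u \<bullet> (B *\<^sub>v v)"
  shows "A = B"
proof (rule eq_matI)
  fix i j assume ij: "i < dim_row B" "j < dim_col B"
  have "C $$ (i, j) = unit_vec n i \<bullet> (C *\<^sub>v unit_vec n j)" if C: "C \<in> carrier_mat n n" for C :: "'a mat"
    using C ij B by (simp add: scalar_prod_left_unit[OF mult_mat_vec_carrier[OF C]])
  then show "A $$ (i, j) = B $$ (i, j)" using A B eq by simp
qed (use A B in auto)

lemma sp_iff_preserves_form:
  fixes M :: "'a::comm_ring_1 mat"
  shows "M \<in> sp_mats n \<longleftrightarrow> M \<in> carrier_mat (2 * n) (2 * n) \<and>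
     (\<forall>u\<in>carrier_vec (2 * n). \<forall>v\<in>carrier_vec (2 * n). \<omega> n (M *\<^sub>v u) (M *\<^sub>v v) = \<omega> n u v)"
proof (cases "M \<in> carrier_mat (2 * n) (2 * n)")
  case M: True
  let ?J = "symp_form n :: 'a mat"
  have "\<omega> n (M *\<^sub>v u) (M *\<^sub>v v) = u \<bullet> ((M\<^sup>T * ?J * M) *\<^sub>v v)"
    if u: "u \<in> carrier_vec (2 * n)" and v: "v \<in> carrier_vec (2 * n)" for u v
  proof -
    have Mt: "M\<^sup>T \<in> carrier_mat (2 * n) (2 * n)" using M by simp
    have Jv: "?J *\<^sub>v (M *\<^sub>v v) \<in> carrier_vec (2 * n)" using M v by (intro mult_mat_vec_carrier[OF symp_form_carrier]) auto
    have "(M\<^sup>T * ?J * M) *\<^sub>v v = M\<^sup>T *\<^sub>v (?J *\<^sub>v (M *\<^sub>v v))"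
      using assoc_mult_mat_vec[OF mult_carrier_mat[OF Mt symp_form_carrier] M v]
        assoc_mult_mat_vec[OF Mt symp_form_carrier mult_mat_vec_carrier[OF M v]] by simp
    then show ?thesis
      using transpose_vec_mult_scalar[OF Mt Jv u] by (simp add: \<omega>_def)
  qed
  then show ?thesis
    using M mat_eq_if_bilinear_eq[of "M\<^sup>T * ?J * M" "2 * n" ?J]
    by (auto simp: sp_mats_def \<omega>_def intro!: mult_carrier_mat[of _ _ "2 * n"])
qed (auto simp: sp_mats_def)

lemma spD:
  assumes "M \<in> sp_mats n"
  shows "M \<in> carrier_mat (2 * n) (2 * n)"
    "u \<in> carrier_vec (2 * n) \<Longrightarrow> v \<in> carrier_vec (2 * n) \<Longrightarrow> \<omega> n (M *\<^sub>v u) (M *\<^sub>v v) = \<omega> n u v"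
  using assms unfolding sp_iff_preserves_form by auto

lemma symp_form_inverse: "(symp_form n)\<^sup>T * symp_form n = (1\<^sub>m (2 * n) :: 'a::comm_ring_1 mat)"
proof (rule mat_eq_if_bilinear_eq)
  fix u v :: "'a vec" assume uv: "u \<in> carrier_vec (2 * n)" "v \<in> carrier_vec (2 * n)"
  let ?J = "symp_form n :: 'a mat"
  have Jt: "?J\<^sup>T \<in> carrier_mat (2 * n) (2 * n)" by simp
  have c: "?J *\<^sub>v u \<in> carrier_vec (2 * n)" "?J *\<^sub>v v \<in> carrier_vec (2 * n)"
    using uv by (auto intro: mult_mat_vec_carrier[OF symp_form_carrier])
  have "u \<bullet> ((?J\<^sup>T * ?J) *\<^sub>v v) = (?J *\<^sub>v u) \<bullet> (?J *\<^sub>v v)"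
    using transpose_vec_mult_scalar[OF Jt c(2) uv(1)] assoc_mult_mat_vec[OF Jt symp_form_carrier uv(2)] by simp
  also have "\<dots> = u \<bullet> v"
  proof -
    have "dim_vec (?J *\<^sub>v v) = 2 * n" "dim_vec v = 2 * n" using c uv by auto
    then show ?thesis
      unfolding scalar_prod_def using uv
      by (simp only: sum_double) (intro sum.cong refl, simp add: symp_form_mult_vec del: index_mult_mat_vec)
  qed
  finally show "u \<bullet> ((?J\<^sup>T * ?J) *\<^sub>v v) = u \<bullet> (1\<^sub>m (2 * n) *\<^sub>v v)" using uv by simp
qed (auto intro!: mult_carrier_mat[of _ _ "2 * n"])

lemma sp_right_inverse:
  fixes M :: "'a::comm_ring_1 mat"
  assumes "M \<in> sp_mats n"
  shows "\<exists>N\<in>carrier_mat (2 * n) (2 * n). N * M = 1\<^sub>m (2 * n)"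
proof -
  let ?J = "symp_form n :: 'a mat"
  have M: "M \<in> carrier_mat (2 * n) (2 * n)" "M\<^sup>T * ?J * M = ?J" using assms by (auto simp: sp_mats_def)
  have Jt: "?J\<^sup>T \<in> carrier_mat (2 * n) (2 * n)" and MJ: "M\<^sup>T * ?J \<in> carrier_mat (2 * n) (2 * n)"
    using M by (auto intro: mult_carrier_mat[of _ _ "2 * n"])
  have "?J\<^sup>T * (M\<^sup>T * ?J) * M = ?J\<^sup>T * ?J"
    using assoc_mult_mat[OF Jt MJ M(1)] M(2) by simp
  then show ?thesis
    using symp_form_inverse[of n] mult_carrier_mat[OF Jt MJ] by (intro bexI[of _ "?J\<^sup>T * (M\<^sup>T * ?J)"]) auto
qed

lemma sp_closed:
  fixes A B :: "'a::comm_ring_1 mat"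
  assumes "A \<in> sp_mats n" "B \<in> sp_mats n"
  shows "A * B \<in> sp_mats n"
  using assms unfolding sp_iff_preserves_form by (auto simp: mult_carrier_mat)

lemma sp_one: "1\<^sub>m (2 * n) \<in> sp_mats n"
  unfolding sp_iff_preserves_form by auto

lemma group_sp: "group (matrix_group (2 * n) (sp_mats n :: 'a::comm_ring_1 mat set))"
proof (rule group_matrix_group)
  fix A :: "'a mat" assume A: "A \<in> sp_mats n"
  obtain N where N: "N \<in> carrier_mat (2 * n) (2 * n)" "N * A = 1\<^sub>m (2 * n)" using sp_right_inverse[OF A] by auto
  have AN: "A * N = 1\<^sub>m (2 * n)" using left_inverse_imp_right_inverse[OF spD(1)[OF A] N] .
  have "\<omega> n (N *\<^sub>v u) (N *\<^sub>v v) = \<omega> n u v" if uv: "u \<in> carrier_vec (2 * n)" "v \<in> carrier_vec (2 * n)" for u v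
  proof -
    have "A *\<^sub>v (N *\<^sub>v w) = w" if "w \<in> carrier_vec (2 * n)" for w
      using assoc_mult_mat_vec[OF spD(1)[OF A] N(1) that] AN that by simp
    then show ?thesis
      using spD(2)[OF A mult_mat_vec_carrier[OF N(1) uv(1)] mult_mat_vec_carrier[OF N(1) uv(2)]] uv by simp
  qed
  then have "N \<in> sp_mats n" using N(1) by (simp add: sp_iff_preserves_form)
  then show "\<exists>B\<in>sp_mats n. B * A = 1\<^sub>m (2 * n)" using N(2) by blast
qed (auto simp: sp_closed sp_one dest: spD(1))

lemma det_sp: "M \<in> sp_mats n \<Longrightarrow> det M * det M = 1"
proof -
  fix M :: "'a mat" assume M: "M \<in> sp_mats n"
  let ?J = "symp_form n :: 'a mat"
  have c: "M \<in> carrier_mat (2 * n) (2 * n)" "M\<^sup>T \<in> carrier_mat (2 * n) (2 * n)" "?J\<^sup>T \<in> carrier_mat (2 * n) (2 * n)"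
    using spD(1)[OF M] by auto
  have jj: "det ?J * det ?J = 1"
    using det_mult[OF c(3) symp_form_carrier] symp_form_inverse[of n, where 'a = 'a] det_transpose[OF symp_form_carrier[of n], where ?'a = 'a]
    by simp
  have mjm: "det M * det ?J * det M = det ?J"
    using M det_mult[OF mult_carrier_mat[OF c(2) symp_form_carrier] c(1)] det_mult[OF c(2) symp_form_carrier] det_transpose[OF c(1)]
    by (simp add: sp_mats_def)
  have "det M * det M = (det M * det M) * (det ?J * det ?J)"
    by (simp add: jj)
  also have "\<dots> = (det M * det ?J * det M) * det ?J"
    by (simp only: mult_ac)
  also have "\<dots> = 1" by (simp add: mjm jj)
  finally show "det M * det M = 1" .
qed

section \<open>Generation by transvections\<close>

text \<open>
  The matrix of \<open>v \<mapsto> v + a \<omega>(z, v) z\<close>; the vector \<open>(symp_form n)\<^sup>T *\<^sub>v z\<close> is the functional \<open>\<omega>(z, _)\<close>.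
  Over the integers, too, \<open>a\<close> and \<open>z\<close> can be chosen freely, so transvections over a finite field lift.
\<close>

definition transvection :: "nat \<Rightarrow> 'a::comm_ring_1 \<Rightarrow> 'a vec \<Rightarrow> 'a mat" where
  "transvection n a z = mat (2 * n) (2 * n) (\<lambda>(i, j). (if i = j then 1 else 0) + a * z $ i * ((symp_form n)\<^sup>T *\<^sub>v z) $ j)"

lemma transvection_carrier [simp]: "transvection n a z \<in> carrier_mat (2 * n) (2 * n)"
  by (simp add: transvection_def)

lemma transvection_mult_vec:
  assumes z: "z \<in> carrier_vec (2 * n)" and v: "v \<in> carrier_vec (2 * n)"
  shows "transvection n a z *\<^sub>v v = v + (a * \<omega> n z v) \<cdot>\<^sub>v z"
proof (rule eq_vecI)
  let ?w = "(symp_form n)\<^sup>T *\<^sub>v z"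
  fix i assume "i < dim_vec (v + (a * \<omega> n z v) \<cdot>\<^sub>v z)"
  then have i: "i < 2 * n" using z by simp
  have w: "?w \<in> carrier_vec (2 * n)" using z by (intro mult_mat_vec_carrier[of _ _ "2 * n"]) auto
  have "(transvection n a z *\<^sub>v v) $ i = (\<Sum>j = 0..<2 * n. ((if i = j then 1 else 0) + a * z $ i * ?w $ j) * v $ j)"
    using i v by (simp add: transvection_def scalar_prod_def)
  also have "\<dots> = (\<Sum>j = 0..<2 * n. (if i = j then v $ j else 0)) + a * z $ i * (\<Sum>j = 0..<2 * n. ?w $ j * v $ j)"
    by (simp add: distrib_right sum.distrib sum_distrib_left mult.assoc if_distrib[of "\<lambda>x. x * _"] cong: if_cong)
  also have "\<dots> = v $ i + a * z $ i * (?w \<bullet> v)"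
    using i v by (simp add: scalar_prod_def)
  also have "?w \<bullet> v = \<omega> n z v"
    using transpose_vec_mult_scalar[OF symp_form_carrier v z] by (simp add: \<omega>_def)
  finally show "(transvection n a z *\<^sub>v v) $ i = (v + (a * \<omega> n z v) \<cdot>\<^sub>v z) $ i"
    using i z v by simp
qed (use z in \<open>simp add: transvection_def\<close>)

lemma transvection_sp:
  assumes z: "z \<in> carrier_vec (2 * n)"
  shows "transvection n a z \<in> sp_mats n"
  unfolding sp_iff_preserves_form
proof (intro conjI ballI)
  fix u v :: "'a vec" assume u: "u \<in> carrier_vec (2 * n)" and v: "v \<in> carrier_vec (2 * n)"
  show "\<omega> n (transvection n a z *\<^sub>v u) (transvection n a z *\<^sub>v v) = \<omega> n u v"
    using z u v \<omega>_skew[OF u z]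
    by (simp add: transvection_mult_vec \<omega>_linear \<omega>_alternating)
qed simp

lemma transvection_inverse:
  assumes z: "z \<in> carrier_vec (2 * n)"
  shows "transvection n (- a) z * transvection n a z = 1\<^sub>m (2 * n)"
proof (rule mat_eq_if_bilinear_eq)
  fix u v :: "'a vec" assume uv: "u \<in> carrier_vec (2 * n)" "v \<in> carrier_vec (2 * n)"
  have "transvection n (- a) z *\<^sub>v (transvection n a z *\<^sub>v v) = v"
    using z uv by (auto simp: transvection_mult_vec \<omega>_linear \<omega>_alternating)
  then show "u \<bullet> ((transvection n (- a) z * transvection n a z) *\<^sub>v v) = u \<bullet> (1\<^sub>m (2 * n) *\<^sub>v v)"
    using assoc_mult_mat_vec[OF transvection_carrier transvection_carrier uv(2)] uv by simp
qed (auto intro!: mult_carrier_mat[of _ _ "2 * n"])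

text \<open>
  The transvection along \<open>z = M v - v\<close> with the parameter \<open>1 / \<omega>(v, M v)\<close> takes \<open>M v\<close> back to \<open>v\<close>.
  Since \<open>M\<close> preserves the form, the vectors fixed by \<open>M\<close> are orthogonal to \<open>z\<close>, so they stay fixed.
\<close>

lemma sp_fixes_more_vectors:
  fixes M :: "'a::field mat"
  assumes M: "M \<in> sp_mats n" and v: "v \<in> carrier_vec (2 * n)" "\<omega> n v (M *\<^sub>v v) \<noteq> 0"
  obtains a z where "z \<in> carrier_vec (2 * n)"
    "{u \<in> carrier_vec (2 * n). M *\<^sub>v u = u} \<subset> {u \<in> carrier_vec (2 * n). (transvection n a z * M) *\<^sub>v u = u}"
proof -
  define z where "z = M *\<^sub>v v - v"
  define a where "a = 1 / \<omega> n v (M *\<^sub>v v)"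
  have c: "M *\<^sub>v u \<in> carrier_vec (2 * n)" if "u \<in> carrier_vec (2 * n)" for u
    using spD(1)[OF M] that by (rule mult_mat_vec_carrier)
  have z: "z \<in> carrier_vec (2 * n)" using c v by (simp add: z_def)
  have T: "(transvection n a z * M) *\<^sub>v u = M *\<^sub>v u + (a * \<omega> n z (M *\<^sub>v u)) \<cdot>\<^sub>v z" if "u \<in> carrier_vec (2 * n)" for u
    using assoc_mult_mat_vec[OF transvection_carrier spD(1)[OF M] that] transvection_mult_vec[OF z c[OF that]] by simp
  have sub: "(transvection n a z * M) *\<^sub>v u = u" if u: "u \<in> carrier_vec (2 * n)" "M *\<^sub>v u = u" for u
  proof -
    have "\<omega> n z u = \<omega> n (M *\<^sub>v v) (M *\<^sub>v u) - \<omega> n v u"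
      using c[OF v(1)] v u by (simp add: z_def \<omega>_linear)
    then have "\<omega> n z u = 0" using spD(2)[OF M v(1) u(1)] by simp
    then show ?thesis using T[OF u(1)] u z by auto
  qed
  have "\<omega> n z (M *\<^sub>v v) = - \<omega> n v (M *\<^sub>v v)"
    using c v by (simp add: z_def \<omega>_linear \<omega>_alternating)
  then have "a * \<omega> n z (M *\<^sub>v v) = - 1" using v(2) by (simp add: a_def)
  then have "(transvection n a z * M) *\<^sub>v v = M *\<^sub>v v + (- 1) \<cdot>\<^sub>v z" using T[OF v(1)] by simp
  also have "\<dots> = v" using c[OF v(1)] v by (auto simp: z_def)
  finally have Tv: "(transvection n a z * M) *\<^sub>v v = v" .
  have "M *\<^sub>v v \<noteq> v" using v \<omega>_alternating[OF v(1)] by auto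
  then show ?thesis using that[OF z, of a] sub Tv v(1) by blast
qed

text \<open>
  If \<open>\<omega>(v, M v)\<close> vanishes identically, polarisation makes \<open>M\<close> self-adjoint for the form. For
  \<open>z = x - M x\<close> this gives \<open>\<omega>(z, M u) = - \<omega>(z, u)\<close>, and the transvection along \<open>z \<noteq> 0\<close> leaves
  the situation without unfixing a vector: \<open>\<omega>(w, M w)\<close> becomes \<open>\<omega>(z, w)\<^sup>2\<close>.
\<close>

lemma sp_fixes_no_fewer_vectors:
  fixes M :: "'a::field mat"
  assumes M: "M \<in> sp_mats n" "M \<noteq> 1\<^sub>m (2 * n)" and iso: "\<And>v. v \<in> carrier_vec (2 * n) \<Longrightarrow> \<omega> n v (M *\<^sub>v v) = 0"
  obtains z v where "z \<in> carrier_vec (2 * n)" "v \<in> carrier_vec (2 * n)" "\<omega> n v ((transvection n 1 z * M) *\<^sub>v v) \<noteq> 0"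
    "{u \<in> carrier_vec (2 * n). M *\<^sub>v u = u} \<subseteq> {u \<in> carrier_vec (2 * n). (transvection n 1 z * M) *\<^sub>v u = u}"
proof -
  have c: "M *\<^sub>v u \<in> carrier_vec (2 * n)" if "u \<in> carrier_vec (2 * n)" for u
    using spD(1)[OF M(1)] that by (rule mult_mat_vec_carrier)
  have lin: "M *\<^sub>v (u + v) = M *\<^sub>v u + M *\<^sub>v v" if "u \<in> carrier_vec (2 * n)" "v \<in> carrier_vec (2 * n)" for u v
    using mult_add_distrib_mat_vec[OF spD(1)[OF M(1)] that] .
  have self: "\<omega> n (M *\<^sub>v u) v = \<omega> n u (M *\<^sub>v v)" if u: "u \<in> carrier_vec (2 * n)" and v: "v \<in> carrier_vec (2 * n)" for u v
  proof -
    have "\<omega> n (u + v) (M *\<^sub>v (u + v)) = \<omega> n u (M *\<^sub>v v) + \<omega> n v (M *\<^sub>v u)"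
      using u v c lin iso[OF u] iso[OF v] by (simp add: \<omega>_linear)
    then have "\<omega> n u (M *\<^sub>v v) + \<omega> n v (M *\<^sub>v u) = 0" using iso[of "u + v"] u v by simp
    then have "\<omega> n u (M *\<^sub>v v) = - \<omega> n v (M *\<^sub>v u)" by (simp add: eq_neg_iff_add_eq_0)
    then show ?thesis using \<omega>_skew[OF c[OF u] v] by simp
  qed
  obtain x where x: "x \<in> carrier_vec (2 * n)" "M *\<^sub>v x \<noteq> x"
    using M mat_eq_if_bilinear_eq[OF spD(1)[OF M(1)] one_carrier_mat] by (metis one_mult_mat_vec)
  define z where "z = x - M *\<^sub>v x"
  have z: "z \<in> carrier_vec (2 * n)" using c x by (simp add: z_def)
  have "z \<noteq> 0\<^sub>v (2 * n)"
  proof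
    assume "z = 0\<^sub>v (2 * n)"
    then have "z + M *\<^sub>v x = 0\<^sub>v (2 * n) + M *\<^sub>v x" by simp
    then show False using x c[OF x(1)] by (auto simp: z_def minus_add_uminus_vec)
  qed
  then obtain w where w: "w \<in> carrier_vec (2 * n)" "\<omega> n z w \<noteq> 0" using \<omega>_nondegenerate[OF z] by blast
  have T: "(transvection n 1 z * M) *\<^sub>v u = M *\<^sub>v u + (\<omega> n z (M *\<^sub>v u)) \<cdot>\<^sub>v z" if "u \<in> carrier_vec (2 * n)" for u
    using assoc_mult_mat_vec[OF transvection_carrier spD(1)[OF M(1)] that] transvection_mult_vec[OF z c[OF that]] by simp
  have zM: "\<omega> n z (M *\<^sub>v u) = - \<omega> n z u" if u: "u \<in> carrier_vec (2 * n)" for u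
    using x u c self[OF x(1) u] spD(2)[OF M(1) x(1) u] by (simp add: z_def \<omega>_linear)
  have "\<omega> n w ((transvection n 1 z * M) *\<^sub>v w) = - \<omega> n z w * \<omega> n w z"
    using T[OF w(1)] zM[OF w(1)] iso[OF w(1)] c[OF w(1)] w z by (simp add: \<omega>_linear)
  also have "\<dots> = \<omega> n z w * \<omega> n z w" using \<omega>_skew[OF w(1) z] by simp
  finally have "\<omega> n w ((transvection n 1 z * M) *\<^sub>v w) \<noteq> 0" using w by simp
  moreover have "(transvection n 1 z * M) *\<^sub>v u = u" if u: "u \<in> carrier_vec (2 * n)" "M *\<^sub>v u = u" for u
  proof -
    have "\<omega> n z u = \<omega> n x u - \<omega> n (M *\<^sub>v x) (M *\<^sub>v u)"
      using x u c[OF x(1)] by (simp add: z_def \<omega>_linear)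
    then have "\<omega> n z u = 0" using spD(2)[OF M(1) x(1) u(1)] by simp
    then show ?thesis using T[OF u(1)] u z by auto
  qed
  ultimately show ?thesis using that[OF z w(1)] by blast
qed

text \<open>
  Symplectic groups over finite fields are generated by transvections. As in the theorem of
  Cartan and Dieudonne, multiplication by at most two transvections enlarges the set of fixed
  vectors, until the identity is reached. Finiteness only serves to measure that set.
\<close>

lemma sp_transvection_induct [consumes 1, case_names one mult]:
  fixes M :: "'a::{field, finite} mat"
  assumes M: "M \<in> sp_mats n" and one: "P (1\<^sub>m (2 * n))"
    and mult: "\<And>N a z. N \<in> sp_mats n \<Longrightarrow> z \<in> carrier_vec (2 * n) \<Longrightarrow> P N \<Longrightarrow> P (transvection n a z * N)"
  shows "P M"
proof -
  define fixed where "fixed M = {u \<in> carrier_vec (2 * n). M *\<^sub>v u = u}" for M :: "'a mat"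
  have fin: "finite (fixed M)" for M unfolding fixed_def by (rule finite_subset[OF _ finite_carrier_vec]) auto
  have undo: "P M" if M: "M \<in> sp_mats n" and z: "z \<in> carrier_vec (2 * n)" and P: "P (transvection n a z * M)" for M a z
  proof -
    have "P (transvection n (- a) z * (transvection n a z * M))"
      by (rule mult[OF sp_closed[OF transvection_sp[OF z] M] z P])
    moreover have "transvection n (- a) z * (transvection n a z * M) = M"
      using assoc_mult_mat[OF transvection_carrier transvection_carrier spD(1)[OF M]] transvection_inverse[OF z] spD(1)[OF M]
      by (metis left_mult_one_mat)
    ultimately show ?thesis by simp
  qed
  show ?thesis
    using M
  proof (induction "card (carrier_vec (2 * n) :: 'a vec set) - card (fixed M)" arbitrary: M rule: less_induct)
    case less
    have IH: "P N" if "N \<in> sp_mats n" "fixed M \<subset> fixed N" for N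
    proof (rule less.hyps)
      have "card (fixed M) < card (fixed N)" using that(2) fin by (rule psubset_card_mono[rotated])
      moreover have "card (fixed N) \<le> card (carrier_vec (2 * n) :: 'a vec set)"
        by (rule card_mono) (auto simp: fixed_def)
      ultimately show "card (carrier_vec (2 * n) :: 'a vec set) - card (fixed N) < card (carrier_vec (2 * n) :: 'a vec set) - card (fixed M)"
        by linarith
    qed fact
    have more: "P N" if N: "N \<in> sp_mats n" "fixed M \<subseteq> fixed N" and v: "v \<in> carrier_vec (2 * n)" "\<omega> n v (N *\<^sub>v v) \<noteq> 0" for N v
    proof -
      obtain a z where z: "z \<in> carrier_vec (2 * n)" "fixed N \<subset> fixed (transvection n a z * N)"
        unfolding fixed_def by (rule sp_fixes_more_vectors[OF N(1) v])
      have "P (transvection n a z * N)"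
        by (rule IH[OF sp_closed[OF transvection_sp[OF z(1)] N(1)] subset_psubset_trans[OF N(2) z(2)]])
      then show ?thesis by (rule undo[OF N(1) z(1)])
    qed
    show ?case
    proof (cases "M = 1\<^sub>m (2 * n)")
      case True then show ?thesis using one by simp
    next
      case ne: False
      show ?thesis
      proof (cases "\<exists>v\<in>carrier_vec (2 * n). \<omega> n v (M *\<^sub>v v) \<noteq> 0")
        case True then show ?thesis using more[OF less.prems subset_refl] by auto
      next
        case False
        then have iso: "\<omega> n v (M *\<^sub>v v) = 0" if "v \<in> carrier_vec (2 * n)" for v using that by auto
        obtain z v where z: "z \<in> carrier_vec (2 * n)" "v \<in> carrier_vec (2 * n)" "\<omega> n v ((transvection n 1 z * M) *\<^sub>v v) \<noteq> 0"
          "fixed M \<subseteq> fixed (transvection n 1 z * M)"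
          unfolding fixed_def by (rule sp_fixes_no_fewer_vectors[OF less.prems ne iso])
        have "P (transvection n 1 z * M)"
          by (rule more[OF sp_closed[OF transvection_sp[OF z(1)] less.prems] z(4,2,3)])
        then show ?thesis by (rule undo[OF less.prems z(1)])
      qed
    qed
  qed
qed

section \<open>Generation by elementary matrices\<close>

text \<open>
  Gaussian elimination, in which only multiples of one row are added to another. A pivot 1 in the
  \<open>k\<close>-th column is created from a nonzero entry strictly below the diagonal; if there is none, the
  diagonal entry is first copied downwards. In the last column this is impossible, and there the
  determinant forces the diagonal entry to be 1.
\<close>

lemma sl_elementary_induct [consumes 1, case_names one mult]:
  fixes M :: "'a::field mat"
  assumes M: "M \<in> sl_mats n" and one: "P (1\<^sub>m n)"
    and mult: "\<And>N a i j. N \<in> sl_mats n \<Longrightarrow> i < n \<Longrightarrow> j < n \<Longrightarrow> i \<noteq> j \<Longrightarrow> P N \<Longrightarrow> P (addrow_mat n a i j * N)"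
  shows "P M"
proof -
  have sl: "M \<in> sl_mats n \<Longrightarrow> i \<noteq> j \<Longrightarrow> addrow_mat n a i j * M \<in> sl_mats n" for M :: "'a mat" and a i j
    by (auto simp: sl_mats_def det_addrow_mat det_mult[of _ n])
  have addrow_sl: "addrow a i j M \<in> sl_mats n" if "M \<in> sl_mats n" "i \<noteq> j" "j < n" for M :: "'a mat" and a i j
    using sl[OF that(1,2), of a] addrow_mat[of M n n j a i] that by (simp add: sl_mats_def)
  have undo: "P M" if M: "M \<in> sl_mats n" and ij: "i < n" "j < n" "i \<noteq> j" and P: "P (addrow a i j M)" for M a i j
  proof -
    have Mc: "M \<in> carrier_mat n n" using M by (simp add: sl_mats_def)
    have "P (addrow_mat n (- a) i j * (addrow_mat n a i j * M))"
      by (rule mult[OF sl[OF M ij(3)] ij]) (use P addrow_mat[OF Mc ij(2), of a i] in simp)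
    moreover have "addrow_mat n (- a) i j * (addrow_mat n a i j * M) = M"
      using assoc_mult_mat[OF addrow_mat_carrier addrow_mat_carrier Mc] addrow_mat_inv[OF ij, of "- a"] Mc
      by (metis add.inverse_inverse left_mult_one_mat)
    ultimately show ?thesis by simp
  qed
  \<comment> \<open>the first \<open>k\<close> columns are those of the identity matrix\<close>
  define std where "std k M \<longleftrightarrow> (\<forall>j<k. \<forall>i<n. M $$ (i, j) = (if i = j then 1 else 0))" for k and M :: "'a mat"
  have "P M" if "M \<in> sl_mats n" "std (n - d) M" "d \<le> n" for M d
    using that
  proof (induction d arbitrary: M)
    case 0
    then have "M = 1\<^sub>m n" by (intro eq_matI) (auto simp: std_def sl_mats_def)
    then show ?case using one by simp
  next
    case (Suc d)
    define k where "k = n - Suc d"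
    have k: "k < n" "n - d = Suc k" using Suc.prems(3) by (auto simp: k_def)
    have IH: "P N" if "N \<in> sl_mats n" "std (Suc k) N" for N using Suc.IH[of N] that Suc.prems(3) k by simp
    have std_addrow: "std k (addrow a i j M)" if "std k M" "M \<in> sl_mats n" "j < n" "j \<ge> k" for a i j and M :: "'a mat"
      using that k by (auto simp: std_def sl_mats_def)
    \<comment> \<open>with pivot 1, column \<open>k\<close> is cleared from the bottom up; the entries from row \<open>e\<close> on are done\<close>
    have clear: "P M" if "M \<in> sl_mats n" "std k M" "M $$ (k, k) = 1" "\<forall>i<n. i \<noteq> k \<and> i \<ge> e \<longrightarrow> M $$ (i, k) = 0" "e \<le> n" for M e
      using that
    proof (induction e arbitrary: M)
      case 0
      then have "std (Suc k) M" by (auto simp: std_def less_Suc_eq)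
      then show ?case using IH 0 by simp
    next
      case (Suc e)
      show ?case
      proof (cases "e = k")
        case True
        then show ?thesis using Suc by (intro Suc.IH) (auto simp: Suc_le_eq le_eq_less_or_eq)
      next
        case False
        have Mc: "M \<in> carrier_mat n n" using Suc.prems by (simp add: sl_mats_def)
        show ?thesis
        proof (rule undo[of _ e k "- M $$ (e, k)"])
          show "P (addrow (- M $$ (e, k)) e k M)"
          proof (rule Suc.IH)
            show "\<forall>i<n. i \<noteq> k \<and> e \<le> i \<longrightarrow> addrow (- M $$ (e, k)) e k M $$ (i, k) = 0"
              using Suc.prems Mc k by (auto simp: Suc_le_eq le_eq_less_or_eq)
          qed (use Suc.prems False k Mc addrow_sl std_addrow in auto)
        qed (use Suc.prems False k in auto)
      qed
    qed
    have pivot: "P M" if M: "M \<in> sl_mats n" "std k M" and i: "k < i" "i < n" "M $$ (i, k) \<noteq> 0" for M i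
    proof -
      have Mc: "M \<in> carrier_mat n n" using M by (simp add: sl_mats_def)
      let ?a = "(1 - M $$ (k, k)) / M $$ (i, k)"
      show ?thesis
      proof (rule undo[of _ k i ?a])
        show "P (addrow ?a k i M)"
          by (rule clear[of _ n]) (use M i k Mc addrow_sl std_addrow in auto)
      qed (use M i k in auto)
    qed
    have M: "M \<in> sl_mats n" "std k M" and Mc: "M \<in> carrier_mat n n" "det M = 1"
      using Suc.prems by (auto simp: k_def sl_mats_def)
    show ?case
    proof (cases "\<exists>i. k < i \<and> i < n \<and> M $$ (i, k) \<noteq> 0")
      case True then show ?thesis using pivot M by blast
    next
      case False
      then have below: "M $$ (i, k) = 0" if "k < i" "i < n" for i using that by auto
      have kk: "M $$ (k, k) \<noteq> 0"
      proof
        assume 0: "M $$ (k, k) = 0"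
        \<comment> \<open>otherwise column \<open>k\<close> is a combination of the first \<open>k\<close> columns, and \<open>v\<close> is in the kernel\<close>
        define v where "v = vec n (\<lambda>i. if i = k then 1 else if i < k then - M $$ (i, k) else 0)"
        have "M *\<^sub>v v = 0\<^sub>v n"
        proof (rule eq_vecI)
          fix i assume "i < dim_vec (0\<^sub>v n :: 'a vec)"
          then have i: "i < n" by simp
          have "(M *\<^sub>v v) $ i = (\<Sum>j = 0..<n. M $$ (i, j) * v $ j)" using Mc i by (simp add: scalar_prod_def v_def)
          also have "\<dots> = (\<Sum>j = 0..<n. (if j = k then M $$ (i, k) else 0) + (if j = i then (if i < k then - M $$ (i, k) else 0) else 0))"
            using M(2) i by (intro sum.cong refl) (auto simp: std_def v_def)
          also have "\<dots> = M $$ (i, k) + (if i < k then - M $$ (i, k) else 0)" using i k by (simp add: sum.distrib)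
          also have "\<dots> = 0" using below[of i] 0 i by (cases "i < k"; cases "i = k") auto
          finally show "(M *\<^sub>v v) $ i = 0\<^sub>v n $ i" using i by simp
        qed (use Mc in auto)
        moreover have "v \<in> carrier_vec n" "v \<noteq> 0\<^sub>v n"
          using k by (auto simp: v_def dest!: arg_cong[of _ _ "\<lambda>v. v $ k"])
        ultimately show False using det_0_iff_vec_prod_zero[OF Mc(1)] Mc(2) by auto
      qed
      show ?thesis
      proof (cases "Suc k < n")
        case True
        show ?thesis
        proof (rule undo[of _ "Suc k" k 1])
          show "P (addrow 1 (Suc k) k M)"
            by (rule pivot[of _ "Suc k"]) (use M Mc True kk below addrow_sl std_addrow in auto)
        qed (use M True in auto)
      next
        case False
        then have nk: "n = Suc k" using k by simp
        have "upper_triangular M" using M(2) Mc nk by (auto simp: std_def upper_triangular_def)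
        then have "prod_list (diag_mat M) = 1" using det_upper_triangular[of M n] Mc by simp
        moreover have "diag_mat M = replicate k 1 @ [M $$ (k, k)]"
        proof -
          have "map (\<lambda>i. M $$ (i, i)) [0..<k] = replicate k 1"
            by (rule nth_equalityI) (use M(2) nk in \<open>auto simp: std_def\<close>)
          then show ?thesis using Mc nk by (simp add: diag_mat_def)
        qed
        ultimately have "M $$ (k, k) = 1" by (simp add: prod_list_replicate)
        then show ?thesis by (intro clear[of M n]) (use M in auto)
      qed
    qed
  qed
  from this[of M n] M show ?thesis by (simp add: std_def)
qed

section \<open>Evaluation of polynomials at matrices\<close>

text \<open>
  Horner's scheme. The size has to be given, because the value of the zero polynomial depends on it.
\<close>

definition poly_mat :: "nat \<Rightarrow> 'a::comm_ring_1 poly \<Rightarrow> 'a mat \<Rightarrow> 'a mat" where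
  "poly_mat n p C = fold_coeffs (\<lambda>a M. a \<cdot>\<^sub>m 1\<^sub>m n + C * M) p (0\<^sub>m n n)"

lemma smult_mat_mult_vec:
  fixes A :: "'a::comm_ring_1 mat"
  assumes "A \<in> carrier_mat m n" "v \<in> carrier_vec n"
  shows "(k \<cdot>\<^sub>m A) *\<^sub>v v = k \<cdot>\<^sub>v (A *\<^sub>v v)"
  using assms by (intro eq_vecI) (auto simp: scalar_prod_def sum_distrib_left mult.assoc)

lemma poly_mat_0 [simp]: "poly_mat n 0 C = 0\<^sub>m n n"
  by (simp add: poly_mat_def)

lemma poly_mat_pCons:
  assumes C: "C \<in> carrier_mat n n"
  shows "poly_mat n (pCons a p) C = a \<cdot>\<^sub>m 1\<^sub>m n + C * poly_mat n p C"
proof (cases "p = 0")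
  case p: True
  have "a \<cdot>\<^sub>m 1\<^sub>m n + C * 0\<^sub>m n n = a \<cdot>\<^sub>m 1\<^sub>m n" using C by (intro eq_matI) auto
  moreover have "0 \<cdot>\<^sub>m 1\<^sub>m n = (0\<^sub>m n n :: 'a mat)" by (intro eq_matI) auto
  ultimately show ?thesis
    using p by (cases "a = 0") (simp_all add: poly_mat_def)
qed (simp add: poly_mat_def)

lemma poly_mat_carrier [simp]:
  assumes C: "C \<in> carrier_mat n n"
  shows "poly_mat n p C \<in> carrier_mat n n"
  by (induction p) (use C in \<open>auto simp: poly_mat_pCons intro!: add_carrier_mat mult_carrier_mat[of _ _ n]\<close>)

lemma poly_mat_dim [simp]:
  assumes C: "C \<in> carrier_mat n n"
  shows "dim_row (poly_mat n p C) = n" "dim_col (poly_mat n p C) = n"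
  using poly_mat_carrier[OF C, of p] by (auto simp del: poly_mat_carrier)

lemma poly_mat_const [simp]: "C \<in> carrier_mat n n \<Longrightarrow> poly_mat n [:a:] C = a \<cdot>\<^sub>m 1\<^sub>m n"
  by (simp add: poly_mat_pCons)

lemma poly_mat_1 [simp]: "C \<in> carrier_mat n n \<Longrightarrow> poly_mat n 1 C = 1\<^sub>m n"
  unfolding one_pCons by (subst poly_mat_const) (auto intro!: eq_matI)

lemma poly_mat_add:
  assumes C: "C \<in> carrier_mat n n"
  shows "poly_mat n (p + q) C = poly_mat n p C + poly_mat n q C"
proof (induction p q rule: poly_induct2)
  case (pCons a p b q)
  have c: "poly_mat n p C \<in> carrier_mat n n" "poly_mat n q C \<in> carrier_mat n n" using C by auto
  have "C * (poly_mat n p C + poly_mat n q C) = C * poly_mat n p C + C * poly_mat n q C"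
    by (rule mult_add_distrib_mat[OF C c])
  moreover have "C * poly_mat n p C \<in> carrier_mat n n" "C * poly_mat n q C \<in> carrier_mat n n"
    using C c by (auto intro: mult_carrier_mat)
  ultimately show ?case
    using C pCons carrier_matD[OF C]
    by (simp add: poly_mat_pCons) (intro eq_matI, auto simp: algebra_simps simp del: index_mult_mat(1))
qed (use C in \<open>auto intro!: eq_matI\<close>)

lemma poly_mat_smult:
  assumes C: "C \<in> carrier_mat n n"
  shows "poly_mat n (Polynomial.smult c p) C = c \<cdot>\<^sub>m poly_mat n p C"
proof (induction p)
  case 0 then show ?case by (auto intro!: eq_matI)
next
  case (pCons a p)
  have c: "poly_mat n p C \<in> carrier_mat n n" using C by auto
  have "C * (c \<cdot>\<^sub>m poly_mat n p C) = c \<cdot>\<^sub>m (C * poly_mat n p C)" using C c by (rule mult_smult_distrib)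
  moreover have "C * poly_mat n p C \<in> carrier_mat n n" using C c by (auto intro: mult_carrier_mat)
  ultimately show ?case
    using C pCons carrier_matD[OF C]
    by (simp add: poly_mat_pCons) (intro eq_matI, auto simp: algebra_simps simp del: index_mult_mat(1))
qed

lemma poly_mat_diff:
  assumes C: "C \<in> carrier_mat n n"
  shows "poly_mat n (p - q) C = poly_mat n p C - poly_mat n q C"
proof -
  have "p - q = p + Polynomial.smult (- 1) q" by simp
  then show ?thesis
    using C poly_mat_carrier[OF C, of p] poly_mat_carrier[OF C, of q]
    by (simp only: poly_mat_add poly_mat_smult) (intro eq_matI, auto)
qed

lemma poly_mat_mult:
  assumes C: "C \<in> carrier_mat n n"
  shows "poly_mat n (p * q) C = poly_mat n p C * poly_mat n q C"
proof (induction p)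
  case 0 then show ?case using C by simp
next
  case (pCons a p)
  have c: "poly_mat n p C \<in> carrier_mat n n" "poly_mat n q C \<in> carrier_mat n n" "C * poly_mat n p C \<in> carrier_mat n n"
    using C by (auto intro: mult_carrier_mat)
  have "poly_mat n (pCons a p * q) C = a \<cdot>\<^sub>m poly_mat n q C + (0 \<cdot>\<^sub>m 1\<^sub>m n + C * (poly_mat n p C * poly_mat n q C))"
    using C pCons by (simp add: poly_mat_add poly_mat_smult poly_mat_pCons)
  also have "C * (poly_mat n p C * poly_mat n q C) = C * poly_mat n p C * poly_mat n q C"
    using assoc_mult_mat[OF C c(1,2)] by simp
  also have "a \<cdot>\<^sub>m poly_mat n q C + (0 \<cdot>\<^sub>m 1\<^sub>m n + C * poly_mat n p C * poly_mat n q C)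
       = (a \<cdot>\<^sub>m 1\<^sub>m n) * poly_mat n q C + C * poly_mat n p C * poly_mat n q C"
    using c C by (auto intro!: eq_matI simp del: index_mult_mat(1) simp: mult_smult_assoc_mat[OF one_carrier_mat c(2)])
  also have "\<dots> = (a \<cdot>\<^sub>m 1\<^sub>m n + C * poly_mat n p C) * poly_mat n q C"
    using c by (intro add_mult_distrib_mat[symmetric]) auto
  finally show ?case using C by (simp add: poly_mat_pCons)
qed

text \<open>
  With \<open>C = D\<close> this says that \<open>Y\<close> commutes with all polynomials in \<open>C\<close> once it commutes with \<open>C\<close>.
\<close>

lemma poly_mat_intertwine:
  assumes C: "C \<in> carrier_mat n n" and D: "D \<in> carrier_mat m m" and Y: "Y \<in> carrier_mat n m" and eq: "C * Y = Y * D"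
  shows "poly_mat n p C * Y = Y * poly_mat m p D"
proof (induction p)
  case 0 then show ?case using Y by simp
next
  case (pCons a p)
  have c: "poly_mat n p C \<in> carrier_mat n n" "poly_mat m p D \<in> carrier_mat m m" "C * poly_mat n p C \<in> carrier_mat n n"
    "D * poly_mat m p D \<in> carrier_mat m m"
    using C D by (auto intro: mult_carrier_mat)
  have "C * poly_mat n p C * Y = C * (Y * poly_mat m p D)"
    using assoc_mult_mat[OF C c(1) Y] pCons by simp
  also have "\<dots> = Y * D * poly_mat m p D" using assoc_mult_mat[OF C Y c(2)] eq by simp
  also have "\<dots> = Y * (D * poly_mat m p D)" by (rule assoc_mult_mat[OF Y D c(2)])
  finally have 1: "C * poly_mat n p C * Y = Y * (D * poly_mat m p D)" .
  have 2: "(a \<cdot>\<^sub>m 1\<^sub>m n) * Y = Y * (a \<cdot>\<^sub>m 1\<^sub>m m)"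
    using Y by (simp add: mult_smult_assoc_mat[OF one_carrier_mat Y] mult_smult_distrib[OF Y one_carrier_mat])
  have "(a \<cdot>\<^sub>m 1\<^sub>m n + C * poly_mat n p C) * Y = (a \<cdot>\<^sub>m 1\<^sub>m n) * Y + C * poly_mat n p C * Y"
    using c Y by (intro add_mult_distrib_mat) auto
  also have "\<dots> = Y * (a \<cdot>\<^sub>m 1\<^sub>m m) + Y * (D * poly_mat m p D)" by (simp only: 1 2)
  also have "\<dots> = Y * (a \<cdot>\<^sub>m 1\<^sub>m m + D * poly_mat m p D)"
    using c Y by (intro mult_add_distrib_mat[symmetric]) auto
  finally show ?case using C D by (simp add: poly_mat_pCons)
qed

lemma poly_mat_sum_index:
  assumes C: "C \<in> carrier_mat n n" and ij: "i < n" "j < n"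
  shows "poly_mat n (\<Sum>h\<in>H. f h) C $$ (i, j) = (\<Sum>h\<in>H. poly_mat n (f h) C $$ (i, j))"
  by (induction H rule: infinite_finite_induct) (use C ij in \<open>auto simp: poly_mat_add\<close>)

text \<open>
  Substituting \<open>A\<close> for the variable, with \<open>A\<close> to the right of the coefficient matrices, maps a
  matrix of polynomials \<open>Q\<close> to the matrix whose \<open>(i, j)\<close> entry is the sum over \<open>l\<close> of
  \<open>poly_mat n (Q $$ (i, l)) A $$ (l, j)\<close>. A left multiple of the characteristic matrix \<open>x I - A\<close>
  goes to 0. The adjugate shows that \<open>char_poly A \<cdot>\<^sub>m 1\<^sub>m n\<close> is such a multiple, and its image is
  \<open>poly_mat n (char_poly A) A\<close>.
\<close>

theorem cayley_hamilton:
  fixes A :: "'a::comm_ring_1 mat"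
  assumes A: "A \<in> carrier_mat n n"
  shows "poly_mat n (char_poly A) A = 0\<^sub>m n n"
proof (rule eq_matI)
  fix i j assume "i < dim_row (0\<^sub>m n n :: 'a mat)" "j < dim_col (0\<^sub>m n n :: 'a mat)"
  then have ij: "i < n" "j < n" by auto
  let ?M = "char_poly_matrix A"
  have M: "?M \<in> carrier_mat n n" using A by simp
  define P where "P = adj_mat ?M"
  have P: "P \<in> carrier_mat n n" "P * ?M = char_poly A \<cdot>\<^sub>m 1\<^sub>m n"
    using adj_mat(1,3)[OF M] by (auto simp: P_def char_poly_def)
  have idx: "?M $$ (h, l) = (if h = l then [:0, 1:] else 0) + [:- A $$ (h, l):]" if "h < n" "l < n" for h l
    using that A by (simp add: char_poly_matrix_def)
  let ?p = "\<lambda>h. poly_mat n (P $$ (i, h)) A"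
  \<comment> \<open>summed over \<open>l\<close>, the two terms are entries of \<open>A * ?p h\<close> and cancel\<close>
  have trm: "poly_mat n (P $$ (i, h) * ?M $$ (h, l)) A $$ (l, j) =
      (if h = l then (A * ?p h) $$ (h, j) else 0) - A $$ (h, l) * ?p h $$ (l, j)" if "h < n" "l < n" for h l
  proof -
    have X: "P $$ (i, h) * ?M $$ (h, l) = (if h = l then pCons 0 (P $$ (i, h)) else 0) - Polynomial.smult (A $$ (h, l)) (P $$ (i, h))"
      using that by (auto simp: idx)
    have c: "A * ?p h \<in> carrier_mat n n" using A by (auto intro: mult_carrier_mat)
    have "poly_mat n (P $$ (i, h) * ?M $$ (h, l)) A =
       (if h = l then 0 \<cdot>\<^sub>m 1\<^sub>m n + A * ?p h else 0\<^sub>m n n) - A $$ (h, l) \<cdot>\<^sub>m ?p h"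
      unfolding X poly_mat_diff[OF A] poly_mat_smult[OF A] by (simp add: poly_mat_pCons[OF A])
    then show ?thesis using that ij A c by (simp del: index_mult_mat(1))
  qed
  have entry: "(P * ?M) $$ (i, l) = (\<Sum>h = 0..<n. P $$ (i, h) * ?M $$ (h, l))" if "l < n" for l
    using P(1) M ij that by (simp add: scalar_prod_def del: char_poly_matrix_closed)
  have "poly_mat n (char_poly A) A $$ (i, j) = (\<Sum>l = 0..<n. if l = i then poly_mat n (char_poly A) A $$ (l, j) else 0)"
    using ij by simp
  also have "\<dots> = (\<Sum>l = 0..<n. poly_mat n ((P * ?M) $$ (i, l)) A $$ (l, j))"
    using ij A by (intro sum.cong refl) (auto simp: P(2))
  also have "\<dots> = (\<Sum>l = 0..<n. \<Sum>h = 0..<n. poly_mat n (P $$ (i, h) * ?M $$ (h, l)) A $$ (l, j))"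
    using ij A by (intro sum.cong refl) (simp add: entry poly_mat_sum_index)
  also have "\<dots> = (\<Sum>h = 0..<n. \<Sum>l = 0..<n. poly_mat n (P $$ (i, h) * ?M $$ (h, l)) A $$ (l, j))"
    by (rule sum.swap)
  also have "\<dots> = (\<Sum>h = 0..<n. \<Sum>l = 0..<n. (if h = l then (A * ?p h) $$ (h, j) else 0) - A $$ (h, l) * ?p h $$ (l, j))"
    by (intro sum.cong refl trm) auto
  also have "\<dots> = (\<Sum>h = 0..<n. (A * ?p h) $$ (h, j) - (\<Sum>l = 0..<n. A $$ (h, l) * ?p h $$ (l, j)))"
    by (intro sum.cong refl) (simp add: sum_subtractf)
  also have "\<dots> = 0"
    using A ij by (intro sum.neutral) (auto simp: scalar_prod_def)
  finally show "poly_mat n (char_poly A) A $$ (i, j) = 0\<^sub>m n n $$ (i, j)" using ij by simp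
qed (use A in auto)

section \<open>Matrices with irreducible characteristic polynomial\<close>

lemma mat_eq_if_mult_vec_eq:
  fixes A B :: "'a::comm_ring_1 mat"
  assumes A: "A \<in> carrier_mat m n" and B: "B \<in> carrier_mat m n"
    and eq: "\<And>v. v \<in> carrier_vec n \<Longrightarrow> A *\<^sub>v v = B *\<^sub>v v"
  shows "A = B"
proof (rule eq_matI)
  fix i j assume ij: "i < dim_row B" "j < dim_col B"
  have "C $$ (i, j) = (C *\<^sub>v unit_vec n j) $ i" if C: "C \<in> carrier_mat m n" for C :: "'a mat"
    using C ij B by simp
  then show "A $$ (i, j) = B $$ (i, j)" using A B eq by simp
qed (use A B in auto)

lemma irreducible_bezout:
  fixes p q :: "'a::field_gcd poly"
  assumes "irreducible q" "\<not> q dvd p"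
  obtains a b where "a * p + b * q = 1"
proof -
  have "prime_elem q" using assms(1) by (rule irreducible_imp_prime_elem_gcd)
  then have "algebraic_semidom_class.coprime q p" using assms(2) by (rule prime_elem_imp_coprime)
  then have "gcd p q = 1" by (subst gcd.commute) (rule coprime_imp_gcd_eq_1)
  then show ?thesis using that bezout_coefficients_fst_snd[of p q] by simp
qed

lemma irreducible_char_poly_degree_pos:
  fixes C :: "'a::field mat"
  assumes "C \<in> carrier_mat d d" "irreducible (char_poly C)"
  shows "d > 0"
  using degree_monic_char_poly[OF assms(1)] irreducible_degree_field[OF assms(2)] by simp

text \<open>
  A nonzero polynomial of smaller degree is coprime to the characteristic polynomial, so by
  Bezout and Cayley-Hamilton its value at \<open>C\<close> is invertible.
\<close>

lemma irreducible_char_poly_no_annihilator: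
  fixes C :: "'a::field_gcd mat"
  assumes C: "C \<in> carrier_mat d d" and irr: "irreducible (char_poly C)"
    and v: "v \<in> carrier_vec d" "v \<noteq> 0\<^sub>v d" and g: "poly_mat d g C *\<^sub>v v = 0\<^sub>v d" "degree g < d"
  shows "g = 0"
proof (rule ccontr)
  assume "g \<noteq> 0"
  then have "\<not> char_poly C dvd g"
    using degree_monic_char_poly[OF C] g(2) dvd_imp_degree_le[of "char_poly C" g] by auto
  then obtain a b where ab: "a * g + b * char_poly C = 1" using irreducible_bezout[OF irr] by blast
  have c: "poly_mat d p C \<in> carrier_mat d d" for p using C by simp
  have "poly_mat d (a * g + b * char_poly C) C = poly_mat d a C * poly_mat d g C + poly_mat d b C * 0\<^sub>m d d"
    using C by (simp add: poly_mat_add poly_mat_mult cayley_hamilton)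
  also have "\<dots> = poly_mat d a C * poly_mat d g C"
    using right_mult_zero_mat[OF c[of b], of d] right_add_zero_mat[OF mult_carrier_mat[OF c c]] by simp
  finally have "poly_mat d a C * poly_mat d g C = 1\<^sub>m d" using C by (simp add: ab)
  then have "v = (poly_mat d a C * poly_mat d g C) *\<^sub>v v" using v by simp
  also have "\<dots> = poly_mat d a C *\<^sub>v 0\<^sub>v d" using assoc_mult_mat_vec[OF c c v(1)] g(1) by simp
  also have "\<dots> = 0\<^sub>v d" using c[of a] by (intro eq_vecI) auto
  finally show False using v by simp
qed

lemma coeff_Poly_list_of_vec: "coeff (Poly (list_of_vec w)) i = (if i < dim_vec w then w $ i else 0)"
  by (simp add: coeff_Poly_eq nth_default_def list_of_vec_index)

text \<open>
  There are as many polynomials of degree below \<open>d\<close> as vectors, and by the previous lemma they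
  move \<open>v\<close> to different vectors.
\<close>

lemma irreducible_char_poly_cyclic:
  fixes C :: "'a::{field_gcd, finite} mat"
  assumes C: "C \<in> carrier_mat d d" and irr: "irreducible (char_poly C)"
    and v: "v \<in> carrier_vec d" "v \<noteq> 0\<^sub>v d" and u: "u \<in> carrier_vec d"
  obtains g where "u = poly_mat d g C *\<^sub>v v"
proof -
  let ?P = "\<lambda>w. Poly (list_of_vec w)"
  let ?f = "\<lambda>w. poly_mat d (?P w) C *\<^sub>v v"
  have d: "d > 0" by (rule irreducible_char_poly_degree_pos[OF C irr])
  have c: "poly_mat d p C \<in> carrier_mat d d" for p using C by simp
  have "inj_on ?f (carrier_vec d)"
  proof (rule inj_onI)
    fix w w' :: "'a vec" assume w: "w \<in> carrier_vec d" "w' \<in> carrier_vec d" "?f w = ?f w'"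
    have "poly_mat d (?P w - ?P w') C *\<^sub>v v = ?f w - ?f w'"
      unfolding poly_mat_diff[OF C] by (rule minus_mult_distrib_mat_vec[OF c c v(1)])
    also have "\<dots> = 0\<^sub>v d" using w(3) mult_mat_vec_carrier[OF c v(1)] by simp
    finally have "poly_mat d (?P w - ?P w') C *\<^sub>v v = 0\<^sub>v d" .
    moreover have "degree (?P w - ?P w') < d"
    proof -
      have "degree (?P w - ?P w') \<le> d - 1"
        by (rule degree_le) (use w in \<open>auto simp: coeff_Poly_list_of_vec simp del: coeff_Poly_eq\<close>)
      then show ?thesis using d by simp
    qed
    ultimately have "?P w - ?P w' = 0" by (rule irreducible_char_poly_no_annihilator[OF C irr v])
    then have "coeff (?P w) i = coeff (?P w') i" for i by simp
    then have "w $ i = w' $ i" if "i < d" for i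
      using that w unfolding coeff_Poly_list_of_vec by (metis carrier_vecD)
    then show "w = w'" using w by (intro eq_vecI) auto
  qed
  moreover have "?f ` carrier_vec d \<subseteq> carrier_vec d" using mult_mat_vec_carrier[OF c v(1)] by auto
  ultimately have "?f ` carrier_vec d = carrier_vec d" by (intro endo_inj_surj finite_carrier_vec)
  then show ?thesis using u that by blast
qed

text \<open>
  A matrix that commutes with \<open>C\<close> is determined by the image of one nonzero vector, since every
  nonzero vector is cyclic.
\<close>

lemma commutant_zero:
  fixes C :: "'a::{field_gcd, finite} mat"
  assumes C: "C \<in> carrier_mat d d" and irr: "irreducible (char_poly C)"
    and v: "v \<in> carrier_vec d" "v \<noteq> 0\<^sub>v d"
    and X: "X \<in> carrier_mat d d" "X * C = C * X" "X *\<^sub>v v = 0\<^sub>v d"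
  shows "X = 0\<^sub>m d d"
proof (rule mat_eq_if_mult_vec_eq)
  fix u :: "'a vec" assume u: "u \<in> carrier_vec d"
  obtain g where g: "u = poly_mat d g C *\<^sub>v v" by (rule irreducible_char_poly_cyclic[OF C irr v u])
  have c: "poly_mat d g C \<in> carrier_mat d d" using C by simp
  have "X *\<^sub>v u = (X * poly_mat d g C) *\<^sub>v v" using g assoc_mult_mat_vec[OF X(1) c v(1)] by simp
  also have "X * poly_mat d g C = poly_mat d g C * X"
    using poly_mat_intertwine[OF C C X(1) X(2)[symmetric]] by simp
  also have "\<dots> *\<^sub>v v = poly_mat d g C *\<^sub>v 0\<^sub>v d" using assoc_mult_mat_vec[OF c X(1) v(1)] X(3) by simp
  also have "\<dots> = 0\<^sub>v d" using c by (intro eq_vecI) auto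
  also have "\<dots> = 0\<^sub>m d d *\<^sub>v u" using u by (intro eq_vecI) auto
  finally show "X *\<^sub>v u = 0\<^sub>m d d *\<^sub>v u" .
qed (use X in auto)

lemma card_commutant_le:
  fixes C :: "'a::{field_gcd, finite} mat"
  assumes C: "C \<in> carrier_mat d d" and irr: "irreducible (char_poly C)"
  shows "finite {X \<in> carrier_mat d d. X * C = C * X}" "card {X \<in> carrier_mat d d. X * C = C * X} \<le> CARD('a) ^ d"
proof -
  let ?Z = "{X \<in> carrier_mat d d. X * C = C * X}" and ?v = "unit_vec d 0 :: 'a vec"
  have d: "d > 0" by (rule irreducible_char_poly_degree_pos[OF C irr])
  then have v: "?v \<in> carrier_vec d" "?v \<noteq> 0\<^sub>v d" by (auto dest: arg_cong[of _ _ "\<lambda>v. v $ 0"])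
  have inj: "inj_on (\<lambda>X. X *\<^sub>v ?v) ?Z"
  proof (rule inj_onI)
    fix X Y assume X: "X \<in> ?Z" and Y: "Y \<in> ?Z" and eq: "X *\<^sub>v ?v = Y *\<^sub>v ?v"
    have "X - Y = 0\<^sub>m d d"
    proof (rule commutant_zero[OF C irr v])
      show "X - Y \<in> carrier_mat d d" using X Y by auto
      show "(X - Y) * C = C * (X - Y)"
        using X Y C by (auto simp: minus_mult_distrib_mat mult_minus_distrib_mat)
      show "(X - Y) *\<^sub>v ?v = 0\<^sub>v d"
        using X Y v eq by (auto simp: minus_mult_distrib_mat_vec)
    qed
    show "X = Y"
    proof (rule eq_matI)
      fix i j assume ij: "i < dim_row Y" "j < dim_col Y"
      then have "i < d" "j < d" using Y by auto
      then have "(X - Y) $$ (i, j) = 0" using \<open>X - Y = 0\<^sub>m d d\<close> by simp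
      then show "X $$ (i, j) = Y $$ (i, j)" using ij X Y by auto
    qed (use X Y in auto)
  qed
  have sub: "(\<lambda>X. X *\<^sub>v ?v) ` ?Z \<subseteq> carrier_vec d" by auto
  show "finite ?Z" using inj_on_finite[OF inj sub finite_carrier_vec] .
  show "card ?Z \<le> CARD('a) ^ d"
    using card_inj_on_le[OF inj sub finite_carrier_vec] by (simp add: card_carrier_vec)
qed

text \<open>
  If \<open>a * char_poly D + b * char_poly C = 1\<close>, then \<open>Y\<close> is the value of \<open>a * char_poly D\<close> at \<open>C\<close>
  applied to \<open>Y\<close>, and moving this polynomial past \<open>Y\<close> gives a value at \<open>D\<close>, which is 0.
\<close>

lemma intertwiner_zero:
  fixes C D :: "'a::field_gcd mat"
  assumes C: "C \<in> carrier_mat d d" and D: "D \<in> carrier_mat e e" and Y: "Y \<in> carrier_mat d e"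
    and eq: "C * Y = Y * D" and irr: "irreducible (char_poly C)" and ndvd: "\<not> char_poly C dvd char_poly D"
  shows "Y = 0\<^sub>m d e"
proof -
  obtain a b where ab: "a * char_poly D + b * char_poly C = 1" using irreducible_bezout[OF irr ndvd] by blast
  have c: "poly_mat d p C \<in> carrier_mat d d" for p using C by simp
  have "1\<^sub>m d = poly_mat d (a * char_poly D + b * char_poly C) C" using C by (simp add: ab)
  also have "\<dots> = poly_mat d a C * poly_mat d (char_poly D) C + poly_mat d b C * 0\<^sub>m d d"
    using C by (simp add: poly_mat_add poly_mat_mult cayley_hamilton)
  also have "\<dots> = poly_mat d a C * poly_mat d (char_poly D) C"
    using right_mult_zero_mat[OF c[of b], of d] right_add_zero_mat[OF mult_carrier_mat[OF c c]] by simp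
  finally have 1: "poly_mat d a C * poly_mat d (char_poly D) C = 1\<^sub>m d" by simp
  have "Y = poly_mat d a C * poly_mat d (char_poly D) C * Y" using Y by (simp add: 1)
  also have "\<dots> = poly_mat d a C * (poly_mat d (char_poly D) C * Y)" by (rule assoc_mult_mat[OF c c Y])
  also have "poly_mat d (char_poly D) C * Y = Y * poly_mat e (char_poly D) D" by (rule poly_mat_intertwine[OF C D Y eq])
  also have "\<dots> = 0\<^sub>m d e" using right_mult_zero_mat[OF Y, of e] by (simp add: cayley_hamilton[OF D])
  also have "poly_mat d a C * 0\<^sub>m d e = 0\<^sub>m d e" using right_mult_zero_mat[OF c[of a]] by simp
  finally show ?thesis .
qed

text \<open>
  Converse of \<open>irreducible_char_poly_no_annihilator\<close>: if \<open>char_poly C = a * b\<close> with factors of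
  smaller degree, then \<open>b\<close> annihilates a vector \<open>v\<close> or \<open>a\<close> annihilates the image of \<open>v\<close> under \<open>b\<close>.
\<close>

lemma irreducible_char_polyI:
  fixes C :: "'a::field mat"
  assumes C: "C \<in> carrier_mat d d" and d: "d > 0"
    and inj: "\<And>v g. v \<in> carrier_vec d \<Longrightarrow> v \<noteq> 0\<^sub>v d \<Longrightarrow> degree g < d \<Longrightarrow> poly_mat d g C *\<^sub>v v = 0\<^sub>v d \<Longrightarrow> g = 0"
  shows "irreducible (char_poly C)"
proof (rule irreducibleI)
  have deg: "degree (char_poly C) = d" and nz: "char_poly C \<noteq> 0" using degree_monic_char_poly[OF C] by auto
  show "char_poly C \<noteq> 0" by fact
  show "\<not> is_unit (char_poly C)" using deg d by (auto simp: is_unit_iff_degree nz)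
  fix a b assume ab: "char_poly C = a * b"
  have ne: "a \<noteq> 0" "b \<noteq> 0" using ab nz by auto
  show "is_unit a \<or> is_unit b"
  proof (rule ccontr)
    assume "\<not> (is_unit a \<or> is_unit b)"
    then have pos: "degree a > 0" "degree b > 0" using ne by (auto simp: is_unit_iff_degree)
    have "degree a + degree b = d" using ab deg ne by (simp add: degree_mult_eq)
    then have lt: "degree a < d" "degree b < d" using pos by auto
    let ?v = "unit_vec d 0 :: 'a vec"
    have v: "?v \<in> carrier_vec d" "?v \<noteq> 0\<^sub>v d" using d by (auto dest: arg_cong[of _ _ "\<lambda>v. v $ 0"])
    have c: "poly_mat d p C \<in> carrier_mat d d" for p using C by simp
    have "poly_mat d b C *\<^sub>v ?v \<noteq> 0\<^sub>v d" using inj[OF v lt(2)] ne by blast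
    moreover have "poly_mat d a C *\<^sub>v (poly_mat d b C *\<^sub>v ?v) = 0\<^sub>v d"
    proof -
      have "poly_mat d a C *\<^sub>v (poly_mat d b C *\<^sub>v ?v) = poly_mat d (char_poly C) C *\<^sub>v ?v"
        using assoc_mult_mat_vec[OF c c v(1)] C by (simp add: ab poly_mat_mult)
      also have "\<dots> = 0\<^sub>v d" unfolding cayley_hamilton[OF C] using v by (intro eq_vecI) auto
      finally show ?thesis .
    qed
    ultimately show False using inj[OF mult_mat_vec_carrier[OF c v(1)] _ lt(1)] ne by blast
  qed
qed

text \<open>
  Multiplying a polynomial in the inverse \<open>D\<close> by a high power of \<open>C\<close> turns it into a polynomial in
  \<open>C\<close> of no larger degree, so an annihilator for \<open>D\<close> would give one for \<open>C\<close>.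
\<close>

lemma irreducible_char_poly_inverse:
  fixes C D :: "'a::field_gcd mat"
  assumes C: "C \<in> carrier_mat d d" and D: "D \<in> carrier_mat d d" and CD: "C * D = 1\<^sub>m d"
    and irr: "irreducible (char_poly C)"
  shows "irreducible (char_poly D)"
proof (rule irreducible_char_polyI[OF D irreducible_char_poly_degree_pos[OF C irr]])
  have c: "poly_mat d p C \<in> carrier_mat d d" "poly_mat d p D \<in> carrier_mat d d" for p using C D by auto
  \<comment> \<open>\<open>g'\<close> has the coefficients of \<open>g\<close> in reverse order, padded to length \<open>m + 1\<close>\<close>
  have rev: "\<exists>g'. degree g' \<le> m \<and> (g \<noteq> 0 \<longrightarrow> g' \<noteq> 0) \<and> poly_mat d (monom 1 m) C * poly_mat d g D = poly_mat d g' C"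
    if "degree g \<le> m" for g m
    using that
  proof (induction m arbitrary: g)
    case 0
    then obtain a where "g = [:a:]" using degree_eq_zeroE by auto
    then show ?case using C D by (intro exI[of _ g]) (simp add: monom_0)
  next
    case (Suc m)
    obtain a h where g: "g = pCons a h" by (rule pCons_cases)
    have "degree h \<le> m" using Suc.prems by (cases "h = 0") (auto simp: g)
    from Suc.IH[OF this] obtain h' where h': "degree h' \<le> m" "h \<noteq> 0 \<longrightarrow> h' \<noteq> 0"
      "poly_mat d (monom 1 m) C * poly_mat d h D = poly_mat d h' C" by blast
    have mono: "poly_mat d (monom 1 (Suc m)) C = poly_mat d (monom 1 m) C * C"
    proof -
      have "monom 1 (Suc m) = monom 1 m * [:0, 1 :: 'a:]" by (simp add: monom_Suc)
      moreover have "poly_mat d [:0, 1:] C = C"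
        using C by (simp add: poly_mat_pCons) (intro eq_matI, auto)
      ultimately show ?thesis using C by (simp only: poly_mat_mult)
    qed
    have "poly_mat d (monom 1 (Suc m)) C * (D * poly_mat d h D) = poly_mat d (monom 1 m) C * (C * (D * poly_mat d h D))"
      unfolding mono using assoc_mult_mat[OF c(1) C mult_carrier_mat[OF D c(2)]] by simp
    also have "C * (D * poly_mat d h D) = poly_mat d h D"
      using assoc_mult_mat[OF C D c(2)] CD c(2)[of h] by (metis left_mult_one_mat)
    finally have 1: "poly_mat d (monom 1 (Suc m)) C * (D * poly_mat d h D) = poly_mat d h' C" by (simp add: h')
    have "poly_mat d (monom 1 (Suc m)) C * poly_mat d g D =
       poly_mat d (monom 1 (Suc m)) C * (a \<cdot>\<^sub>m 1\<^sub>m d) + poly_mat d (monom 1 (Suc m)) C * (D * poly_mat d h D)"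
      unfolding g poly_mat_pCons[OF D] using mult_add_distrib_mat[OF c(1) _ mult_carrier_mat[OF D c(2)], of "a \<cdot>\<^sub>m 1\<^sub>m d"] by simp
    also have "poly_mat d (monom 1 (Suc m)) C * (a \<cdot>\<^sub>m 1\<^sub>m d) = poly_mat d (monom a (Suc m)) C"
    proof -
      have "monom a (Suc m) = Polynomial.smult a (monom 1 (Suc m))" by (simp add: smult_monom)
      then show ?thesis
        using mult_smult_distrib[OF c(1) one_carrier_mat, of "monom 1 (Suc m)" a] right_mult_one_mat[OF c(1)]
        by (simp add: poly_mat_smult[OF C])
    qed
    finally have "poly_mat d (monom 1 (Suc m)) C * poly_mat d g D = poly_mat d (monom a (Suc m) + h') C"
      using C by (simp add: 1 poly_mat_add)
    moreover have "degree (monom a (Suc m) + h') \<le> Suc m"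
      using h'(1) degree_monom_le[of a "Suc m"] by (intro degree_add_le) auto
    moreover have "monom a (Suc m) + h' \<noteq> 0" if "g \<noteq> 0"
    proof (cases "a = 0")
      case True
      then show ?thesis using that h'(2) by (simp add: g)
    next
      case False
      have "coeff (monom a (Suc m) + h') (Suc m) = a" using h'(1) by (simp add: coeff_eq_0)
      then show ?thesis using False by (metis coeff_0)
    qed
    ultimately show ?case by blast
  qed
  fix v g assume v: "v \<in> carrier_vec d" "v \<noteq> 0\<^sub>v d" and g: "degree g < d" "poly_mat d g D *\<^sub>v v = 0\<^sub>v d"
  have "degree g \<le> d - 1" using g(1) by simp
  from rev[OF this] obtain g' where g': "degree g' \<le> d - 1" "g \<noteq> 0 \<longrightarrow> g' \<noteq> 0"
    "poly_mat d (monom 1 (d - 1)) C * poly_mat d g D = poly_mat d g' C" by blast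
  have "poly_mat d g' C *\<^sub>v v = poly_mat d (monom 1 (d - 1)) C *\<^sub>v 0\<^sub>v d"
    using assoc_mult_mat_vec[OF c(1) c(2) v(1)] g(2) by (simp flip: g'(3))
  also have "\<dots> = 0\<^sub>v d" using c(1)[of "monom 1 (d - 1)"] by (intro eq_vecI) auto
  finally have "g' = 0" using irreducible_char_poly_no_annihilator[OF C irr v] g'(1) g(1) by simp
  then show "g = 0" using g'(2) by blast
qed

text \<open>
  The companion matrix \<open>C\<close> shifts the unit vectors, so a polynomial of degree below \<open>d\<close> moves the first
  unit vector to the vector of its coefficients. Both \<open>q\<close> and \<open>char_poly C\<close> annihilate that unit
  vector, and their difference has degree below \<open>d\<close>, so it vanishes. No determinant is computed.
\<close>

lemma ex_mat_with_char_poly: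
  fixes q :: "'a::field poly"
  assumes q: "monic q" "degree q = d" and d: "d > 0"
  shows "\<exists>C\<in>carrier_mat d d. char_poly C = q"
proof -
  define C where "C = mat d d (\<lambda>(i, j). if j = d - 1 then - coeff q i else if i = Suc j then 1 else 0)"
  have C: "C \<in> carrier_mat d d" by (simp add: C_def)
  let ?v = "unit_vec d 0 :: 'a vec"
  have c: "poly_mat d p C \<in> carrier_mat d d" for p using C by simp
  have v: "?v \<in> carrier_vec d" by simp
  have shift: "C *\<^sub>v w = vec d (\<lambda>i. (if i = 0 then 0 else w $ (i - 1)) - coeff q i * w $ (d - 1))"
    if w: "w \<in> carrier_vec d" for w
  proof (rule eq_vecI)
    fix i assume "i < dim_vec (vec d (\<lambda>i. (if i = 0 then 0 else w $ (i - 1)) - coeff q i * w $ (d - 1)))"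
    then have i: "i < d" by simp
    have "(C *\<^sub>v w) $ i = (\<Sum>j = 0..<d. (if j = d - 1 then - coeff q i else if i = Suc j then 1 else 0) * w $ j)"
      using i w C by (simp add: C_def scalar_prod_def)
    also have "\<dots> = (\<Sum>j = 0..<d. (if j = d - 1 then - coeff q i * w $ (d - 1) else 0) + (if j = i - 1 then (if i = 0 then 0 else w $ (i - 1)) else 0))"
      using i by (intro sum.cong refl) auto
    also have "\<dots> = - coeff q i * w $ (d - 1) + (if i = 0 then 0 else w $ (i - 1))"
      using i d by (simp add: sum.distrib)
    finally show "(C *\<^sub>v w) $ i = vec d (\<lambda>i. (if i = 0 then 0 else w $ (i - 1)) - coeff q i * w $ (d - 1)) $ i"
      using i by simp
  qed (use C in simp)
  have step: "poly_mat d (pCons a p) C *\<^sub>v ?v = a \<cdot>\<^sub>v ?v + C *\<^sub>v (poly_mat d p C *\<^sub>v ?v)" for a p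
    using assoc_mult_mat_vec[OF C c v] add_mult_distrib_mat_vec[OF _ mult_carrier_mat[OF C c] v, of "a \<cdot>\<^sub>m 1\<^sub>m d"]
    by (simp add: poly_mat_pCons[OF C] smult_mat_mult_vec[OF one_carrier_mat v])
  have low: "poly_mat d p C *\<^sub>v ?v = vec d (coeff p)" if "degree p < d" for p
    using that
  proof (induction p)
    case 0
    show ?case using d by (intro eq_vecI) auto
  next
    case (pCons a p)
    show ?case
    proof (cases "p = 0")
      case True
      have "poly_mat d [:a:] C *\<^sub>v ?v = a \<cdot>\<^sub>v ?v"
        using smult_mat_mult_vec[OF one_carrier_mat v] C by simp
      then show ?thesis using True d by (intro eq_vecI) (auto simp: unit_vec_def coeff_pCons split: nat.split)
    next
      case False
      then have deg: "Suc (degree p) < d" using pCons.prems by simp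
      have "C *\<^sub>v vec d (coeff p) = vec d (\<lambda>i. if i = 0 then 0 else coeff p (i - 1))"
        using deg d by (subst shift) (auto intro!: eq_vecI simp: coeff_eq_0)
      then show ?thesis
        using step[of a p] pCons.IH deg by (auto intro!: eq_vecI simp: unit_vec_def coeff_pCons split: nat.split)
    qed
  qed
  have "poly_mat d q C *\<^sub>v ?v = 0\<^sub>v d"
  proof -
    obtain a p where qp: "q = pCons a p" by (rule pCons_cases)
    have "p \<noteq> 0" using q d qp by (auto split: if_splits)
    then have deg: "Suc (degree p) = d" "coeff p (d - 1) = 1" using q by (auto simp: qp coeff_pCons split: nat.splits)
    have "C *\<^sub>v vec d (coeff p) = vec d (\<lambda>i. if i = 0 then - a else 0)"
      using deg d by (subst shift) (auto intro!: eq_vecI simp: qp coeff_pCons split: nat.split)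
    then show ?thesis
      using step[of a p] low[of p] deg by (auto intro!: eq_vecI simp: qp unit_vec_def)
  qed
  moreover have "poly_mat d (char_poly C) C *\<^sub>v ?v = 0\<^sub>v d"
    unfolding cayley_hamilton[OF C] using v by (intro eq_vecI) auto
  ultimately have zero: "poly_mat d (char_poly C - q) C *\<^sub>v ?v = 0\<^sub>v d"
    unfolding poly_mat_diff[OF C] minus_mult_distrib_mat_vec[OF c c v] by simp
  have "degree (char_poly C - q) < d"
  proof -
    have "degree (char_poly C - q) \<le> d - 1"
    proof (rule degree_le, intro allI impI)
      fix i assume "d - 1 < i"
      then have "d \<le> i" using d by simp
      then show "coeff (char_poly C - q) i = 0"
        using degree_monic_char_poly[OF C] q by (cases "i = d") (auto simp: coeff_eq_0)
    qed
    then show ?thesis using d by simp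
  qed
  from low[OF this] zero have "vec d (coeff (char_poly C - q)) = 0\<^sub>v d" by simp
  then have "coeff (char_poly C - q) i = 0" if "i < d" for i
    using that by (metis index_vec index_zero_vec(1))
  then have "char_poly C - q = 0"
    using \<open>degree (char_poly C - q) < d\<close> by (intro poly_eqI) (metis coeff_0 coeff_eq_0 not_less_iff_gr_or_eq order.strict_trans)
  then show ?thesis using C by auto
qed

abbreviation block_diag :: "nat \<Rightarrow> nat \<Rightarrow> 'a::zero mat \<Rightarrow> 'a mat \<Rightarrow> 'a mat" where
  "block_diag d e A D \<equiv> four_block_mat A (0\<^sub>m d e) (0\<^sub>m e d) D"

lemma char_poly_block_diag:
  fixes A D :: "'a::idom mat"
  assumes A: "A \<in> carrier_mat d d" and D: "D \<in> carrier_mat e e"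
  shows "char_poly (block_diag d e A D) = char_poly A * char_poly D"
proof -
  have "char_poly_matrix (block_diag d e A D) =
        block_diag d e (char_poly_matrix A) (char_poly_matrix D)"
    using A D by (intro eq_matI) (auto simp: char_poly_matrix_def)
  then show ?thesis
    unfolding char_poly_def using A D by (simp add: det_four_block_mat_lower_left_zero[of _ d _ e])
qed

lemma poly_char_poly_0:
  fixes A :: "'a::comm_ring_1 mat"
  assumes A: "A \<in> carrier_mat n n"
  shows "poly (char_poly A) 0 = (- 1) ^ n * det A"
proof -
  have "poly (char_poly A) 0 = det ((- 1) \<cdot>\<^sub>m A)"
    unfolding char_poly_def by (rule poly_det_cong[of _ n]) (use A in \<open>auto simp: char_poly_matrix_def\<close>)
  then show ?thesis using A by (simp add: det_smult)
qed

section \<open>Counting irreducible polynomials over a prime field\<close>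

text \<open>
  The polynomial \<open>x ^ (p ^ e) - x\<close>, in the shape in which its irreducible factors are described by
  \<open>degree_divisor\<close>.
\<close>

abbreviation frob_poly :: "nat \<Rightarrow> 'a::prime_card mod_ring poly" where
  "frob_poly e \<equiv> monom 1 1 ^ (CARD('a) ^ e) - monom 1 1"

definition monic_irreducibles :: "nat \<Rightarrow> 'a::field poly set" where
  "monic_irreducibles e = {f. monic f \<and> irreducible f \<and> degree f = e}"

lemma card_gt_1: "CARD('a::prime_card) > 1"
  by (rule prime_gt_1_nat) (rule prime_card)

lemma frob_poly_degree:
  assumes "e > 0"
  shows "degree (frob_poly e :: 'a::prime_card mod_ring poly) = CARD('a) ^ e" "monic (frob_poly e :: 'a mod_ring poly)"
proof -
  let ?N = "CARD('a) ^ e"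
  have N: "1 < ?N" using card_gt_1[where 'a = 'a] assms by (rule one_less_power)
  have F: "frob_poly e = (monom 1 ?N - monom 1 1 :: 'a mod_ring poly)" by (simp add: monom_power)
  have le: "degree (frob_poly e :: 'a mod_ring poly) \<le> ?N"
    unfolding F using N by (intro degree_diff_le degree_monom_le[THEN order_trans]) auto
  moreover have c: "coeff (frob_poly e :: 'a mod_ring poly) ?N = 1" unfolding F using N by simp
  ultimately show "degree (frob_poly e :: 'a mod_ring poly) = ?N" by (metis le_antisym le_degree zero_neq_one)
  then show "monic (frob_poly e :: 'a mod_ring poly)" using c by simp
qed

text \<open>
  The derivative is \<open>-1\<close>.
\<close>

lemma frob_poly_no_square_factor:
  assumes e: "e > 0" and dvd: "g * g dvd (frob_poly e :: 'a::prime_card mod_ring poly)"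
  shows "is_unit g"
proof -
  let ?N = "CARD('a) ^ e"
  obtain h where h: "frob_poly e = g * g * h" using dvd by (rule dvdE)
  have F: "frob_poly e = (monom 1 ?N - monom 1 1 :: 'a mod_ring poly)" by (simp add: monom_power)
  have "(of_nat ?N :: 'a mod_ring) = 0" using e by simp
  then have "pderiv (frob_poly e) = (- 1 :: 'a mod_ring poly)"
    unfolding F by (simp add: pderiv_diff pderiv_monom monom_0)
  moreover have "g dvd pderiv (frob_poly e)"
    unfolding h pderiv_mult by (simp add: algebra_simps)
  ultimately show ?thesis by simp
qed

lemma finite_monic_irreducibles: "finite (monic_irreducibles e :: 'a::prime_card mod_ring poly set)"
proof (rule finite_subset)
  show "monic_irreducibles e \<subseteq> (\<lambda>w. Poly (list_of_vec w)) ` (carrier_vec (Suc e) :: 'a mod_ring vec set)"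
  proof
    fix f :: "'a mod_ring poly" assume "f \<in> monic_irreducibles e"
    then have "degree f = e" by (simp add: monic_irreducibles_def)
    then have "f = Poly (list_of_vec (vec (Suc e) (coeff f)))"
      by (intro poly_eqI) (simp only: coeff_Poly_list_of_vec, auto simp: coeff_eq_0)
    then show "f \<in> (\<lambda>w. Poly (list_of_vec w)) ` carrier_vec (Suc e)" by (rule image_eqI) simp
  qed
qed simp

lemma monic_irreducible_dvd_imp_eq:
  fixes f g :: "'a::field_gcd poly"
  assumes "monic f" "irreducible f" "monic g" "irreducible g" "f dvd g"
  shows "f = g"
  using assms by (metis irreducible_altdef irreducible_not_unit monic_irreducible_gcd normalize_monic associated_eqI dvd_refl irreducibleD' )

lemma prime_elem_dvd_prodE:
  assumes "prime_elem f" "finite S" "f dvd \<Prod>S"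
  obtains g where "g \<in> S" "f dvd g"
  using assms(2,3)
proof (induction S arbitrary: thesis)
  case empty
  then show ?case using assms(1) by (simp add: prime_elem_not_unit)
next
  case (insert g S)
  then have "f dvd g * \<Prod>S" by simp
  then consider "f dvd g" | "f dvd \<Prod>S" using prime_elem_dvd_mult_iff[OF assms(1)] by blast
  then show ?case using insert by cases auto
qed

lemma prod_distinct_irreducibles_dvd:
  fixes F :: "'a::field_gcd poly"
  assumes "finite S" "\<And>f. f \<in> S \<Longrightarrow> monic f \<and> irreducible f \<and> f dvd F"
  shows "\<Prod>S dvd F"
  using assms
proof (induction S)
  case (insert f S)
  have f: "prime_elem f" using insert.prems[of f] by (intro irreducible_imp_prime_elem_gcd) auto
  obtain h where h: "F = \<Prod>S * h" using insert by (auto elim: dvdE)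
  have "\<not> f dvd \<Prod>S"
  proof
    assume "f dvd \<Prod>S"
    then obtain g where "g \<in> S" "f dvd g" using prime_elem_dvd_prodE[OF f insert.hyps(1)] by auto
    then show False using monic_irreducible_dvd_imp_eq[of f g] insert by auto
  qed
  moreover have "f dvd \<Prod>S * h" using insert.prems[of f] h by simp
  ultimately have "f dvd h" using prime_elem_dvd_mult_iff[OF f] by blast
  then show ?case using insert.hyps h by (simp add: mult.commute mult_dvd_mono)
qed simp

text \<open>
  All monic irreducible polynomials of degree \<open>e\<close> divide \<open>x ^ (p ^ e) - x\<close>; compare degrees.
\<close>

lemma card_monic_irreducibles_le:
  assumes e: "e > 0"
  shows "e * card (monic_irreducibles e :: 'a::prime_card mod_ring poly set) \<le> CARD('a) ^ e"
proof -
  let ?I = "monic_irreducibles e :: 'a mod_ring poly set"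
  have "\<Prod>?I dvd frob_poly e"
    by (rule prod_distinct_irreducibles_dvd[OF finite_monic_irreducibles])
       (use degree_divisor(1) in \<open>auto simp: monic_irreducibles_def\<close>)
  moreover have "frob_poly e \<noteq> (0 :: 'a mod_ring poly)" using frob_poly_degree(2)[OF e, where 'a = 'a] by auto
  ultimately have "degree (\<Prod>?I) \<le> CARD('a) ^ e" using frob_poly_degree(1)[OF e, where 'a = 'a] dvd_imp_degree_le by metis
  moreover have "degree (\<Prod>?I) = (\<Sum>f\<in>?I. degree f)"
    by (rule degree_prod_eq_sum_degree) (auto simp: monic_irreducibles_def)
  moreover have "(\<Sum>f\<in>?I. degree f) = (\<Sum>f\<in>?I. e)" by (rule sum.cong) (auto simp: monic_irreducibles_def)
  ultimately show ?thesis by (simp add: mult.commute)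
qed

text \<open>
  Conversely, \<open>x ^ (p ^ d) - x\<close> is the product of distinct monic irreducible polynomials of
  degree at most \<open>d\<close>; compare degrees again.
\<close>

lemma card_monic_irreducibles_ge:
  assumes d: "d > 0"
  shows "CARD('a) ^ d \<le> (\<Sum>e = 1..d. e * card (monic_irreducibles e :: 'a::prime_card mod_ring poly set))"
proof -
  let ?F = "frob_poly d :: 'a mod_ring poly"
  obtain as m where as: "finite as" "?F = (\<Prod>a\<in>as. a ^ Suc (m a))" "as \<subseteq> {q. irreducible q \<and> monic q}"
    using monic_irreducible_factorization[OF frob_poly_degree(2)[OF d]] by blast
  have dvd: "a ^ Suc (m a) dvd ?F" if "a \<in> as" for a unfolding as(2) using as(1) that by (rule dvd_prodI)
  have m0: "m a = 0" if a: "a \<in> as" for a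
  proof (rule ccontr)
    assume "m a \<noteq> 0"
    then have "a * a dvd a ^ Suc (m a)" by (cases "m a") (auto simp: mult.assoc[symmetric])
    then have "is_unit a" using dvd[OF a] frob_poly_no_square_factor[OF d] dvd_trans by blast
    then show False using as(3) a by (auto simp: irreducible_def)
  qed
  have deg: "degree a \<in> {1..d}" if a: "a \<in> as" for a
  proof -
    have irr: "irreducible a" using as(3) a by auto
    then have "degree a > 0" by (rule irreducible_degree_field)
    moreover have "a dvd ?F" using dvd[OF a] m0[OF a] by simp
    then have "\<not> d < degree a" using degree_divisor(2)[OF irr refl, of d] d by auto
    ultimately show ?thesis by simp
  qed
  have "CARD('a) ^ d = degree ?F" using frob_poly_degree(1)[OF d, where 'a = 'a] by simp
  also have "?F = \<Prod>as" using as(2) m0 by simp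
  also have "degree (\<Prod>as) = (\<Sum>a\<in>as. degree a)"
    by (rule degree_prod_eq_sum_degree) (use as(3) in auto)
  also have "\<dots> \<le> (\<Sum>a\<in>(\<Union>e\<in>{1..d}. monic_irreducibles e :: 'a mod_ring poly set). degree a)"
  proof (rule sum_mono2)
    show "finite (\<Union>e\<in>{1..d}. monic_irreducibles e :: 'a mod_ring poly set)" by (simp add: finite_monic_irreducibles)
    show "as \<subseteq> (\<Union>e\<in>{1..d}. monic_irreducibles e)" using deg as(3) by (auto simp: monic_irreducibles_def)
  qed simp
  also have "\<dots> = (\<Sum>e = 1..d. \<Sum>a\<in>(monic_irreducibles e :: 'a mod_ring poly set). degree a)"
    using finite_monic_irreducibles by (intro sum.UNION_disjoint) (auto simp: monic_irreducibles_def)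
  also have "\<dots> = (\<Sum>e = 1..d. e * card (monic_irreducibles e :: 'a mod_ring poly set))"
    by (intro sum.cong refl) (auto simp: monic_irreducibles_def)
  finally show ?thesis .
qed

text \<open>
  A monic polynomial with constant term \<open>c\<close> is determined by the \<open>d - 1\<close> coefficients in between.
\<close>

lemma card_monic_const_le:
  assumes d: "d > 0"
  shows "card {f \<in> (monic_irreducibles d :: 'a::prime_card mod_ring poly set). poly f 0 = c} \<le> CARD('a) ^ (d - 1)"
proof -
  let ?S = "{f \<in> (monic_irreducibles d :: 'a mod_ring poly set). poly f 0 = c}"
  let ?v = "\<lambda>f :: 'a mod_ring poly. vec (d - 1) (\<lambda>i. coeff f (Suc i))"
  have "inj_on ?v ?S"
  proof (rule inj_onI)
    fix f g assume fg: "f \<in> ?S" "g \<in> ?S" "?v f = ?v g"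
    have deg: "degree f = d" "degree g = d" "monic f" "monic g" using fg by (auto simp: monic_irreducibles_def)
    show "f = g"
    proof (rule poly_eqI)
      fix i
      consider "i = 0" | j where "i = Suc j" "j < d - 1" | "i = d" | "i > d" using d by (cases i) force+
      then show "coeff f i = coeff g i"
      proof cases
        case 1 then show ?thesis using fg by (auto simp: poly_0_coeff_0)
      next
        case 2 then show ?thesis using arg_cong[OF fg(3), of "\<lambda>v. v $ j"] by simp
      next
        case 3 then show ?thesis using deg by simp
      next
        case 4 then show ?thesis using deg by (simp add: coeff_eq_0)
      qed
    qed
  qed
  moreover have "?v ` ?S \<subseteq> carrier_vec (d - 1)" by auto
  ultimately have "card ?S \<le> card (carrier_vec (d - 1) :: 'a mod_ring vec set)"
    by (rule card_inj_on_le) simp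
  then show ?thesis by (simp add: card_carrier_vec)
qed

text \<open>
  The possible characteristic polynomials of \<open>C\<close> in a block \<open>diag (C, \<theta> C)\<close>: the value 0 is excluded for
  invertibility, the values \<open>\<plusminus>1\<close> are the constant terms that integral factors can have.
\<close>

definition admissible_irreducibles :: "nat \<Rightarrow> 'a::field poly set" where
  "admissible_irreducibles d = {f \<in> monic_irreducibles d. poly f 0 \<notin> {0, 1, - 1}}"

text \<open>
  Irreducible polynomials of degree below \<open>d\<close> account for at most \<open>d * p ^ (d - 1)\<close> of the degree
  \<open>p ^ d\<close>, and so do, up to a factor 3, the excluded constant terms. The bound \<open>p \<ge> 8 d\<close> makes both
  together at most one half.
\<close>

lemma card_admissible_irreducibles:
  assumes d: "d > 0" and p: "8 * d \<le> CARD('a::prime_card)"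
  shows "CARD('a) ^ d \<le> 2 * d * card (admissible_irreducibles d :: 'a mod_ring poly set)"
proof -
  let ?I = "\<lambda>e. monic_irreducibles e :: 'a mod_ring poly set" and ?p = "CARD('a)"
  let ?B = "\<lambda>c. {f \<in> ?I d. poly f 0 = c}"
  have pd: "?p ^ d = ?p * ?p ^ (d - 1)" using d by (cases d) auto
  have "?p ^ d \<le> (\<Sum>e = 1..d. e * card (?I e))" by (rule card_monic_irreducibles_ge[OF d])
  also have "{1..d} = insert d {1..d - 1}" using d by auto
  also have "(\<Sum>e\<in>insert d {1..d - 1}. e * card (?I e)) = d * card (?I d) + (\<Sum>e = 1..d - 1. e * card (?I e))"
    using d by (subst sum.insert) auto
  also have "(\<Sum>e = 1..d - 1. e * card (?I e)) \<le> (\<Sum>e = 1..d - 1. ?p ^ (d - 1))"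
  proof (rule sum_mono)
    fix e assume e: "e \<in> {1..d - 1}"
    then have "e * card (?I e) \<le> ?p ^ e" by (intro card_monic_irreducibles_le) auto
    also have "\<dots> \<le> ?p ^ (d - 1)" using e card_gt_1[where 'a = 'a] by (intro power_increasing) auto
    finally show "e * card (?I e) \<le> ?p ^ (d - 1)" .
  qed
  finally have 1: "?p ^ d \<le> d * card (?I d) + (d - 1) * ?p ^ (d - 1)" by simp
  have "?I d \<subseteq> admissible_irreducibles d \<union> (?B 0 \<union> ?B 1 \<union> ?B (- 1))" by (auto simp: admissible_irreducibles_def)
  then have "card (?I d) \<le> card (admissible_irreducibles d \<union> (?B 0 \<union> ?B 1 \<union> ?B (- 1)))"
    using finite_monic_irreducibles[of d, where 'a = 'a] by (intro card_mono) (auto simp: admissible_irreducibles_def)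
  also have "\<dots> \<le> card (admissible_irreducibles d :: 'a mod_ring poly set) + (card (?B 0) + card (?B 1) + card (?B (- 1)))"
    by (meson card_Un_le add_left_mono add_right_mono le_trans)
  also have "\<dots> \<le> card (admissible_irreducibles d :: 'a mod_ring poly set) + 3 * ?p ^ (d - 1)"
    using card_monic_const_le[OF d, where 'a = 'a, of 0] card_monic_const_le[OF d, where 'a = 'a, of 1]
      card_monic_const_le[OF d, where 'a = 'a, of "- 1"] by linarith
  finally have "d * card (?I d) \<le> d * (card (admissible_irreducibles d :: 'a mod_ring poly set) + 3 * ?p ^ (d - 1))"
    by (rule mult_le_mono2)
  with 1 have "?p ^ d \<le> d * card (admissible_irreducibles d :: 'a mod_ring poly set) + 3 * (d * ?p ^ (d - 1)) + (d - 1) * ?p ^ (d - 1)"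
    by (simp add: algebra_simps)
  also have "\<dots> \<le> d * card (admissible_irreducibles d :: 'a mod_ring poly set) + 4 * (d * ?p ^ (d - 1))"
    by (simp add: algebra_simps diff_le_self)
  finally have "2 * ?p ^ d \<le> 2 * d * card (admissible_irreducibles d :: 'a mod_ring poly set) + 8 * d * ?p ^ (d - 1)" by simp
  moreover have "8 * d * ?p ^ (d - 1) \<le> ?p ^ d" unfolding pd using p by (rule mult_le_mono1)
  ultimately show ?thesis by linarith
qed

section \<open>Counting by conjugacy classes\<close>

text \<open>
  Count the pairs of an index \<open>q\<close> and a conjugator \<open>x\<close>. For a given element \<open>g\<close> and a given \<open>q\<close> the solutions \<open>x\<close>
  of \<open>x \<otimes> h q = g \<otimes> x\<close> form a coset of the centraliser of \<open>h q\<close>, or there are none. The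
  classes of different \<open>q\<close> may coincide, but only up to \<open>k\<close> of them do.
\<close>

lemma (in group) card_conjugacy_classes:
  assumes fin: "finite (carrier G)" and Q: "finite Q" and h: "\<And>q. q \<in> Q \<Longrightarrow> h q \<in> carrier G"
    and cent: "\<And>q. q \<in> Q \<Longrightarrow> card {x \<in> carrier G. x \<otimes> h q = h q \<otimes> x} \<le> c"
    and few: "\<And>g. g \<in> carrier G \<Longrightarrow> card {q \<in> Q. \<exists>x\<in>carrier G. x \<otimes> h q = g \<otimes> x} \<le> k"
  shows "card Q * card (carrier G) \<le> k * c * card {g \<in> carrier G. \<exists>q\<in>Q. \<exists>x\<in>carrier G. x \<otimes> h q = g \<otimes> x}"
proof -
  let ?B = "{g \<in> carrier G. \<exists>q\<in>Q. \<exists>x\<in>carrier G. x \<otimes> h q = g \<otimes> x}"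
  let ?Qg = "\<lambda>g. {q \<in> Q. \<exists>x\<in>carrier G. x \<otimes> h q = g \<otimes> x}"
  let ?T = "\<lambda>g q. {x \<in> carrier G. x \<otimes> h q = g \<otimes> x}"
  have T: "card (?T g q) \<le> c" if g: "g \<in> carrier G" and q: "q \<in> Q" for g q
  proof (cases "?T g q = {}")
    case True
    then show ?thesis by (simp only: card.empty)
  next
    case False
    then obtain y where y: "y \<in> carrier G" "y \<otimes> h q = g \<otimes> y" by auto
    have "inj_on (\<lambda>x. inv y \<otimes> x) (?T g q)"
      using y(1) by (auto simp: inj_on_def)
    moreover have "(\<lambda>x. inv y \<otimes> x) ` ?T g q \<subseteq> {x \<in> carrier G. x \<otimes> h q = h q \<otimes> x}"
    proof
      fix z assume "z \<in> (\<lambda>x. inv y \<otimes> x) ` ?T g q"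
      then obtain x where x: "x \<in> carrier G" "x \<otimes> h q = g \<otimes> x" "z = inv y \<otimes> x" by auto
      \<comment> \<open>\<open>y\<close> conjugates \<open>h q\<close> to \<open>g\<close>, so left division by \<open>y\<close> lands in the centraliser\<close>
      have yg: "inv y \<otimes> g = h q \<otimes> inv y"
        using y g h[OF q] by (metis inv_closed inv_solve_left inv_solve_right m_assoc m_closed)
      have "z \<otimes> h q = inv y \<otimes> (g \<otimes> x)" using x y h[OF q] by (simp add: m_assoc)
      also have "\<dots> = inv y \<otimes> g \<otimes> x" using x y g by (simp add: m_assoc)
      also have "\<dots> = h q \<otimes> z" using x y h[OF q] by (simp add: yg m_assoc)
      finally show "z \<in> {x \<in> carrier G. x \<otimes> h q = h q \<otimes> x}" using x y by simp
    qed
    ultimately have "card (?T g q) \<le> card {x \<in> carrier G. x \<otimes> h q = h q \<otimes> x}"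
      by (rule card_inj_on_le) (use fin in auto)
    then show ?thesis using cent[OF q] by linarith
  qed
  have "Q \<times> carrier G \<subseteq> (\<Union>g\<in>?B. \<Union>q\<in>?Qg g. {q} \<times> ?T g q)"
  proof
    fix z assume "z \<in> Q \<times> carrier G"
    then obtain q x where z: "z = (q, x)" "q \<in> Q" "x \<in> carrier G" by auto
    define g where "g = x \<otimes> h q \<otimes> inv x"
    have "g \<in> carrier G" "x \<otimes> h q = g \<otimes> x" using z h by (auto simp: g_def m_assoc)
    then show "z \<in> (\<Union>g\<in>?B. \<Union>q\<in>?Qg g. {q} \<times> ?T g q)" using z by blast
  qed
  then have "card (Q \<times> carrier G) \<le> card (\<Union>g\<in>?B. \<Union>q\<in>?Qg g. {q} \<times> ?T g q)"
    using fin Q by (intro card_mono finite_UN_I) auto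
  also have "\<dots> \<le> (\<Sum>g\<in>?B. card (\<Union>q\<in>?Qg g. {q} \<times> ?T g q))" using fin by (intro card_UN_le) auto
  also have "\<dots> \<le> (\<Sum>g\<in>?B. k * c)"
  proof (rule sum_mono)
    fix g assume g: "g \<in> ?B"
    have "card (\<Union>q\<in>?Qg g. {q} \<times> ?T g q) \<le> (\<Sum>q\<in>?Qg g. card ({q} \<times> ?T g q))" using Q by (intro card_UN_le) auto
    also have "\<dots> \<le> (\<Sum>q\<in>?Qg g. c)" using T g by (intro sum_mono) (auto simp: card_cartesian_product)
    also have "\<dots> \<le> k * c" using few[of g] g by simp
    finally show "card (\<Union>q\<in>?Qg g. {q} \<times> ?T g q) \<le> k * c" .
  qed
  finally show ?thesis by (simp add: card_cartesian_product mult.commute)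
qed

section \<open>Certified elements of the finite groups\<close>

lemma finite_mats_with_entries:
  assumes A: "finite A"
  shows "finite {M \<in> carrier_mat k l. \<forall>i<k. \<forall>j<l. M $$ (i, j) \<in> A}"
proof (rule finite_subset)
  show "{M \<in> carrier_mat k l. \<forall>i<k. \<forall>j<l. M $$ (i, j) \<in> A} \<subseteq> (\<lambda>f. mat k l (\<lambda>x. f x)) ` ({..<k} \<times> {..<l} \<rightarrow>\<^sub>E A)"
  proof
    fix M assume M: "M \<in> {M \<in> carrier_mat k l. \<forall>i<k. \<forall>j<l. M $$ (i, j) \<in> A}"
    then have "M = mat k l (\<lambda>x. restrict (($$) M) ({..<k} \<times> {..<l}) x)" by (intro eq_matI) auto
    then show "M \<in> (\<lambda>f. mat k l (\<lambda>x. f x)) ` ({..<k} \<times> {..<l} \<rightarrow>\<^sub>E A)"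
      by (rule image_eqI[where x = "restrict (($$) M) ({..<k} \<times> {..<l})"]) (use M in auto)
  qed
qed (use A in \<open>auto intro!: finite_PiE\<close>)

lemma finite_carrier_mat: "finite (carrier_mat k l :: 'a::finite mat set)"
  using finite_mats_with_entries[of "UNIV :: 'a set" k l] by simp

lemma four_block_mat_eqD:
  assumes eq: "four_block_mat A B C D = four_block_mat A' B' C' D'"
    and c: "A \<in> carrier_mat d d" "B \<in> carrier_mat d e" "C \<in> carrier_mat e d" "D \<in> carrier_mat e e"
      "A' \<in> carrier_mat d d" "B' \<in> carrier_mat d e" "C' \<in> carrier_mat e d" "D' \<in> carrier_mat e e"
  shows "A = A'" "B = B'" "C = C'" "D = D'"
proof -
  have idx: "four_block_mat A B C D $$ (i, j) = four_block_mat A' B' C' D' $$ (i, j)" for i j using eq by simp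
  show "A = A'"
  proof (rule eq_matI)
    fix i j assume "i < dim_row A'" "j < dim_col A'"
    then show "A $$ (i, j) = A' $$ (i, j)" using c idx[of i j] by auto
  qed (use c in auto)
  show "B = B'"
  proof (rule eq_matI)
    fix i j assume "i < dim_row B'" "j < dim_col B'"
    then show "B $$ (i, j) = B' $$ (i, j)" using c idx[of i "d + j"] by auto
  qed (use c in auto)
  show "C = C'"
  proof (rule eq_matI)
    fix i j assume "i < dim_row C'" "j < dim_col C'"
    then show "C $$ (i, j) = C' $$ (i, j)" using c idx[of "d + i" j] by auto
  qed (use c in auto)
  show "D = D'"
  proof (rule eq_matI)
    fix i j assume "i < dim_row D'" "j < dim_col D'"
    then show "D $$ (i, j) = D' $$ (i, j)" using c idx[of "d + i" "d + j"] by auto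
  qed (use c in auto)
qed

lemma ex_four_block:
  assumes "x \<in> carrier_mat (d + e) (d + e)"
  obtains A B C D where "x = four_block_mat A B C D" "A \<in> carrier_mat d d" "B \<in> carrier_mat d e"
    "C \<in> carrier_mat e d" "D \<in> carrier_mat e e"
proof -
  obtain A B C D where s: "split_block x d d = (A, B, C, D)" by (cases "split_block x d d") auto
  from split_block[OF s, of e e] assms that show ?thesis by auto
qed

text \<open>
  The off-diagonal blocks of \<open>x\<close> intertwine \<open>C\<close> and \<open>D\<close>. Different irreducible characteristic
  polynomials are coprime, so these blocks vanish.
\<close>

lemma commutes_with_block_diag:
  fixes C D :: "'a::field_gcd mat"
  assumes C: "C \<in> carrier_mat d d" and D: "D \<in> carrier_mat e e"
    and irr: "irreducible (char_poly C)" "irreducible (char_poly D)" and ne: "char_poly C \<noteq> char_poly D"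
    and x: "x \<in> carrier_mat (d + e) (d + e)"
    and comm: "x * block_diag d e C D = block_diag d e C D * x"
  obtains X W where "x = block_diag d e X W" "X \<in> carrier_mat d d" "W \<in> carrier_mat e e"
    "X * C = C * X"
proof -
  obtain X Y Z W where b: "x = four_block_mat X Y Z W" "X \<in> carrier_mat d d" "Y \<in> carrier_mat d e"
    "Z \<in> carrier_mat e d" "W \<in> carrier_mat e e" by (rule ex_four_block[OF x])
  have 1: "x * block_diag d e C D = four_block_mat (X * C) (Y * D) (Z * C) (W * D)"
    unfolding b(1) using b C D by (subst mult_four_block_mat[of _ d d _ e _ e _ _ d _ e]) auto
  have 2: "block_diag d e C D * x = four_block_mat (C * X) (C * Y) (D * Z) (D * W)"
    unfolding b(1) using b C D by (subst mult_four_block_mat[of _ d d _ e _ e _ _ d _ e]) auto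
  have eqs: "X * C = C * X" "Y * D = C * Y" "Z * C = D * Z"
    using four_block_mat_eqD[OF comm[unfolded 1 2], of d e] b C D by auto
  have mon: "monic (char_poly C)" "monic (char_poly D)"
    using degree_monic_char_poly[OF C] degree_monic_char_poly[OF D] by auto
  have "\<not> char_poly C dvd char_poly D" "\<not> char_poly D dvd char_poly C"
    using monic_irreducible_dvd_imp_eq mon irr ne by metis+
  then have "Y = 0\<^sub>m d e" "Z = 0\<^sub>m e d"
    using intertwiner_zero[OF C D b(3) eqs(2)[symmetric] irr(1)] intertwiner_zero[OF D C b(4) eqs(3)[symmetric] irr(2)] by auto
  then show ?thesis using that b eqs by blast
qed

text \<open>
  The factorisation pattern modulo \<open>p\<close> that proves irreducibility over the integers.
\<close>

definition certified :: "'a::field mat \<Rightarrow> bool" where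
  "certified x \<longleftrightarrow> (\<exists>q r. char_poly x = q * r \<and> monic q \<and> irreducible q \<and> irreducible r \<and> poly q 0 \<notin> {1, - 1})"

text \<open>
  The elements \<open>diag (C, \<theta> C)\<close>, where \<open>char_poly C\<close> runs over the admissible polynomials, are certified.
  Their centralisers embed into the commutant of \<open>C\<close> by the assumption \<open>unique\<close>, and an element \<open>g\<close> can be
  conjugate to at most two of them, because the polynomial \<open>q\<close> must be one of the two irreducible
  factors of \<open>char_poly g\<close>.
\<close>

lemma card_certified:
  fixes H :: "'a::prime_card mod_ring mat set"
  assumes group: "group (matrix_group (d + e) H)" and H: "H \<subseteq> carrier_mat (d + e) (d + e)"
    and d: "d > 0" and p: "8 * d \<le> CARD('a)"
    and \<theta>: "\<And>C :: 'a mod_ring mat. C \<in> carrier_mat d d \<Longrightarrow> det C \<notin> {0, 1, - 1} \<Longrightarrow> irreducible (char_poly C) \<Longrightarrow>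
        \<theta> C \<in> carrier_mat e e \<and> block_diag d e C (\<theta> C) \<in> H \<and>
        irreducible (char_poly (\<theta> C)) \<and> char_poly (\<theta> C) \<noteq> char_poly C"
    and unique: "\<And>X W W'. X \<in> carrier_mat d d \<Longrightarrow> W \<in> carrier_mat e e \<Longrightarrow> W' \<in> carrier_mat e e \<Longrightarrow>
        block_diag d e X W \<in> H \<Longrightarrow> block_diag d e X W' \<in> H \<Longrightarrow> W = W'"
  shows "card H \<le> 4 * d * card {x \<in> H. certified x}"
proof -
  interpret H: group "matrix_group (d + e) H" by fact
  have car: "carrier (matrix_group (d + e) H) = H" and mul: "\<And>x y. x \<otimes>\<^bsub>matrix_group (d + e) H\<^esub> y = x * y"
    and one: "\<one>\<^bsub>matrix_group (d + e) H\<^esub> = 1\<^sub>m (d + e)"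
    by (auto simp: matrix_group_def)
  let ?Q = "admissible_irreducibles d :: 'a mod_ring poly set"
  have finH: "finite H" using H finite_carrier_mat by (rule finite_subset)
  have finQ: "finite ?Q" using finite_monic_irreducibles[of d, where 'a = 'a] by (simp add: admissible_irreducibles_def)
  have "\<exists>C\<in>carrier_mat d d. char_poly C = q" if "q \<in> ?Q" for q
    using that ex_mat_with_char_poly[of q d] d by (auto simp: admissible_irreducibles_def monic_irreducibles_def)
  then obtain C where C: "\<And>q. q \<in> ?Q \<Longrightarrow> C q \<in> carrier_mat d d \<and> char_poly (C q) = q" by metis
  define h where "h q = block_diag d e (C q) (\<theta> (C q))" for q
  have Cq: "C q \<in> carrier_mat d d" "char_poly (C q) = q" "irreducible q" "monic q" "poly q 0 \<notin> {0, 1, - 1}"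
    "\<theta> (C q) \<in> carrier_mat e e" "h q \<in> H" "irreducible (char_poly (\<theta> (C q)))" "char_poly (\<theta> (C q)) \<noteq> q"
    "h q \<in> carrier_mat (d + e) (d + e)" "char_poly (h q) = q * char_poly (\<theta> (C q))"
    if q: "q \<in> ?Q" for q
  proof -
    show a: "C q \<in> carrier_mat d d" "char_poly (C q) = q" using C[OF q] by auto
    show b: "irreducible q" "monic q" "poly q 0 \<notin> {0, 1, - 1}" using q by (auto simp: admissible_irreducibles_def monic_irreducibles_def)
    have "poly q 0 = (- 1) ^ d * det (C q)" using poly_char_poly_0[OF a(1)] a(2) by simp
    then have "det (C q) \<notin> {0, 1, - 1}" using b(3) by (cases "even d") (auto simp: equation_minus_iff minus_equation_iff)
    from \<theta>[OF a(1) this] b(1) a(2)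
    show "\<theta> (C q) \<in> carrier_mat e e" "h q \<in> H" "irreducible (char_poly (\<theta> (C q)))" "char_poly (\<theta> (C q)) \<noteq> q"
      by (auto simp: h_def)
    then show "h q \<in> carrier_mat (d + e) (d + e)" "char_poly (h q) = q * char_poly (\<theta> (C q))"
      using H char_poly_block_diag[OF a(1), of "\<theta> (C q)" e] a(2) by (auto simp: h_def)
  qed
  have conj: "char_poly g = char_poly (h q)" if q: "q \<in> ?Q" and g: "g \<in> H" and x: "x \<in> H" "x * h q = g * x" for g q x
  proof -
    obtain y where y: "y \<in> H" "y * x = 1\<^sub>m (d + e)" using H.l_inv_ex[of x] x car mul one by auto
    have c: "x \<in> carrier_mat (d + e) (d + e)" "y \<in> carrier_mat (d + e) (d + e)" "g \<in> carrier_mat (d + e) (d + e)" "h q \<in> carrier_mat (d + e) (d + e)"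
      using x y g H Cq(10)[OF q] by auto
    have xy: "x * y = 1\<^sub>m (d + e)" by (rule left_inverse_imp_right_inverse[OF c(1,2) y(2)])
    have "x * h q * y = g * (x * y)" using assoc_mult_mat[OF c(3,1,2)] x(2) by simp
    then have "g = x * h q * y" using xy c by simp
    then have "similar_mat g (h q)"
      unfolding similar_mat_def using similar_mat_witI[OF xy y(2) _ c(3,4,1,2)] by blast
    then show ?thesis by (rule char_poly_similar)
  qed
  have "card ?Q * card H \<le> 2 * CARD('a) ^ d * card {g \<in> H. \<exists>q\<in>?Q. \<exists>x\<in>H. x * h q = g * x}"
  proof (rule H.card_conjugacy_classes[of ?Q h "CARD('a) ^ d" 2, unfolded car mul])
    show "finite H" "finite ?Q" by fact+
    fix q assume q: "q \<in> ?Q"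
    show "h q \<in> H" using Cq q by simp
    let ?Z = "{x \<in> H. x * h q = h q * x}"
    \<comment> \<open>the upper left block determines an element of the centraliser\<close>
    define ul where "ul x = mat d d (\<lambda>(i, j). x $$ (i, j))" for x :: "'a mod_ring mat"
    have ul: "ul (block_diag d e X W) = X" if "X \<in> carrier_mat d d" for X W
      using that by (intro eq_matI) (auto simp: ul_def)
    have Z: "\<exists>X W. x = block_diag d e X W \<and> X \<in> carrier_mat d d \<and> W \<in> carrier_mat e e \<and> X * C q = C q * X"
      if "x \<in> ?Z" for x
    proof -
      have ne: "char_poly (C q) \<noteq> char_poly (\<theta> (C q))" and irr: "irreducible (char_poly (C q))"
        using Cq(2,3,9)[OF q] by auto
      have x: "x \<in> carrier_mat (d + e) (d + e)" "x * block_diag d e (C q) (\<theta> (C q)) = block_diag d e (C q) (\<theta> (C q)) * x"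
        using that H by (auto simp: h_def)
      show ?thesis
        using commutes_with_block_diag[OF Cq(1)[OF q] Cq(6)[OF q] irr Cq(8)[OF q] ne x] by metis
    qed
    have "inj_on ul ?Z"
    proof (rule inj_onI)
      fix x y assume xy: "x \<in> ?Z" "y \<in> ?Z" "ul x = ul y"
      obtain X W where X: "x = block_diag d e X W" "X \<in> carrier_mat d d" "W \<in> carrier_mat e e"
        using Z[OF xy(1)] by blast
      obtain Y V where Y: "y = block_diag d e Y V" "Y \<in> carrier_mat d d" "V \<in> carrier_mat e e"
        using Z[OF xy(2)] by blast
      have "X = Y" using xy(3) X Y ul by simp
      then show "x = y" using unique[OF X(2,3) Y(3)] xy X Y by auto
    qed
    moreover have "ul ` ?Z \<subseteq> {X \<in> carrier_mat d d. X * C q = C q * X}"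
      using Z ul by (smt (verit, best) image_subsetI mem_Collect_eq)
    ultimately have "card ?Z \<le> card {X \<in> carrier_mat d d. X * C q = C q * X}"
      using card_commutant_le(1)[OF Cq(1)[OF q]] Cq(2,3)[OF q] by (intro card_inj_on_le) auto
    also have "\<dots> \<le> CARD('a) ^ d" using card_commutant_le(2)[OF Cq(1)[OF q]] Cq(2,3)[OF q] by simp
    finally show "card ?Z \<le> CARD('a) ^ d" .
  next
    fix g assume g: "g \<in> H"
    let ?Qg = "{q \<in> ?Q. \<exists>x\<in>H. x * h q = g * x}"
    show "card ?Qg \<le> 2"
    proof (cases "?Qg = {}")
      case True
      then show ?thesis by (simp only: card.empty)
    next
      case False
      then obtain q x where q: "q \<in> ?Q" and x: "x \<in> H" "x * h q = g * x" by auto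
      let ?r = "char_poly (\<theta> (C q))"
      have g_eq: "char_poly g = q * ?r" using conj[OF q g x] Cq(11)[OF q] by simp
      have "?Qg \<subseteq> {q, ?r}"
      proof
        fix q' assume "q' \<in> ?Qg"
        then obtain x' where q': "q' \<in> ?Q" "x' \<in> H" "x' * h q' = g * x'" by auto
        have "q' dvd q * ?r" using conj[OF q'(1) g q'(2,3)] Cq(11)[OF q'(1)] g_eq by (metis dvd_triv_left)
        then have "q' dvd q \<or> q' dvd ?r"
          using irreducible_imp_prime_elem_gcd[OF Cq(3)[OF q'(1)]] by (rule prime_elem_dvd_multD[rotated])
        moreover have "monic ?r" using degree_monic_char_poly[OF Cq(6)[OF q]] by simp
        ultimately show "q' \<in> {q, ?r}"
          using monic_irreducible_dvd_imp_eq Cq(3,4)[OF q'(1)] Cq(3,4,8)[OF q] by blast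
      qed
      then have "card ?Qg \<le> card {q, ?r}" by (intro card_mono) auto
      also have "\<dots> \<le> 2" by (simp add: card_insert_if)
      finally show ?thesis .
    qed
  qed
  also have "\<dots> \<le> 2 * CARD('a) ^ d * card {x \<in> H. certified x}"
  proof (intro mult_le_mono2 card_mono)
    show "{g \<in> H. \<exists>q\<in>?Q. \<exists>x\<in>H. x * h q = g * x} \<subseteq> {x \<in> H. certified x}"
    proof
      fix g assume "g \<in> {g \<in> H. \<exists>q\<in>?Q. \<exists>x\<in>H. x * h q = g * x}"
      then obtain q x where q: "g \<in> H" "q \<in> ?Q" and x: "x \<in> H" "x * h q = g * x" by auto
      have "char_poly g = q * char_poly (\<theta> (C q))" using conj[OF q(2,1) x] Cq(11)[OF q(2)] by simp
      then show "g \<in> {x \<in> H. certified x}" using q Cq(3,4,5,8)[OF q(2)] unfolding certified_def by blast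
    qed
  qed (use finH in auto)
  also have "\<dots> \<le> 2 * (2 * d * card ?Q) * card {x \<in> H. certified x}"
    using card_admissible_irreducibles[OF d p] by (intro mult_le_mono1 mult_le_mono2)
  finally have "card ?Q * card H \<le> card ?Q * (4 * d * card {x \<in> H. certified x})" by (simp add: mult_ac)
  moreover have "card ?Q > 0"
  proof (rule ccontr)
    assume "\<not> card ?Q > 0"
    then have "CARD('a) ^ d \<le> 0" using card_admissible_irreducibles[OF d p] by simp
    then show False using card_gt_1[where 'a = 'a] by simp
  qed
  ultimately show ?thesis by simp
qed

lemma irreducible_degree_one:
  fixes p :: "'a::field poly"
  assumes "degree p = 1"
  shows "irreducible p"
proof (rule irreducibleI)
  show p: "p \<noteq> 0" using assms by auto
  show "\<not> is_unit p" using assms p by (auto simp: is_unit_iff_degree)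
  fix a b assume ab: "p = a * b"
  then have ne: "a \<noteq> 0" "b \<noteq> 0" using p by auto
  then have "degree a + degree b = 1" using assms ab by (simp add: degree_mult_eq)
  then show "is_unit a \<or> is_unit b" using ne by (auto simp: is_unit_iff_degree add_is_1)
qed

text \<open>
  Here \<open>\<theta> C\<close> is the scalar \<open>1 / det C\<close>. Its characteristic polynomial can agree with that of \<open>C\<close> only
  for \<open>d = 1\<close> and \<open>(det C)\<^sup>2 = 1\<close>.
\<close>

lemma card_certified_sl:
  assumes d: "d > 0" and p: "8 * d \<le> CARD('a::prime_card)"
  shows "card (sl_mats (d + 1) :: 'a mod_ring mat set) \<le> 4 * d * card {x \<in> (sl_mats (d + 1) :: 'a mod_ring mat set). certified x}"
proof (rule card_certified[where \<theta> = "\<lambda>C. mat 1 1 (\<lambda>_. 1 / det C)", OF group_sl _ d p])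
  show "(sl_mats (d + 1) :: 'a mod_ring mat set) \<subseteq> carrier_mat (d + 1) (d + 1)" by (auto simp: sl_mats_def)
next
  fix C :: "'a mod_ring mat"
  assume C: "C \<in> carrier_mat d d" "det C \<notin> {0, 1, - 1}" "irreducible (char_poly C)"
  let ?D = "mat 1 1 (\<lambda>_. 1 / det C)"
  have D: "?D \<in> carrier_mat 1 1" "det ?D = 1 / det C" by (auto simp: det_single)
  have "det (block_diag d 1 C ?D) = 1"
    using C det_four_block_mat_lower_left_zero[OF C(1) zero_carrier_mat refl D(1)] D(2) by simp
  then have "block_diag d 1 C ?D \<in> sl_mats (d + 1)"
    using four_block_carrier_mat[OF C(1) D(1)] by (simp add: sl_mats_def)
  moreover have "irreducible (char_poly ?D)"
    by (rule irreducible_degree_one) (use degree_monic_char_poly[OF D(1)] in simp)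
  moreover have "char_poly ?D \<noteq> char_poly C"
  proof
    assume eq: "char_poly ?D = char_poly C"
    then have "d = 1" using degree_monic_char_poly[OF C(1)] degree_monic_char_poly[OF D(1)] by simp
    moreover have "(- 1) ^ 1 * (1 / det C) = (- 1) ^ d * det C"
      using poly_char_poly_0[OF C(1)] poly_char_poly_0[OF D(1)] eq D(2) by simp
    ultimately have "det C * det C = 1" using C(2) by (simp add: field_simps)
    then show False using C(2) by (simp add: square_eq_1_iff)
  qed
  ultimately show "?D \<in> carrier_mat 1 1 \<and> block_diag d 1 C ?D \<in> sl_mats (d + 1) \<and>
    irreducible (char_poly ?D) \<and> char_poly ?D \<noteq> char_poly C" using D by blast
next
  fix X W W' :: "'a mod_ring mat"
  assume X: "X \<in> carrier_mat d d" and W: "W \<in> carrier_mat 1 1" "W' \<in> carrier_mat 1 1"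
    and sl: "block_diag d 1 X W \<in> sl_mats (d + 1)" "block_diag d 1 X W' \<in> sl_mats (d + 1)"
  have "det X * det W = 1" "det X * det W' = 1"
    using sl det_four_block_mat_lower_left_zero[OF X zero_carrier_mat refl W(1)]
      det_four_block_mat_lower_left_zero[OF X zero_carrier_mat refl W(2)] by (auto simp: sl_mats_def)
  then have "det W = det W'" by (metis mult.left_commute mult.right_neutral)
  then show "W = W'" using W by (intro eq_matI) (auto simp: det_single)
qed

lemma block_diag_sp_iff:
  fixes X W :: "'a::comm_ring_1 mat"
  assumes X: "X \<in> carrier_mat d d" and W: "W \<in> carrier_mat d d"
  shows "block_diag d d X W \<in> sp_mats d \<longleftrightarrow> X\<^sup>T * W = 1\<^sub>m d"
proof -
  let ?M = "block_diag d d X W"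
  have t: "?M\<^sup>T = block_diag d d (X\<^sup>T) (W\<^sup>T)"
    using X W by (subst transpose_four_block_mat[of _ d d _ d _ d]) auto
  have tj: "?M\<^sup>T * symp_form d = four_block_mat (0\<^sub>m d d) (X\<^sup>T) (- W\<^sup>T) (0\<^sub>m d d)"
    unfolding t symp_form_def using X W
    by (subst mult_four_block_mat[of _ d d _ d _ d _ _ d _ d]) (auto intro!: arg_cong4[where f = four_block_mat] eq_matI)
  have tjm: "?M\<^sup>T * symp_form d * ?M = four_block_mat (0\<^sub>m d d) (X\<^sup>T * W) (- W\<^sup>T * X) (0\<^sub>m d d)"
    unfolding tj using X W by (subst mult_four_block_mat[of _ d d _ d _ d _ _ d _ d]) auto
  have c: "X\<^sup>T * W \<in> carrier_mat d d" "- W\<^sup>T * X \<in> carrier_mat d d" using X W by (auto intro!: mult_carrier_mat[of _ _ d])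
  have M: "?M \<in> carrier_mat (2 * d) (2 * d)" using X W by (simp add: mult_2)
  show ?thesis
  proof
    assume "?M \<in> sp_mats d"
    then have "four_block_mat (0\<^sub>m d d) (X\<^sup>T * W) (- W\<^sup>T * X) (0\<^sub>m d d) = four_block_mat (0\<^sub>m d d) (1\<^sub>m d) (- 1\<^sub>m d) (0\<^sub>m d d)"
      using tjm by (simp add: sp_mats_def symp_form_def)
    then show "X\<^sup>T * W = 1\<^sub>m d"
      by (rule four_block_mat_eqD(2)[OF _ zero_carrier_mat c(1) c(2) zero_carrier_mat]) auto
  next
    assume 1: "X\<^sup>T * W = 1\<^sub>m d"
    have "W\<^sup>T * X = (X\<^sup>T * W)\<^sup>T" using transpose_mult[of "X\<^sup>T" d d W d] X W by simp
    then have "- W\<^sup>T * X = - 1\<^sub>m d" using 1 X W by simp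
    then show "?M \<in> sp_mats d" using 1 tjm M by (simp add: sp_mats_def symp_form_def)
  qed
qed

text \<open>
  Here \<open>\<theta> C\<close> is the inverse transpose of \<open>C\<close>. If \<open>C\<close> and its inverse had the same characteristic
  polynomial, the constant terms would give \<open>(det C)\<^sup>2 = 1\<close>.
\<close>

lemma card_certified_sp:
  assumes d: "d > 0" and p: "8 * d \<le> CARD('a::prime_card)"
  shows "card (sp_mats d :: 'a mod_ring mat set) \<le> 4 * d * card {x \<in> (sp_mats d :: 'a mod_ring mat set). certified x}"
proof -
  define inverse where "inverse C = (SOME D. D \<in> carrier_mat d d \<and> C * D = 1\<^sub>m d)" for C :: "'a mod_ring mat"
  show ?thesis
  proof (rule card_certified[where \<theta> = "\<lambda>C. (inverse C)\<^sup>T" and d = d and e = d, OF _ _ d p])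
    show "group (matrix_group (d + d) (sp_mats d :: 'a mod_ring mat set))" using group_sp[of d] by (simp add: mult_2)
    show "(sp_mats d :: 'a mod_ring mat set) \<subseteq> carrier_mat (d + d) (d + d)" by (auto simp: sp_mats_def mult_2)
  next
    fix C :: "'a mod_ring mat"
    assume C: "C \<in> carrier_mat d d" "det C \<notin> {0, 1, - 1}" "irreducible (char_poly C)"
    let ?D = "inverse C"
    have "\<exists>D. D \<in> carrier_mat d d \<and> C * D = 1\<^sub>m d"
    proof -
      have "C * ((1 / det C) \<cdot>\<^sub>m adj_mat C) = 1\<^sub>m d"
        using C adj_mat(1,2)[OF C(1)] by (intro eq_matI) (auto simp: mult_smult_distrib[OF C(1) adj_mat(1)[OF C(1)]])
      then show ?thesis using adj_mat(1)[OF C(1)] by (metis smult_carrier_mat)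
    qed
    then have D: "?D \<in> carrier_mat d d" "C * ?D = 1\<^sub>m d" unfolding inverse_def by (metis (mono_tags, lifting) someI_ex)+
    have "block_diag d d C (?D\<^sup>T) \<in> sp_mats d"
    proof -
      have "?D * C = 1\<^sub>m d" by (rule left_inverse_imp_right_inverse[OF D(1) C(1) D(2)])
      then have "C\<^sup>T * ?D\<^sup>T = 1\<^sub>m d" using transpose_mult[OF D(1) C(1)] by simp
      then show ?thesis using block_diag_sp_iff[OF C(1), of "?D\<^sup>T"] D(1) by simp
    qed
    moreover have chD: "char_poly (?D\<^sup>T) = char_poly ?D" by (rule char_poly_transpose_mat[OF D(1)])
    moreover have "irreducible (char_poly ?D)" by (rule irreducible_char_poly_inverse[OF C(1) D C(3)])
    moreover have "char_poly ?D \<noteq> char_poly C"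
    proof
      assume "char_poly ?D = char_poly C"
      then have "(- 1) ^ d * det ?D = (- 1) ^ d * det C"
        using poly_char_poly_0[OF C(1)] poly_char_poly_0[OF D(1)] by simp
      then have "det ?D = det C" by simp
      moreover have "det C * det ?D = 1" using det_mult[OF C(1) D(1)] D(2) by simp
      ultimately show False using C(2) by (simp add: square_eq_1_iff)
    qed
    ultimately show "?D\<^sup>T \<in> carrier_mat d d \<and> block_diag d d C (?D\<^sup>T) \<in> sp_mats d \<and>
      irreducible (char_poly (?D\<^sup>T)) \<and> char_poly (?D\<^sup>T) \<noteq> char_poly C" using D by simp
  next
    fix X W W' :: "'a mod_ring mat"
    assume X: "X \<in> carrier_mat d d" and W: "W \<in> carrier_mat d d" "W' \<in> carrier_mat d d"
      and sp: "block_diag d d X W \<in> sp_mats d" "block_diag d d X W' \<in> sp_mats d"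
    have Xt: "X\<^sup>T \<in> carrier_mat d d" using X by simp
    have 1: "X\<^sup>T * W = 1\<^sub>m d" "X\<^sup>T * W' = 1\<^sub>m d" using sp block_diag_sp_iff X W by auto
    have 2: "W * X\<^sup>T = 1\<^sub>m d" by (rule left_inverse_imp_right_inverse[OF W(1) Xt 1(1)])
    have "W = W * (X\<^sup>T * W')" using 1 W by simp
    also have "\<dots> = W'" using assoc_mult_mat[OF W(1) Xt W(2)] 2 W by simp
    finally show "W = W'" .
  qed
qed

section \<open>Lifting to the integers\<close>

text \<open>
  If \<open>q\<close> divides the reduction of \<open>u\<close> in a factorisation \<open>u * v\<close>, and \<open>v\<close> is not constant, then the
  irreducible \<open>r\<close> is the reduction of \<open>v\<close> up to a unit, and \<open>q\<close> is that of \<open>u\<close> up to a unit \<open>c\<close>.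
  Comparing leading coefficients gives \<open>c = \<plusminus>1\<close>, and then the constant terms contradict each other.
\<close>

lemma irreducible_if_certified:
  fixes g :: "int mat" and M :: "'a::prime_card mod_ring mat"
  assumes g: "g \<in> carrier_mat n n" and det: "det g * det g = 1"
    and good: "certified (map_mat of_int g :: 'a mod_ring mat)"
  shows "irreducible (char_poly g)"
proof (rule irreducibleI)
  let ?f = "char_poly g" and ?h = "map_poly (of_int :: int \<Rightarrow> 'a mod_ring)"
  interpret h: map_poly_comm_ring_hom "of_int :: int \<Rightarrow> 'a mod_ring" ..
  have deg: "degree ?f = n" "monic ?f" using degree_monic_char_poly[OF g] by auto
  obtain q r where qr: "?h ?f = q * r" "monic q" "irreducible q" "irreducible r" "poly q 0 \<notin> {1, - 1}"
    using good of_int_hom.char_poly_hom[OF g, where ?'a = "'a mod_ring"] unfolding certified_def by auto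
  show "?f \<noteq> 0" using deg(2) by auto
  have unit: "is_unit a \<longleftrightarrow> degree a = 0" if "\<bar>lead_coeff a\<bar> = 1" for a :: "int poly"
  proof
    assume "is_unit a"
    then show "degree a = 0" by (auto simp: is_unit_poly_iff)
  next
    assume "degree a = 0"
    then obtain c where "a = [:c:]" using degree_eq_zeroE by blast
    then show "is_unit a" using that by (auto simp: is_unit_const_poly_iff)
  qed
  have hdeg: "degree (?h a) = degree a \<and> lead_coeff (?h a) \<in> {1, - 1}" if "\<bar>lead_coeff a\<bar> = 1" for a
  proof -
    have "(of_int (lead_coeff a) :: 'a mod_ring) \<in> {1, - 1}" using that by (auto simp: abs_if split: if_splits)
    moreover from this have "degree (?h a) = degree a" by (intro degree_map_poly) auto
    ultimately show ?thesis by simp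
  qed
  show "\<not> is_unit ?f"
  proof
    assume "is_unit ?f"
    then have "?f = 1" using unit[of ?f] deg by (metis abs_1 monic_degree_0)
    then have "q * r = 1" using qr(1) by simp
    then show False using qr(3) by (metis dvd_triv_left irreducible_not_unit)
  qed
  have const: "poly ?f 0 * poly ?f 0 = 1" using det poly_char_poly_0[OF g] by (cases "even n") auto
  fix a b assume ab: "?f = a * b"
  have "lead_coeff a * lead_coeff b = 1" using deg(2) by (simp add: ab lead_coeff_mult)
  then have la: "\<bar>lead_coeff a\<bar> = 1" and lb: "\<bar>lead_coeff b\<bar> = 1"
    by (metis abs_1 abs_mult abs_ge_zero zmult_eq_1_iff abs_minus_cancel)+
  have "(poly a 0 * poly b 0) * (poly a 0 * poly b 0) = 1" using const by (simp add: ab)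
  then have "poly a 0 * poly b 0 \<in> {1, - 1}" by (auto simp: square_eq_1_iff)
  then have ca: "poly a 0 \<in> {1, - 1}" and cb: "poly b 0 \<in> {1, - 1}" by (auto simp: zmult_eq_1_iff zmult_eq_neg1_iff)
  have key: "degree v = 0" if uv: "?f = u * v" "\<bar>lead_coeff u\<bar> = 1" "\<bar>lead_coeff v\<bar> = 1" "poly u 0 \<in> {1, - 1}" and qu: "q dvd ?h u" for u v
  proof (rule ccontr)
    assume "degree v \<noteq> 0"
    then have nu: "\<not> is_unit (?h v)" using hdeg[OF uv(3)] by (auto simp: is_unit_iff_degree)
    obtain s where s: "?h u = q * s" using qu by (rule dvdE)
    have "q * (s * ?h v) = q * r" using qr(1) uv(1) s by (simp add: hom_distribs mult.assoc)
    then have "s * ?h v = r" using qr(2) by auto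
    then have "is_unit s" using qr(4) nu by (metis irreducibleD)
    then have "degree s = 0" by auto
    then obtain c where c: "s = [:c:]" by (rule degree_eq_zeroE)
    have "lead_coeff (?h u) = c" using qr(2) by (simp add: s c)
    then have c1: "c = 1 \<or> c = - 1" using conjunct2[OF hdeg[OF uv(2)]] by (simp only: insert_iff empty_iff simp_thms)
    have "poly (?h u) 0 = of_int (poly u 0)" by (simp add: poly_0_coeff_0 coeff_map_poly)
    then have "poly q 0 * c = of_int (poly u 0)" by (simp add: s c mult.commute)
    then have pq: "poly q 0 * c = 1 \<or> poly q 0 * c = - 1" using uv(4) by auto
    obtain x where x: "poly q 0 * c = x" "x = 1 \<or> x = - 1" using pq by blast
    have "poly q 0 = x * c" using c1 by (auto simp flip: x(1))
    then have "poly q 0 \<in> {1, - 1}" using x(2) c1 by auto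
    then show False using qr(5) by simp
  qed
  have "?h ?f = ?h a * ?h b" by (simp add: ab hom_distribs)
  then have "q * r = ?h a * ?h b" using qr(1) by simp
  then have "q dvd ?h a * ?h b" by (rule dvdI[OF sym])
  then have "q dvd ?h a \<or> q dvd ?h b"
    using irreducible_imp_prime_elem_gcd[OF qr(3)] by (rule prime_elem_dvd_multD[rotated])
  then show "is_unit a \<or> is_unit b"
    using key[OF ab la lb ca] key[of b a] ab la lb cb unit by (auto simp: mult.commute)
qed

definition reduce :: "nat \<Rightarrow> int mat \<Rightarrow> int mat" where
  "reduce m M = map_mat (\<lambda>x. x mod int m) M"

lemma reduce_carrier [simp]: "reduce m M \<in> carrier_mat k l \<longleftrightarrow> M \<in> carrier_mat k l"
  by (auto simp: reduce_def)

lemma reduce_eq_iff: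
  assumes "M \<in> carrier_mat k l" "N \<in> carrier_mat k l"
  shows "reduce m M = reduce m N \<longleftrightarrow> (\<forall>i<k. \<forall>j<l. M $$ (i, j) mod int m = N $$ (i, j) mod int m)"
  using assms by (auto simp: reduce_def mat_eq_iff)

lemma reduce_mult:
  assumes M: "M \<in> carrier_mat k l" "M' \<in> carrier_mat k l" and N: "N \<in> carrier_mat l n" "N' \<in> carrier_mat l n"
    and eq: "reduce m M = reduce m M'" "reduce m N = reduce m N'"
  shows "reduce m (M * N) = reduce m (M' * N')"
proof (subst reduce_eq_iff[of _ k n])
  have eqs: "M $$ (i, h) * N $$ (h, j) mod int m = M' $$ (i, h) * N' $$ (h, j) mod int m" if "i < k" "h < l" "j < n" for i h j
    using eq that unfolding reduce_eq_iff[OF M] reduce_eq_iff[OF N] by (intro mod_mult_cong) auto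
  show "\<forall>i<k. \<forall>j<n. (M * N) $$ (i, j) mod int m = (M' * N') $$ (i, j) mod int m"
  proof (intro allI impI)
    fix i j assume ij: "i < k" "j < n"
    have "(\<Sum>h = 0..<l. M $$ (i, h) * N $$ (h, j)) mod int m = (\<Sum>h = 0..<l. M' $$ (i, h) * N' $$ (h, j)) mod int m"
      unfolding mod_sum_eq[symmetric, of "\<lambda>h. M $$ (i, h) * N $$ (h, j)"] mod_sum_eq[symmetric, of "\<lambda>h. M' $$ (i, h) * N' $$ (h, j)"]
      using eqs[OF ij(1) _ ij(2)] by simp
    then show "(M * N) $$ (i, j) mod int m = (M' * N') $$ (i, j) mod int m" using M N ij by (simp add: scalar_prod_def)
  qed
qed (use M N in \<open>auto intro!: mult_carrier_mat\<close>)

lemma reduce_dvd: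
  assumes "m dvd m'" "reduce m' M = reduce m' N" "M \<in> carrier_mat k l" "N \<in> carrier_mat k l"
  shows "reduce m M = reduce m N"
proof -
  have "x mod int m = y mod int m" if "x mod int m' = y mod int m'" for x y
  proof -
    have "x mod int m' mod int m = y mod int m' mod int m" using that by simp
    then show ?thesis using assms(1) by (simp add: mod_mod_cancel)
  qed
  then show ?thesis using assms(2) unfolding reduce_eq_iff[OF assms(3,4)] by blast
qed

text \<open>
  The two facts about a prime \<open>p\<close> that the sieve uses: residues modulo \<open>p\<close> can be prescribed
  independently of those modulo a number prime to \<open>p\<close>, and the residue classes that consist of
  elements with irreducible characteristic polynomial form at least the fraction \<open>1 / c\<close>. It only mentions
  integers, so that it makes sense for every prime \<open>p\<close>.
\<close>

definition reduces_well :: "int mat set \<Rightarrow> nat \<Rightarrow> nat \<Rightarrow> nat \<Rightarrow> bool" where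
  "reduces_well \<Gamma> n c p \<longleftrightarrow>
     (\<forall>r. gcd r p = 1 \<longrightarrow> (\<forall>g\<in>\<Gamma>. \<exists>g'\<in>\<Gamma>. reduce p g' = reduce p g \<and> reduce r g' = reduce r (1\<^sub>m n))) \<and>
     card (reduce p ` \<Gamma>) \<le> c * card {x \<in> reduce p ` \<Gamma>. \<forall>g\<in>\<Gamma>. reduce p g = x \<longrightarrow> irreducible (char_poly g)}"

text \<open>
  Residue classes of integer matrices modulo \<open>p\<close> correspond to matrices over the field with \<open>p\<close>
  elements; by the case \<open>r = 1\<close> of \<open>lift\<close> the reduction of \<open>\<Gamma>\<close> is all of \<open>H\<close>.
\<close>

lemma reduces_wellI:
  fixes H :: "'a::prime_card mod_ring mat set"
  assumes \<Gamma>: "\<Gamma> \<subseteq> carrier_mat n n" and H: "H \<subseteq> carrier_mat n n"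
    and det: "\<And>g. g \<in> \<Gamma> \<Longrightarrow> det g * det g = 1"
    and hom: "\<And>g. g \<in> \<Gamma> \<Longrightarrow> map_mat of_int g \<in> H"
    and lift: "\<And>r M. gcd r CARD('a) = 1 \<Longrightarrow> M \<in> H \<Longrightarrow> \<exists>g\<in>\<Gamma>. map_mat of_int g = M \<and> reduce r g = reduce r (1\<^sub>m n)"
    and good: "card H \<le> c * card {x \<in> H. certified x}"
  shows "reduces_well \<Gamma> n c CARD('a)"
proof -
  define \<phi> where "\<phi> M = map_mat (to_int_mod_ring :: 'a mod_ring \<Rightarrow> int) M" for M
  have \<phi>: "\<phi> (map_mat of_int g) = reduce CARD('a) g" for g
  proof -
    have "to_int_mod_ring (of_int x :: 'a mod_ring) = x mod int CARD('a)" for x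
    proof -
      have "(of_int x :: 'a mod_ring) = of_int_mod_ring (x mod int CARD('a))"
        unfolding of_int_of_int_mod_ring[symmetric] by (metis of_int_mod_CHAR semiring_char_mod_ring)
      then show ?thesis using card_gt_1[where 'a = 'a] by simp
    qed
    then show ?thesis by (auto simp: \<phi>_def reduce_def intro!: eq_matI)
  qed
  have inj: "inj \<phi>"
  proof (rule injI)
    fix M N assume "\<phi> M = \<phi> N"
    then have "map_mat of_int_mod_ring (\<phi> M) = (map_mat of_int_mod_ring (\<phi> N) :: 'a mod_ring mat)" by simp
    moreover have "map_mat of_int_mod_ring (\<phi> M) = M" for M :: "'a mod_ring mat" by (intro eq_matI) (auto simp: \<phi>_def)
    ultimately show "M = N" by simp
  qed
  have surj: "reduce CARD('a) ` \<Gamma> = \<phi> ` H"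
  proof
    show "reduce CARD('a) ` \<Gamma> \<subseteq> \<phi> ` H" using hom by (auto simp flip: \<phi>)
    show "\<phi> ` H \<subseteq> reduce CARD('a) ` \<Gamma>"
    proof
      fix x assume "x \<in> \<phi> ` H"
      then obtain M where M: "M \<in> H" "x = \<phi> M" by auto
      obtain g where "g \<in> \<Gamma>" "map_mat of_int g = M" using lift[of 1 M] M by auto
      then show "x \<in> reduce CARD('a) ` \<Gamma>" using M \<phi> by blast
    qed
  qed
  have "card {x \<in> H. certified x} = card (\<phi> ` {x \<in> H. certified x})"
    using inj by (intro card_image[symmetric]) (auto simp: inj_on_def)
  also have "\<dots> \<le> card {x \<in> reduce CARD('a) ` \<Gamma>. \<forall>g\<in>\<Gamma>. reduce CARD('a) g = x \<longrightarrow> irreducible (char_poly g)}"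
  proof (rule card_mono)
    show "finite {x \<in> reduce CARD('a) ` \<Gamma>. \<forall>g\<in>\<Gamma>. reduce CARD('a) g = x \<longrightarrow> irreducible (char_poly g)}"
      using finite_subset[OF H finite_carrier_mat] by (auto simp: surj)
    show "\<phi> ` {x \<in> H. certified x} \<subseteq> {x \<in> reduce CARD('a) ` \<Gamma>. \<forall>g\<in>\<Gamma>. reduce CARD('a) g = x \<longrightarrow> irreducible (char_poly g)}"
    proof
      fix x assume "x \<in> \<phi> ` {x \<in> H. certified x}"
      then obtain M where M: "M \<in> H" "certified M" "x = \<phi> M" by auto
      have "irreducible (char_poly g)" if g: "g \<in> \<Gamma>" "reduce CARD('a) g = x" for g
      proof -
        have "map_mat of_int g = M" using g(2) inj unfolding M(3) \<phi>[symmetric] by (rule injD[rotated])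
        then show ?thesis using irreducible_if_certified[of g n, where 'a = 'a] \<Gamma> det g(1) M(2) by auto
      qed
      then show "x \<in> {x \<in> reduce CARD('a) ` \<Gamma>. \<forall>g\<in>\<Gamma>. reduce CARD('a) g = x \<longrightarrow> irreducible (char_poly g)}"
        using M surj by auto
    qed
  qed
  finally have "card {x \<in> H. certified x} \<le> card {x \<in> reduce CARD('a) ` \<Gamma>. \<forall>g\<in>\<Gamma>. reduce CARD('a) g = x \<longrightarrow> irreducible (char_poly g)}" .
  then have "c * card {x \<in> H. certified x} \<le> c * card {x \<in> reduce CARD('a) ` \<Gamma>. \<forall>g\<in>\<Gamma>. reduce CARD('a) g = x \<longrightarrow> irreducible (char_poly g)}"
    by (rule mult_le_mono2)
  moreover have "card (reduce CARD('a) ` \<Gamma>) = card H"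
    unfolding surj using inj by (intro card_image) (auto simp: inj_on_def)
  moreover have "\<exists>g'\<in>\<Gamma>. reduce CARD('a) g' = reduce CARD('a) g \<and> reduce r g' = reduce r (1\<^sub>m n)"
    if "gcd r CARD('a) = 1" "g \<in> \<Gamma>" for r g
    using lift[OF that(1) hom[OF that(2)]] \<phi> by metis
  ultimately show ?thesis
    unfolding reduces_well_def using order.trans[OF good] by (intro conjI allI impI ballI) simp_all
qed

text \<open>
  The Chinese remainder theorem for the parameter of an elementary matrix or a transvection.
\<close>

lemma ex_lift_param:
  fixes a :: "'a::prime_card mod_ring"
  assumes "gcd r CARD('a) = 1"
  shows "\<exists>b::int. of_int b = a \<and> b mod int r = 0"
proof -
  have "gcd (int r) (int CARD('a)) = 1" using assms by (simp only: gcd_int_int_eq)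
  then obtain s t where st: "s * int r + t * int CARD('a) = 1"
    using bezout_int[of "int r" "int CARD('a)"] by metis
  have "(of_int (int r) * of_int s :: 'a mod_ring) = of_int (1 - t * int CARD('a))"
    unfolding st[symmetric] by (simp add: mult.commute)
  then have 1: "(of_nat r * of_int s :: 'a mod_ring) = 1" by simp
  have "of_int (to_int_mod_ring a) = a" by (simp add: of_int_of_int_mod_ring)
  then have "of_int (to_int_mod_ring a * s * int r) = a * (of_nat r * of_int s)"
    by (simp only: of_int_mult of_int_of_nat_eq mult_ac)
  then show ?thesis using 1 by (intro exI[of _ "to_int_mod_ring a * s * int r"]) simp
qed

text \<open>
  An elementary matrix over the field lifts to an integral elementary matrix whose off-diagonal entry is
  divisible by \<open>r\<close>.
\<close>

lemma reduces_well_sl: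
  assumes d: "d > 0" and p: "8 * d \<le> CARD('a::prime_card)"
  shows "reduces_well (sl_mats (d + 1)) (d + 1) (4 * d) CARD('a)"
proof (rule reduces_wellI[where H = "sl_mats (d + 1) :: 'a mod_ring mat set"])
  let ?n = "d + 1"
  show "sl_mats ?n \<subseteq> carrier_mat ?n ?n" "(sl_mats ?n :: 'a mod_ring mat set) \<subseteq> carrier_mat ?n ?n"
    by (auto simp: sl_mats_def)
  show "det g * det g = 1" if "g \<in> sl_mats ?n" for g :: "int mat"
    using that by (simp add: sl_mats_def)
  show "map_mat of_int g \<in> (sl_mats ?n :: 'a mod_ring mat set)" if "g \<in> sl_mats ?n" for g :: "int mat"
    using that of_int_hom.hom_det[of g, where ?'a = "'a mod_ring"] by (auto simp: sl_mats_def)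
  show "card (sl_mats ?n :: 'a mod_ring mat set) \<le> 4 * d * card {x \<in> (sl_mats ?n :: 'a mod_ring mat set). certified x}"
    by (rule card_certified_sl[OF d p])
  fix r and M :: "'a mod_ring mat" assume r: "gcd r CARD('a) = 1" and M: "M \<in> sl_mats ?n"
  from M show "\<exists>g\<in>sl_mats ?n. map_mat of_int g = M \<and> reduce r g = reduce r (1\<^sub>m ?n)"
  proof (induction M rule: sl_elementary_induct)
    case one
    show ?case by (intro bexI[of _ "1\<^sub>m ?n"]) (auto simp: sl_mats_def)
  next
    case (mult N a i j)
    then obtain g where g: "g \<in> sl_mats ?n" "map_mat of_int g = N" "reduce r g = reduce r (1\<^sub>m ?n)" by blast
    obtain b :: int where b: "of_int b = a" "b mod int r = 0" using ex_lift_param[OF r, of a] by (elim exE conjE)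
    have gc: "g \<in> carrier_mat ?n ?n" using g by (simp add: sl_mats_def)
    have E: "map_mat of_int (addrow_mat ?n b i j) = addrow_mat ?n a i j"
      using b(1) by (intro eq_matI) (auto simp: addrow_mat_def)
    have "reduce r (addrow_mat ?n b i j) = reduce r (1\<^sub>m ?n)"
      using b(2) by (subst reduce_eq_iff[of _ ?n ?n]) (auto simp: addrow_mat_def mod_add_left_eq[symmetric])
    then have "reduce r (addrow_mat ?n b i j * g) = reduce r (1\<^sub>m ?n * 1\<^sub>m ?n)"
      using g(3) gc by (intro reduce_mult[of _ ?n ?n]) auto
    moreover have "addrow_mat ?n b i j * g \<in> sl_mats ?n"
      using g(1) mult(4) by (auto simp: sl_mats_def det_addrow_mat det_mult[of _ ?n])
    moreover have "map_mat of_int (addrow_mat ?n b i j * g) = addrow_mat ?n a i j * N"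
      unfolding E[symmetric] g(2)[symmetric] by (rule of_int_hom.mat_hom_mult[OF addrow_mat_carrier gc])
    ultimately show ?case by (intro bexI[of _ "addrow_mat ?n b i j * g"]) auto
  qed
qed

lemma (in comm_ring_hom) symp_form_hom: "map_mat hom (symp_form n) = symp_form n"
  by (intro eq_matI) (auto simp: symp_form_def hom_distribs)

lemma (in comm_ring_hom) sp_hom:
  assumes "g \<in> sp_mats n"
  shows "map_mat hom g \<in> sp_mats n"
proof -
  have g: "g \<in> carrier_mat (2 * n) (2 * n)" "g\<^sup>T * symp_form n * g = symp_form n" using assms by (auto simp: sp_mats_def)
  have gt: "g\<^sup>T \<in> carrier_mat (2 * n) (2 * n)" using g by simp
  have "map_mat hom (g\<^sup>T * symp_form n * g) = (map_mat hom g)\<^sup>T * symp_form n * map_mat hom g"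
    using mat_hom_mult[OF mult_carrier_mat[OF gt symp_form_carrier] g(1)] mat_hom_mult[OF gt symp_form_carrier]
    by (simp add: symp_form_hom map_mat_transpose)
  then show ?thesis using g by (simp add: sp_mats_def symp_form_hom)
qed

lemma (in comm_ring_hom) transvection_hom:
  assumes z: "z \<in> carrier_vec (2 * n)"
  shows "map_mat hom (transvection n a z) = transvection n (hom a) (map_vec hom z)"
proof -
  have "map_vec hom ((symp_form n)\<^sup>T *\<^sub>v z) = (symp_form n)\<^sup>T *\<^sub>v map_vec hom z"
    using mult_mat_vec_hom[of "(symp_form n)\<^sup>T" "2 * n" "2 * n" z] z
    by (simp add: map_mat_transpose[symmetric] symp_form_hom)
  then have "hom (((symp_form n)\<^sup>T *\<^sub>v z) $ j) = ((symp_form n)\<^sup>T *\<^sub>v map_vec hom z) $ j" if "j < 2 * n" for j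
    using that by (metis dim_mult_mat_vec index_map_vec(1) index_transpose_mat(2) symp_form_dim(2))
  then show ?thesis using z by (intro eq_matI) (auto simp: transvection_def hom_distribs simp del: index_mult_mat_vec)
qed

text \<open>
  A transvection over the field lifts to an integral transvection whose parameter is divisible by \<open>r\<close>;
  the vector \<open>z\<close> may be lifted arbitrarily.
\<close>

lemma reduces_well_sp:
  assumes d: "d > 0" and p: "8 * d \<le> CARD('a::prime_card)"
  shows "reduces_well (sp_mats d) (2 * d) (4 * d) CARD('a)"
proof (rule reduces_wellI[where H = "sp_mats d :: 'a mod_ring mat set"])
  let ?n = "2 * d"
  show "sp_mats d \<subseteq> carrier_mat ?n ?n" "(sp_mats d :: 'a mod_ring mat set) \<subseteq> carrier_mat ?n ?n"
    by (auto simp: sp_mats_def)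
  show "det g * det g = 1" if "g \<in> sp_mats d" for g :: "int mat" by (rule det_sp[OF that])
  show "map_mat of_int g \<in> (sp_mats d :: 'a mod_ring mat set)" if "g \<in> sp_mats d" for g :: "int mat"
    by (rule of_int_hom.sp_hom[OF that])
  show "card (sp_mats d :: 'a mod_ring mat set) \<le> 4 * d * card {x \<in> (sp_mats d :: 'a mod_ring mat set). certified x}"
    by (rule card_certified_sp[OF d p])
  fix r and M :: "'a mod_ring mat" assume r: "gcd r CARD('a) = 1" and M: "M \<in> sp_mats d"
  from M show "\<exists>g\<in>sp_mats d. map_mat of_int g = M \<and> reduce r g = reduce r (1\<^sub>m ?n)"
  proof (induction M rule: sp_transvection_induct)
    case one
    show ?case by (intro bexI[of _ "1\<^sub>m ?n"]) (auto simp: sp_one)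
  next
    case (mult N a z)
    then obtain g where g: "g \<in> sp_mats d" "map_mat of_int g = N" "reduce r g = reduce r (1\<^sub>m ?n)" by blast
    obtain b :: int where b: "of_int b = a" "b mod int r = 0" using ex_lift_param[OF r, of a] by (elim exE conjE)
    define y where "y = map_vec to_int_mod_ring z"
    have y: "y \<in> carrier_vec ?n" "map_vec of_int y = z"
      using mult(2) by (auto simp: y_def of_int_of_int_mod_ring intro!: eq_vecI)
    have gc: "g \<in> carrier_mat ?n ?n" by (rule spD(1)[OF g(1)])
    have E: "map_mat of_int (transvection d b y) = transvection d a z"
      using of_int_hom.transvection_hom[OF y(1), of b, where ?'a = "'a mod_ring"] b(1) y(2) by simp
    have "(x + b * u * v) mod int r = x mod int r" for x u v
    proof -
      have "(b * (u * v)) mod int r = 0" using b(2) by (metis mod_mult_left_eq mult_zero_left mod_0)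
      then show ?thesis by (metis add.right_neutral mod_add_right_eq mult.assoc)
    qed
    then have "reduce r (transvection d b y) = reduce r (1\<^sub>m ?n)"
      by (subst reduce_eq_iff[of _ ?n ?n]) (auto simp: transvection_def simp del: index_mult_mat_vec)
    then have "reduce r (transvection d b y * g) = reduce r (1\<^sub>m ?n * 1\<^sub>m ?n)"
      using g(3) gc by (intro reduce_mult[of _ ?n ?n]) auto
    moreover have "transvection d b y * g \<in> sp_mats d" by (rule sp_closed[OF transvection_sp[OF y(1)] g(1)])
    moreover have "map_mat of_int (transvection d b y * g) = transvection d a z * N"
      unfolding E[symmetric] g(2)[symmetric] by (rule of_int_hom.mat_hom_mult[OF transvection_carrier gc])
    ultimately show ?case by (intro bexI[of _ "transvection d b y * g"]) auto
  qed
qed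

section \<open>From types of prime cardinality to all primes\<close>

definition reduction_statement :: "nat \<Rightarrow> bool" where
  "reduction_statement p \<longleftrightarrow> (\<forall>d>0. 8 * d \<le> p \<longrightarrow>
     reduces_well (sl_mats (d + 1)) (d + 1) (4 * d) p \<and> reduces_well (sp_mats d) (2 * d) (4 * d) p)"

text \<open>
  A prime that violates the statement, if there is one. The type \<open>critical\<close> below has this size. What has been
  proved for types of prime size applies to it, so the statement holds for this prime, and there is
  no violation. The value 2 in the other case only serves to make the size a prime.
\<close>

definition critical_prime :: nat where
  "critical_prime = (if \<exists>p. prime p \<and> \<not> reduction_statement p then SOME p. prime p \<and> \<not> reduction_statement p else 2)"

lemma prime_critical_prime: "prime critical_prime"
proof (cases "\<exists>p. prime p \<and> \<not> reduction_statement p")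
  case True
  from someI_ex[OF this] show ?thesis unfolding critical_prime_def if_P[OF True] by blast
next
  case False
  show ?thesis unfolding critical_prime_def if_not_P[OF False] by (rule two_is_prime_nat)
qed

typedef critical = "{..<critical_prime}"
  using prime_gt_0_nat[OF prime_critical_prime] by blast

lemma card_critical: "CARD(critical) = critical_prime"
  using type_definition.card[OF type_definition_critical] by simp

instance critical :: prime_card
  by standard (simp add: card_critical prime_critical_prime)

lemma reduction_statement_all_primes:
  assumes "prime p"
  shows "reduction_statement p"
proof (rule ccontr)
  assume "\<not> reduction_statement p"
  then have ex: "\<exists>p. prime p \<and> \<not> reduction_statement p" using assms by blast
  have "\<not> reduction_statement critical_prime"
    using someI_ex[OF ex] unfolding critical_prime_def if_P[OF ex] by blast
  moreover have "reduction_statement critical_prime"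
    unfolding reduction_statement_def
    using reduces_well_sl[where 'a = critical] reduces_well_sp[where 'a = critical] by (simp add: card_critical)
  ultimately show False by blast
qed

section \<open>The sieve over many primes\<close>

lemma reduce_idem: "reduce m (reduce m M) = reduce m M"
  by (auto simp: reduce_def intro!: eq_matI)

lemma reduce_mult_reduce:
  assumes "g \<in> carrier_mat n n" "x \<in> carrier_mat n n"
  shows "reduce m (g * reduce m x) = reduce m (g * x)"
  using assms by (intro reduce_mult[of _ n n _ _ n]) (auto simp: reduce_idem)

lemma finite_reduce: "p > 0 \<Longrightarrow> S \<subseteq> carrier_mat n n \<Longrightarrow> finite (reduce p ` S)"
  by (rule finite_subset[OF _ finite_mats_with_entries[of "{0..<int p}" n n]]) (auto simp: reduce_def)

text \<open>
  For each prime \<open>p\<close> in \<open>P\<close> there is an element with the prescribed residue modulo \<open>p\<close> that is trivial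
  modulo the product of the other primes. The product of these elements has all prescribed residues.
\<close>

lemma simultaneous_reduction:
  assumes group: "group (matrix_group n S)" and S: "S \<subseteq> carrier_mat n n"
    and P: "finite P" "\<And>p. p \<in> P \<Longrightarrow> prime p" and well: "\<And>p. p \<in> P \<Longrightarrow> reduces_well S n c p"
    and x: "\<And>p. p \<in> P \<Longrightarrow> x p \<in> reduce p ` S"
  obtains g where "g \<in> S" "\<And>p. p \<in> P \<Longrightarrow> reduce p g = x p"
proof -
  interpret group "matrix_group n S" by fact
  have mult: "g * h \<in> S" if "g \<in> S" "h \<in> S" for g h using m_closed[of g h] that by (simp add: matrix_group_def)
  have one: "1\<^sub>m n \<in> S" using one_closed by (simp add: matrix_group_def)
  have local: "\<exists>g\<in>S. reduce p g = x p \<and> (\<forall>q\<in>P - {p}. reduce q g = reduce q (1\<^sub>m n))" if p: "p \<in> P" for p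
  proof -
    let ?r = "\<Prod>(P - {p})"
    obtain h where h: "h \<in> S" "reduce p h = x p" using x[OF p] by auto
    have "algebraic_semidom_class.coprime ?r p"
      using P p by (intro prod_coprime_left primes_coprime) auto
    then have "gcd ?r p = 1" by (rule coprime_imp_gcd_eq_1)
    moreover have "\<forall>r. gcd r p = 1 \<longrightarrow> (\<forall>g\<in>S. \<exists>g'\<in>S. reduce p g' = reduce p g \<and> reduce r g' = reduce r (1\<^sub>m n))"
      using well[OF p] unfolding reduces_well_def by (rule conjunct1)
    ultimately have "\<exists>g\<in>S. reduce p g = reduce p h \<and> reduce ?r g = reduce ?r (1\<^sub>m n)"
      using h(1) by simp
    then obtain g where g: "g \<in> S" "reduce p g = x p" "reduce ?r g = reduce ?r (1\<^sub>m n)"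
      using h(2) by auto
    have "reduce q g = reduce q (1\<^sub>m n)" if "q \<in> P - {p}" for q
      by (rule reduce_dvd[OF _ g(3), of _ n n]) (use that P g S in \<open>auto intro: dvd_prodI\<close>)
    then show ?thesis using g by blast
  qed
  have "\<exists>g\<in>S. \<forall>p\<in>P. reduce p g = (if p \<in> T then x p else reduce p (1\<^sub>m n))" if "T \<subseteq> P" for T
    using finite_subset[OF that P(1)] that
  proof (induction T)
    case empty
    show ?case using one by auto
  next
    case (insert q T)
    then obtain g where g: "g \<in> S" "\<And>p. p \<in> P \<Longrightarrow> reduce p g = (if p \<in> T then x p else reduce p (1\<^sub>m n))" by auto
    obtain h where h: "h \<in> S" "reduce q h = x q" "\<And>p. p \<in> P - {q} \<Longrightarrow> reduce p h = reduce p (1\<^sub>m n)"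
      using local[of q] insert.prems by auto
    have c: "g \<in> carrier_mat n n" "h \<in> carrier_mat n n" using g h S by auto
    have "reduce p (h * g) = (if p \<in> insert q T then x p else reduce p (1\<^sub>m n))" if p: "p \<in> P" for p
    proof (cases "p = q")
      case True
      have "reduce q (h * g) = reduce q (h * 1\<^sub>m n)"
        using c g(2)[of q] insert by (intro reduce_mult[of _ n n _ _ n]) auto
      then show ?thesis using True c h by simp
    next
      case False
      have "reduce p (h * g) = reduce p (1\<^sub>m n * g)"
        using c h(3)[of p] p False by (intro reduce_mult[of _ n n _ _ n]) auto
      then show ?thesis using False c g(2)[OF p] by simp
    qed
    then show ?case using mult[OF h(1) g(1)] by blast
  qed
  from this[of P] that show ?thesis by auto
qed

text \<open>
  For a finite set \<open>P\<close> of primes, the group acts transitively on the product of its reductions. A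
  product of a walk whose characteristic polynomial is reducible avoids, for every \<open>p\<close> in \<open>P\<close>, the residue classes
  \<open>good p\<close>, and by equidistribution this has probability close to at most \<open>(1 - 1 / c) ^ card P\<close>.
\<close>

theorem walk_char_poly_irreducible:
  assumes group: "group (matrix_group n S)" and S: "S \<subseteq> carrier_mat n n" and G: "finite_multigraph G"
    and t: "\<forall>i<nverts G. t i \<in> S"
    and gen: "generate (matrix_group n S) (t ` {..<nverts G}) = S"
    and PF: "perron_frobenius_matrix (adj_matrix G)"
    and char: "\<forall>\<rho>. nontrivial_unitary_character (matrix_group n S) \<rho> \<longrightarrow> (\<exists>i<nverts G. \<exists>j<nverts G. \<rho> (t i) \<noteq> \<rho> (t j))"
    and well: "\<And>p. prime p \<Longrightarrow> b \<le> p \<Longrightarrow> reduces_well S n c p"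
  shows "(\<lambda>N. measure_pmf.prob (pmf_of_set (walks G N))
            {w. \<not> irreducible (char_poly (walk_prod (matrix_group n S) t w))}) \<longlonglongrightarrow> 0"
proof -
  let ?G = "matrix_group n S" and ?prob = "\<lambda>N. measure_pmf.prob (pmf_of_set (walks G N))"
  interpret group ?G by fact
  have ops: "carrier ?G = S" "\<And>x y. x \<otimes>\<^bsub>?G\<^esub> y = x * y" "\<one>\<^bsub>?G\<^esub> = 1\<^sub>m n" by (auto simp: matrix_group_def)
  have mult: "g * h \<in> S" if "g \<in> S" "h \<in> S" for g h using m_closed[of g h] that by (simp add: ops)
  have one: "1\<^sub>m n \<in> S" using one_closed by (simp add: ops)
  let ?bad = "\<lambda>w. \<not> irreducible (char_poly (walk_prod ?G t w))"
  define good where "good p = {x \<in> reduce p ` S. \<forall>g\<in>S. reduce p g = x \<longrightarrow> irreducible (char_poly g)}" for p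
  have fin: "finite (reduce p ` S)" if "prime p" for p using finite_reduce[OF prime_gt_0_nat[OF that] S] .
  have ratio: "real (card (reduce p ` S - good p)) / card (reduce p ` S) \<le> 1 - 1 / c" and c_pos: "c > 0"
    if p: "prime p" "b \<le> p" for p
  proof -
    have le: "card (reduce p ` S) \<le> c * card (good p)" using well[OF p] unfolding reduces_well_def good_def by (rule conjunct2)
    have pos: "card (reduce p ` S) > 0" using fin[OF p(1)] one by (auto simp: card_gt_0_iff)
    then show c: "c > 0" using le by (cases c) auto
    have "good p \<subseteq> reduce p ` S" by (auto simp: good_def)
    then have "card (reduce p ` S - good p) = card (reduce p ` S) - card (good p)" "card (good p) \<le> card (reduce p ` S)"
      using fin[OF p(1)] by (auto simp: card_Diff_subset finite_subset card_mono)
    then have "real (card (reduce p ` S - good p)) / card (reduce p ` S) = 1 - card (good p) / card (reduce p ` S)"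
      using pos by (simp add: of_nat_diff field_simps)
    moreover have "real (card (reduce p ` S)) \<le> real c * real (card (good p))"
      using le unfolding of_nat_mult[symmetric] of_nat_le_iff .
    then have "1 / c \<le> card (good p) / card (reduce p ` S)"
      using c pos by (simp add: field_simps)
    ultimately show "real (card (reduce p ` S - good p)) / card (reduce p ` S) \<le> 1 - 1 / c" by linarith
  qed
  have key: "\<forall>\<^sub>F N in sequentially. ?prob N {w. ?bad w} < \<epsilon>" if \<epsilon>: "\<epsilon> > 0" for \<epsilon>
  proof -
    have inf: "infinite {p :: nat. prime p \<and> b \<le> p}"
    proof
      assume "finite {p :: nat. prime p \<and> b \<le> p}"
      then have "finite ({p. prime p \<and> b \<le> p} \<union> {..<b})" by simp
      then have "finite {p :: nat. prime p}" by (rule rev_finite_subset) auto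
      then show False using primes_infinite by simp
    qed
    then obtain p0 :: nat where p0: "prime p0" "b \<le> p0" using infinite_imp_nonempty by auto
    have c: "c > 0" using c_pos[OF p0] .
    have "\<exists>k. (1 - 1 / real c) ^ k < \<epsilon> / 2" using c \<epsilon> by (intro real_arch_pow_inv) auto
    then obtain k where k: "(1 - 1 / real c) ^ k < \<epsilon> / 2" ..
    obtain P where P: "P \<subseteq> {p. prime p \<and> b \<le> p}" "finite P" "card P = k"
      using infinite_arbitrarily_large[OF inf, of k] by blast
    have Pp: "prime p" "b \<le> p" if "p \<in> P" for p using P that by auto
    define X where "X = (\<Pi>\<^sub>E p\<in>P. reduce p ` S)"
    define Y where "Y = (\<Pi>\<^sub>E p\<in>P. reduce p ` S - good p)"
    define x0 where "x0 = (\<lambda>p\<in>P. reduce p (1\<^sub>m n))"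
    define act where "act g f = (\<lambda>p\<in>P. reduce p (g * f p))" for g :: "int mat" and f :: "nat \<Rightarrow> int mat"
    have Xp: "x p \<in> carrier_mat n n" "reduce p (x p) = x p" if "x \<in> X" "p \<in> P" for x p
    proof -
      have "x p \<in> reduce p ` S" by (rule PiE_mem[OF that(1)[unfolded X_def] that(2)])
      then obtain g where "g \<in> S" "x p = reduce p g" by blast
      then show "x p \<in> carrier_mat n n" "reduce p (x p) = x p" using S by (auto simp: reduce_idem)
    qed
    have act_x0: "act g x0 = (\<lambda>p\<in>P. reduce p g)" if "g \<in> S" for g
    proof -
      have "g \<in> carrier_mat n n" using that S by auto
      then show ?thesis using reduce_mult_reduce[of g n "1\<^sub>m n"] by (auto simp: act_def x0_def intro!: restrict_ext)
    qed
    have "\<forall>\<^sub>F N in sequentially. walks G N \<noteq> {} \<and> ?prob N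
            {w. act (walk_prod ?G t w) x0 \<in> Y} \<le> card Y / card X + \<epsilon> / 2"
    proof (rule walk_equidistribution[OF group G _ _ PF char])
      show "\<forall>i<nverts G. t i \<in> carrier ?G" "generate ?G (t ` {..<nverts G}) = carrier ?G" using t gen by (auto simp: ops)
      show "finite X" unfolding X_def using P fin Pp by (intro finite_PiE) auto
      show "x0 \<in> X" using one by (auto simp: X_def x0_def)
      show "Y \<subseteq> X" by (auto simp: X_def Y_def PiE_iff)
      show "\<epsilon> / 2 > 0" using \<epsilon> by simp
    next
      fix g x assume g: "g \<in> carrier ?G" and x: "x \<in> X"
      show "act g x \<in> X"
        unfolding X_def act_def
      proof (rule restrict_PiE_iff[THEN iffD2], intro ballI)
        fix p assume p: "p \<in> P"
        obtain h where h: "h \<in> S" "x p = reduce p h" using PiE_mem[OF x[unfolded X_def] p] by blast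
        have "reduce p (g * x p) = reduce p (g * h)"
          using g h S by (auto simp: ops intro!: reduce_mult_reduce[of _ n])
        then show "reduce p (g * x p) \<in> reduce p ` S" using mult[of g h] g h by (simp add: ops)
      qed
    next
      fix g h x assume g: "g \<in> carrier ?G" and h: "h \<in> carrier ?G" and x: "x \<in> X"
      show "act (g \<otimes>\<^bsub>?G\<^esub> h) x = act g (act h x)"
        unfolding act_def ops
      proof (rule restrict_ext)
        fix p assume p: "p \<in> P"
        have c: "g \<in> carrier_mat n n" "h \<in> carrier_mat n n" "x p \<in> carrier_mat n n" using g h S Xp(1)[OF x p] by (auto simp: ops)
        have "reduce p (g * reduce p (h * x p)) = reduce p (g * (h * x p))"
          using c by (intro reduce_mult_reduce[of _ n]) auto
        then show "reduce p (g * h * x p) = reduce p (g * (\<lambda>p\<in>P. reduce p (h * x p)) p)"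
          using p assoc_mult_mat[OF c] by simp
      qed
    next
      fix x assume x: "x \<in> X"
      show "act \<one>\<^bsub>?G\<^esub> x = x"
      proof
        fix p
        show "act \<one>\<^bsub>?G\<^esub> x p = x p"
          using Xp[OF x, of p] PiE_arb[OF x[unfolded X_def], of p] by (cases "p \<in> P") (auto simp: act_def ops)
      qed
    next
      fix x assume x: "x \<in> X"
      obtain g where g: "g \<in> S" "\<And>p. p \<in> P \<Longrightarrow> reduce p g = x p"
      proof (rule simultaneous_reduction[OF group S P(2)])
        show "prime p" if "p \<in> P" for p using Pp that by blast
        show "reduces_well S n c p" if "p \<in> P" for p using well Pp that by blast
        show "x p \<in> reduce p ` S" if "p \<in> P" for p using PiE_mem[OF x[unfolded X_def] that] .
      qed blast
      have "act g x0 = x"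
        unfolding act_x0[OF g(1)]
      proof
        fix p show "(\<lambda>p\<in>P. reduce p g) p = x p"
          using g(2)[of p] PiE_arb[OF x[unfolded X_def], of p] by (cases "p \<in> P") auto
      qed
      then show "\<exists>g\<in>carrier ?G. act g x0 = x" using g(1) by (auto simp: ops)
    qed
    then show ?thesis
    proof eventually_elim
      case (elim N)
      have "real (card Y) / card X = (\<Prod>p\<in>P. real (card (reduce p ` S - good p)) / card (reduce p ` S))"
        unfolding X_def Y_def using P(2) by (simp add: card_PiE prod_dividef)
      also have "\<dots> \<le> (\<Prod>p\<in>P. 1 - 1 / real c)" using ratio Pp by (intro prod_mono) auto
      also have "\<dots> < \<epsilon> / 2" using k P(3) by simp
      finally have YX: "card Y / card X < \<epsilon> / 2" .
      have W: "finite (walks G N)" "walks G N \<noteq> {}" using finite_walks[OF G] elim by auto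
      have "walks G N \<inter> {w. ?bad w} \<subseteq> {w. act (walk_prod ?G t w) x0 \<in> Y}"
      proof
        fix w assume w: "w \<in> walks G N \<inter> {w. ?bad w}"
        let ?g = "walk_prod ?G t w"
        have vs: "set (fst w) \<subseteq> {..<nverts G}" using w by (auto simp: walks_def)
        have "fold (\<lambda>i g. t i \<otimes>\<^bsub>?G\<^esub> g) vs g \<in> S" if "set vs \<subseteq> {..<nverts G}" "g \<in> S" for vs g
          using that by (induction vs arbitrary: g) (use t mult in \<open>auto simp: ops\<close>)
        then have g: "?g \<in> S" using vs one by (simp add: walk_prod_def ops)
        have "reduce p ?g \<notin> good p" for p using w g by (auto simp: good_def)
        then have "act ?g x0 \<in> Y" using g by (auto simp: act_x0[OF g] Y_def)
        then show "w \<in> {w. act (walk_prod ?G t w) x0 \<in> Y}" by simp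
      qed
      then have "?prob N (walks G N \<inter> {w. ?bad w}) \<le>
            ?prob N {w. act (walk_prod ?G t w) x0 \<in> Y}"
        by (rule measure_pmf.finite_measure_mono) simp
      moreover have "?prob N (walks G N \<inter> {w. ?bad w}) =
            ?prob N {w. ?bad w}"
        using measure_Int_set_pmf[of "pmf_of_set (walks G N)" "{w. ?bad w}"] W by (simp add: Int_commute)
      ultimately show ?case using elim YX by linarith
    qed
  qed
  show ?thesis
  proof (rule tendstoI)
    fix \<epsilon> :: real assume "\<epsilon> > 0"
    from key[OF this] show "\<forall>\<^sub>F N in sequentially. dist (?prob N {w. ?bad w}) 0 < \<epsilon>"
      by eventually_elim (simp add: measure_nonneg)
  qed
qed

theorem theorem6p5:
  fixes n :: nat
    and \<Gamma> :: "int mat monoid"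
    and G :: "'e multigraph"
    and t :: "nat \<Rightarrow> int mat"
  assumes "(\<Gamma> = Sp n \<and> n \<ge> 1) \<or> (\<Gamma> = SL n \<and> n \<ge> 2)"
    and "finite_multigraph G"
    and "\<forall>i<nverts G. t i \<in> carrier \<Gamma>"
    and "generate \<Gamma> (t ` {..<nverts G}) = carrier \<Gamma>"
    and "perron_frobenius_matrix (adj_matrix G)"
    and "\<forall>\<rho>. nontrivial_unitary_character \<Gamma> \<rho> \<longrightarrow>
           (\<exists>i<nverts G. \<exists>j<nverts G. \<rho> (t i) \<noteq> \<rho> (t j))"
  shows "(\<lambda>N. measure_pmf.prob (pmf_of_set (walks G N))
            {w. \<not> irreducible (char_poly (walk_prod \<Gamma> t w))}) \<longlonglongrightarrow> 0"
proof -
  obtain S k d where S: "\<Gamma> = matrix_group k S" "group (matrix_group k S)" "S \<subseteq> carrier_mat k k"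
    and well: "\<And>p. prime p \<Longrightarrow> 8 * d \<le> p \<Longrightarrow> reduces_well S k (4 * d) p"
    using assms(1)
  proof (elim disjE conjE)
    assume n: "\<Gamma> = Sp n" "n \<ge> 1"
    show ?thesis
    proof (rule that[of "2 * n" "sp_mats n" n])
      show "reduces_well (sp_mats n) (2 * n) (4 * n) p" if "prime p" "8 * n \<le> p" for p
        using reduction_statement_all_primes[OF that(1)] that(2) n(2) by (simp add: reduction_statement_def)
    qed (auto simp: n Sp_eq group_sp dest: spD(1))
  next
    assume n: "\<Gamma> = SL n" "n \<ge> 2"
    show ?thesis
    proof (rule that[of n "sl_mats n" "n - 1"])
      show "reduces_well (sl_mats n) n (4 * (n - 1)) p" if "prime p" "8 * (n - 1) \<le> p" for p
      proof -
        have "n - 1 > 0" "n - 1 + 1 = n" using n(2) by auto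
        then show ?thesis using reduction_statement_all_primes[OF that(1)] that(2) unfolding reduction_statement_def by metis
      qed
    qed (auto simp: n SL_eq group_sl, auto simp: sl_mats_def)
  qed
  have ops: "carrier (matrix_group k S) = S" by (simp add: matrix_group_def)
  show ?thesis
    using walk_char_poly_irreducible[OF S(2,3) assms(2) _ _ assms(5) _ well] assms(3,4,6) unfolding S(1) ops by blast
qed

end
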